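(* Let the origin be a monodromic singularity of the family $\mathcal{X}$ with parameters in $\Lambda$, let $(p,q)\in W(\mathbf{N}(\mathcal{X}))$, and let $0\notin\Omega_{pq}$. Assume that the equation $\frac{d\rho}{d\varphi}=\mathcal{F}(\varphi,\rho)$ has a Laurent inverse integrating factor $V(\varphi,\rho)=\sum_{i\ge m}v_i(\varphi)\rho^i$ with multiplicity $m\in\mathbb{Z}$. Restrict the family to the parameter space $\Lambda\setminus\Lambda_{pq}$ and let $$G(r)=\int_0^{2\pi}\frac{\mathcal{F}(\varphi,r)}{V(\varphi,r)}\,d\varphi,\qquad r\in I^+,$$ where $I^+\subset(0,\infty)$ is a sufficiently small positive half-neighborhood of the origin. Then $G(r)=\mathfrak{g}\in\mathbb{R}$ is a constant in $I^+$. Moreover $\log\eta_1=\mathfrak{g}$ when $m=1$, and $\eta_m=\mathfrak{g}$ if $m>1$, where $\eta_i$ are the coefficients of the formal power series expansion $\Pi(\rho)=\sum_{i\ge1}\eta_i\rho^i$ of the Poincaré map $\Pi$ of the origin.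
   Context: Family. $\mathcal{X} = P(x,y;\lambda)\partial_x + Q(x,y;\lambda)\partial_y$ is a family of real analytic planar vector fields depending analytically on parameters $\lambda \in \mathbb{R}^d$. $\Lambda \subset \mathbb{R}^d$ is the parameter space for which the origin is a monodromic singularity: $P(0,0;\lambda)=Q(0,0;\lambda)=0$ and the local orbits turn around the origin. Newton diagram and weights. Write $P = \sum a_{ij} x^i y^{j-1}$, $Q = \sum b_{ij} x^{i-1} y^j$ with $(i,j) \in \mathbb{N}^2$; let $\mathrm{supp}(\mathcal{X}) = \{(i,j) : (a_{ij},b_{ij}) \ne (0,0)\}$. The boundary of the convex hull of $\bigcup_{(i,j)\in \mathrm{supp}(\mathcal{X})} \{(i,j)+\mathbb{R}_+^2\}$ contains a polygon; in the monodromic case the Newton diagram $\mathbf{N}(\mathcal{X})$ consists of the edges of this polygon. To each edge one associates weights $(p,q)\in\mathbb{N}^2$, $p,q$ coprime, where $q/p$ is the tangent of the angle between the edge and the ordinate axis. $W(\mathbf{N}(\mathcal{X}))$ is the set of all these weights. Given $(p,q)\in W(\mathbf{N}(\mathcal{X}))$, expand $\mathcal{X} = \sum_{j\ge r_0}\mathcal{X}_j$ with $r_0\ge 1$, where $\mathcal{X}_j = P_{p+j}\partial_x + Q_{q+j}\partial_y$ is $(p,q)$-quasihomogeneous of degree $j$ (i.e. $P_{p+j}(s^p x, s^q y)=s^{p+j}P_{p+j}(x,y)$, $Q_{q+j}(s^p x, s^q y)=s^{q+j}Q_{q+j}(x,y)$) and $\mathcal{X}_{r_0}\not\equiv 0$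 is the leading part. Polar equation. The weighted polar blow-up $(x,y) = (\rho^p\cos\varphi, \rho^q\sin\varphi)$, after division by $\rho^{r_0}$ (time rescaling), transforms the system into $\dot\rho = R(\varphi,\rho)$, $\dot\varphi=\Theta(\varphi,\rho)$, with $R(\varphi,0)\equiv 0$. Put $\mathcal{F}=R/\Theta$. Let $C = \{(\varphi,\rho)\in \mathbb{S}^1\times\mathbb{R} : 0\le\rho\ll 1\}$, $\mathbb{S}^1=\mathbb{R}/(2\pi\mathbb{Z})$; the radial interval of $C$ is $I=\{0\}\cup I^+$. $\Theta^{-1}(0) = \{(\varphi,\rho)\in C: \Theta(\varphi,\rho)=0\}$. Characteristic directions: $\Omega_{pq}=\{\varphi^*\in\mathbb{S}^1:\Theta(\varphi^*,0)=0\}$. Critical parameters: $\Lambda_{pq} = \{\lambda\in\Lambda : \Theta^{-1}(0)\setminus\{\rho=0\}\neq\emptyset\}$. Inverse integrating factor: a not locally null real-valued function $V$ of class $C^1$ on $C\setminus(\Theta^{-1}(0)\cup\{\rho=0\})$ with $\frac{\partial V}{\partial\varphi} + \frac{\partial V}{\partial\rho}\mathcal{F} = \frac{\partial\mathcal{F}}{\partial\rho}V$ there. It is a Laurent inverse integrating factor of multiplicity $m\in\mathbb{Z}$ if it can be expanded in a convergent Laurent series about $\rho=0$, $V(\varphi,\rho)=\sum_{i\ge m}v_i(\varphi)\rho^i$, with $C^1$ coefficients $v_i:\mathbb{S}^1\setminus\Omega_{pq}\to\mathbb{R}$ and $v_m\not\equiv0$; $m$ is a fixed number. Poincaré map: $\Phi(\varphi;\rho_0)$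 is the solution of $d\rho/d\varphi=\mathcal{F}(\varphi,\rho)$ with $\Phi(0;\rho_0)=\rho_0>0$ sufficiently small, and $\Pi(\rho_0) = \Phi(2\pi;\rho_0)$ (i.e. the section $\{(x,0): 0<x\ll1\}$ is parameterized by $x=\rho_0^p$). Under the stated hypotheses and for parameters in $\Lambda\setminus\Lambda_{pq}$, $\Pi$ has a formal power series expansion $\Pi(\rho)=\sum_{i\ge1}\eta_i\rho^i$.
   Formalization: Since V may be rescaled by a constant (which changes g but not Π), the formulas are corrected to log η_1 = v_m(0)·g when m=1 and η_m = v_m(0)·g when m>1; they agree with the stated ones when V is normalized by v_m(0)=1. *)

theory Defs
  imports "HOL-Analysis.Analysis" "HOL-Library.Landau_Symbols"
begin

text \<open>
  Planar vector fields are given by their components \<open>P x y\<close> and \<open>Q x y\<close>; a family adds the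
  parameter as a first argument. Functions on the circle are functions on the reals of
  period \<open>2 * pi\<close>. The cylinder \<open>0 \<le> \<rho>\<close>, \<open>\<rho>\<close> small, is \<open>0 \<le> \<rho> < \<epsilon>\<close> for a positive \<open>\<epsilon>\<close>.
\<close>

text \<open>The multi-indices are the functions from \<open>Basis\<close> to the naturals.\<close>

definition real_analytic_at :: "('a::euclidean_space \<Rightarrow> real) \<Rightarrow> 'a \<Rightarrow> bool" where
  "real_analytic_at f a \<longleftrightarrow>
     (\<exists>c r. 0 < r \<and>
        (\<forall>x\<in>ball a r.
           ((\<lambda>\<alpha>::'a \<Rightarrow> nat. c \<alpha> * (\<Prod>b\<in>Basis. ((x - a) \<bullet> b) ^ \<alpha> b)) has_sum f x)
             (Basis \<rightarrow>\<^sub>E UNIV)))"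

definition analytic_family ::
    "(real ^ 'd \<Rightarrow> real \<Rightarrow> real \<Rightarrow> real) \<Rightarrow> (real ^ 'd \<Rightarrow> real \<Rightarrow> real \<Rightarrow> real) \<Rightarrow> bool" where
  "analytic_family P Q \<longleftrightarrow>
     (\<forall>\<mu>. real_analytic_at (\<lambda>(x, y, \<nu>). P \<nu> x y) (0, 0, \<mu>) \<and>
          real_analytic_at (\<lambda>(x, y, \<nu>). Q \<nu> x y) (0, 0, \<mu>))"

text \<open>
  The orbits turn around the origin: every orbit starting close to the origin makes a full
  turn around it while staying close to it. Here \<open>\<theta>\<close> is a continuous choice of the angle
  along the orbit \<open>\<gamma>\<close>; both senses of rotation are allowed.
\<close>

definition monodromic :: "(real \<Rightarrow> real \<Rightarrow> real) \<Rightarrow> (real \<Rightarrow> real \<Rightarrow> real) \<Rightarrow> bool" where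
  "monodromic P Q \<longleftrightarrow>
     P 0 0 = 0 \<and> Q 0 0 = 0 \<and>
     (\<forall>\<epsilon>>0. \<exists>\<delta>>0. \<forall>z::real \<times> real. 0 < norm z \<and> norm z < \<delta> \<longrightarrow>
        (\<exists>T \<gamma> \<theta>. 0 < T \<and> \<gamma> 0 = z \<and>
           (\<forall>t\<in>{0..T}.
              (\<gamma> has_vector_derivative
                 (P (fst (\<gamma> t)) (snd (\<gamma> t)), Q (fst (\<gamma> t)) (snd (\<gamma> t)))) (at t within {0..T}) \<and>
              0 < norm (\<gamma> t) \<and> norm (\<gamma> t) < \<epsilon> \<and>
              \<gamma> t = norm (\<gamma> t) *\<^sub>R (cos (\<theta> t), sin (\<theta> t))) \<and>
           continuous_on {0..T} \<theta> \<and> \<bar>\<theta> T - \<theta> 0\<bar> = 2 * pi))"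

definition monodromic_parameters ::
    "(real ^ 'd \<Rightarrow> real \<Rightarrow> real \<Rightarrow> real) \<Rightarrow> (real ^ 'd \<Rightarrow> real \<Rightarrow> real \<Rightarrow> real) \<Rightarrow> (real ^ 'd) set" where
  "monodromic_parameters P Q = {\<mu>. monodromic (P \<mu>) (Q \<mu>)}"

text \<open>Only meaningful for functions that are analytic at the origin.\<close>

definition taylor_coeff :: "(real \<Rightarrow> real \<Rightarrow> real) \<Rightarrow> nat \<Rightarrow> nat \<Rightarrow> real" where
  "taylor_coeff f =
     (THE c. \<exists>r>0. \<forall>x y. \<bar>x\<bar> < r \<and> \<bar>y\<bar> < r \<longrightarrow>
        ((\<lambda>(i, j). c i j * x ^ i * y ^ j) has_sum f x y) UNIV)"

text \<open>
  With \<open>P = \<Sum> a\<^sub>i\<^sub>j x\<^sup>i y\<^sup>j\<^sup>-\<^sup>1\<close> and \<open>Q = \<Sum> b\<^sub>i\<^sub>j x\<^sup>i\<^sup>-\<^sup>1 y\<^sup>j\<close>, the support is the set of the \<open>(i, j)\<close> such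
  that \<open>(a\<^sub>i\<^sub>j, b\<^sub>i\<^sub>j) \<noteq> (0, 0)\<close>.
\<close>

definition vf_support :: "(real \<Rightarrow> real \<Rightarrow> real) \<Rightarrow> (real \<Rightarrow> real \<Rightarrow> real) \<Rightarrow> (nat \<times> nat) set" where
  "vf_support P Q =
     {(i, j). (1 \<le> j \<and> taylor_coeff P i (j - 1) \<noteq> 0) \<or> (1 \<le> i \<and> taylor_coeff Q (i - 1) j \<noteq> 0)}"

definition newton_hull ::
    "(real \<Rightarrow> real \<Rightarrow> real) \<Rightarrow> (real \<Rightarrow> real \<Rightarrow> real) \<Rightarrow> (real \<times> real) set" where
  "newton_hull P Q =
     convex hull (\<Union>(i, j)\<in>vf_support P Q. {real i..} \<times> {real j..})"

text \<open>
  The boundary of the hull consists of two half-lines parallel to the axes and of a polygon,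
  whose edges are the bounded edges of the hull.
\<close>

definition newton_diagram ::
    "(real \<Rightarrow> real \<Rightarrow> real) \<Rightarrow> (real \<Rightarrow> real \<Rightarrow> real) \<Rightarrow> (real \<times> real) set set" where
  "newton_diagram P Q = {e. e edge_of newton_hull P Q \<and> bounded e}"

text \<open>\<open>q / p\<close> is the tangent of the angle between the edge and the ordinate axis.\<close>

definition newton_weights ::
    "(real \<Rightarrow> real \<Rightarrow> real) \<Rightarrow> (real \<Rightarrow> real \<Rightarrow> real) \<Rightarrow> (nat \<times> nat) set" where
  "newton_weights P Q =
     {(p, q). 0 < p \<and> 0 < q \<and> coprime p q \<and>
        (\<exists>e\<in>newton_diagram P Q. \<forall>z\<in>e. \<forall>w\<in>e. z \<noteq> w \<longrightarrow>
           real q / real p = \<bar>fst z - fst w\<bar> / \<bar>snd z - snd w\<bar>)}"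

definition qh_part :: "nat \<Rightarrow> nat \<Rightarrow> (real \<Rightarrow> real \<Rightarrow> real) \<Rightarrow> int \<Rightarrow> real \<Rightarrow> real \<Rightarrow> real" where
  "qh_part p q f n x y =
     (\<Sum>(i, j)\<in>{(i, j). int (p * i + q * j) = n}. taylor_coeff f i j * x ^ i * y ^ j)"

text \<open>
  The component of degree \<open>j\<close> of the vector field is
  \<open>(qh_part p q P (p + j), qh_part p q Q (q + j))\<close>.
\<close>

definition leading_degree ::
    "(real \<Rightarrow> real \<Rightarrow> real) \<Rightarrow> (real \<Rightarrow> real \<Rightarrow> real) \<Rightarrow> nat \<Rightarrow> nat \<Rightarrow> int" where
  "leading_degree P Q p q =
     (LEAST j. \<exists>x y. (qh_part p q P (int p + j) x y, qh_part p q Q (int q + j) x y) \<noteq> (0, 0))"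

text \<open>
  For \<open>x = \<rho>\<^sup>p cos \<phi>\<close> and \<open>y = \<rho>\<^sup>q sin \<phi>\<close>, the equations
  \<open>p \<rho>\<^sup>p\<^sup>-\<^sup>1 cos \<phi> \<rho>' - \<rho>\<^sup>p sin \<phi> \<phi>' = P\<close> and \<open>q \<rho>\<^sup>q\<^sup>-\<^sup>1 sin \<phi> \<rho>' + \<rho>\<^sup>q cos \<phi> \<phi>' = Q\<close> are solved for \<open>\<rho>'\<close>
  and \<open>\<phi>'\<close>, and the solution is divided by \<open>\<rho>\<close> to the power \<open>leading_degree\<close>. The values at
  \<open>\<rho> = 0\<close> are those of the analytic extension; they come from the leading part only.
\<close>

definition polar_R ::
    "(real \<Rightarrow> real \<Rightarrow> real) \<Rightarrow> (real \<Rightarrow> real \<Rightarrow> real) \<Rightarrow> nat \<Rightarrow> nat \<Rightarrow> real \<Rightarrow> real \<Rightarrow> real" where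
  "polar_R P Q p q \<phi> \<rho> =
     (if \<rho> = 0 then 0
      else (let x = \<rho> ^ p * cos \<phi>; y = \<rho> ^ q * sin \<phi> in
        (\<rho> ^ q * cos \<phi> * P x y + \<rho> ^ p * sin \<phi> * Q x y)
        / (\<rho> ^ (p + q - 1) * (real p * (cos \<phi>)\<^sup>2 + real q * (sin \<phi>)\<^sup>2))
        / \<rho> powi leading_degree P Q p q))"

definition polar_Theta ::
    "(real \<Rightarrow> real \<Rightarrow> real) \<Rightarrow> (real \<Rightarrow> real \<Rightarrow> real) \<Rightarrow> nat \<Rightarrow> nat \<Rightarrow> real \<Rightarrow> real \<Rightarrow> real" where
  "polar_Theta P Q p q \<phi> \<rho> =
     (if \<rho> = 0 then
        (real p * cos \<phi> * qh_part p q Q (int q + leading_degree P Q p q) (cos \<phi>) (sin \<phi>)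
         - real q * sin \<phi> * qh_part p q P (int p + leading_degree P Q p q) (cos \<phi>) (sin \<phi>))
        / (real p * (cos \<phi>)\<^sup>2 + real q * (sin \<phi>)\<^sup>2)
      else (let x = \<rho> ^ p * cos \<phi>; y = \<rho> ^ q * sin \<phi> in
        (real p * \<rho> ^ (p - 1) * cos \<phi> * Q x y - real q * \<rho> ^ (q - 1) * sin \<phi> * P x y)
        / (\<rho> ^ (p + q - 1) * (real p * (cos \<phi>)\<^sup>2 + real q * (sin \<phi>)\<^sup>2))
        / \<rho> powi leading_degree P Q p q))"

definition polar_F ::
    "(real \<Rightarrow> real \<Rightarrow> real) \<Rightarrow> (real \<Rightarrow> real \<Rightarrow> real) \<Rightarrow> nat \<Rightarrow> nat \<Rightarrow> real \<Rightarrow> real \<Rightarrow> real" where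
  "polar_F P Q p q \<phi> \<rho> = polar_R P Q p q \<phi> \<rho> / polar_Theta P Q p q \<phi> \<rho>"

definition characteristic_directions ::
    "(real \<Rightarrow> real \<Rightarrow> real) \<Rightarrow> (real \<Rightarrow> real \<Rightarrow> real) \<Rightarrow> nat \<Rightarrow> nat \<Rightarrow> real set" where
  "characteristic_directions P Q p q = {\<phi>. polar_Theta P Q p q \<phi> 0 = 0}"

text \<open>A parameter is critical if there are zeros with \<open>\<rho> > 0\<close> however small the cylinder is.\<close>

definition critical_parameters ::
    "(real ^ 'd \<Rightarrow> real \<Rightarrow> real \<Rightarrow> real) \<Rightarrow> (real ^ 'd \<Rightarrow> real \<Rightarrow> real \<Rightarrow> real) \<Rightarrow> nat \<Rightarrow> nat
      \<Rightarrow> (real ^ 'd) set" where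
  "critical_parameters P Q p q =
     {\<mu> \<in> monodromic_parameters P Q.
        \<forall>\<epsilon>>0. \<exists>\<phi> \<rho>. 0 < \<rho> \<and> \<rho> < \<epsilon> \<and> polar_Theta (P \<mu>) (Q \<mu>) p q \<phi> \<rho> = 0}"

definition polar_domain ::
    "(real \<Rightarrow> real \<Rightarrow> real) \<Rightarrow> (real \<Rightarrow> real \<Rightarrow> real) \<Rightarrow> nat \<Rightarrow> nat \<Rightarrow> real \<Rightarrow> (real \<times> real) set" where
  "polar_domain P Q p q \<epsilon> = {(\<phi>, \<rho>). 0 < \<rho> \<and> \<rho> < \<epsilon> \<and> polar_Theta P Q p q \<phi> \<rho> \<noteq> 0}"

definition inverse_integrating_factor ::
    "(real \<Rightarrow> real \<Rightarrow> real) \<Rightarrow> (real \<Rightarrow> real \<Rightarrow> real) \<Rightarrow> nat \<Rightarrow> nat \<Rightarrow> real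
      \<Rightarrow> (real \<Rightarrow> real \<Rightarrow> real) \<Rightarrow> bool" where
  "inverse_integrating_factor P Q p q \<epsilon> V \<longleftrightarrow>
     (\<forall>(\<phi>, \<rho>)\<in>polar_domain P Q p q \<epsilon>. V (\<phi> + 2 * pi) \<rho> = V \<phi> \<rho>) \<and>
     (\<exists>V1 V2. continuous_on (polar_domain P Q p q \<epsilon>) V1 \<and>
              continuous_on (polar_domain P Q p q \<epsilon>) V2 \<and>
              (\<forall>z\<in>polar_domain P Q p q \<epsilon>.
                 ((\<lambda>(\<phi>, \<rho>). V \<phi> \<rho>) has_derivative (\<lambda>(a, b). a * V1 z + b * V2 z)) (at z))) \<and>
     (\<forall>U. open U \<and> U \<noteq> {} \<and> U \<subseteq> polar_domain P Q p q \<epsilon> \<longrightarrow> (\<exists>(\<phi>, \<rho>)\<in>U. V \<phi> \<rho> \<noteq> 0)) \<and>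
     (\<forall>(\<phi>, \<rho>)\<in>polar_domain P Q p q \<epsilon>.
        deriv (\<lambda>s. V s \<rho>) \<phi> + deriv (\<lambda>s. V \<phi> s) \<rho> * polar_F P Q p q \<phi> \<rho>
        = deriv (\<lambda>s. polar_F P Q p q \<phi> s) \<rho> * V \<phi> \<rho>)"

text \<open>
  The radius of convergence of the Laurent series may depend on the angle. Nonzero constant
  multiples of \<open>V\<close> are again of this kind; the value \<open>v m 0\<close> records the scaling.
\<close>

definition laurent_inverse_integrating_factor ::
    "(real \<Rightarrow> real \<Rightarrow> real) \<Rightarrow> (real \<Rightarrow> real \<Rightarrow> real) \<Rightarrow> nat \<Rightarrow> nat \<Rightarrow> real
      \<Rightarrow> (real \<Rightarrow> real \<Rightarrow> real) \<Rightarrow> (int \<Rightarrow> real \<Rightarrow> real) \<Rightarrow> int \<Rightarrow> bool" where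
  "laurent_inverse_integrating_factor P Q p q \<epsilon> V v m \<longleftrightarrow>
     inverse_integrating_factor P Q p q \<epsilon> V \<and>
     (\<forall>i\<ge>m. v i C1_differentiable_on (- characteristic_directions P Q p q) \<and>
        (\<forall>\<phi>. \<phi> \<notin> characteristic_directions P Q p q \<longrightarrow> v i (\<phi> + 2 * pi) = v i \<phi>)) \<and>
     (\<forall>\<phi>. \<phi> \<notin> characteristic_directions P Q p q \<longrightarrow>
        (\<exists>r>0. \<forall>\<rho>. 0 < \<rho> \<and> \<rho> < r \<longrightarrow>
           ((\<lambda>i. v i \<phi> * \<rho> powi i) has_sum V \<phi> \<rho>) {m..})) \<and>
     (\<exists>\<phi>. \<phi> \<notin> characteristic_directions P Q p q \<and> v m \<phi> \<noteq> 0)"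

text \<open>\<open>\<Phi> \<phi> \<rho>\<^sub>0\<close> is the value at \<open>\<phi>\<close> of the solution that starts at \<open>\<rho>\<^sub>0\<close>; the Poincare map is \<open>\<Phi> (2 * pi)\<close>.\<close>

definition polar_flow ::
    "(real \<Rightarrow> real \<Rightarrow> real) \<Rightarrow> (real \<Rightarrow> real \<Rightarrow> real) \<Rightarrow> nat \<Rightarrow> nat \<Rightarrow> real
      \<Rightarrow> (real \<Rightarrow> real \<Rightarrow> real) \<Rightarrow> bool" where
  "polar_flow P Q p q \<epsilon> \<Phi> \<longleftrightarrow>
     (\<exists>\<delta>>0. \<forall>\<rho>\<^sub>0. 0 < \<rho>\<^sub>0 \<and> \<rho>\<^sub>0 < \<delta> \<longrightarrow>
        \<Phi> 0 \<rho>\<^sub>0 = \<rho>\<^sub>0 \<and>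
        (\<forall>\<phi>\<in>{0..2 * pi}.
           (\<phi>, \<Phi> \<phi> \<rho>\<^sub>0) \<in> polar_domain P Q p q \<epsilon> \<and>
           ((\<lambda>s. \<Phi> s \<rho>\<^sub>0) has_real_derivative polar_F P Q p q \<phi> (\<Phi> \<phi> \<rho>\<^sub>0))
             (at \<phi> within {0..2 * pi})))"

text \<open>The formal series need not converge; it is the asymptotic expansion of the function at \<open>0\<close>.\<close>

definition formal_expansion :: "(real \<Rightarrow> real) \<Rightarrow> (nat \<Rightarrow> real) \<Rightarrow> bool" where
  "formal_expansion f \<eta> \<longleftrightarrow>
     (\<forall>N. (\<lambda>\<rho>. f \<rho> - (\<Sum>i=1..N. \<eta> i * \<rho> ^ i)) \<in> o[at_right 0](\<lambda>\<rho>. \<rho> ^ N))"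

end

theory Submission
  imports Defs
begin

text \<open>
  Let \<open>F\<close> be the right-hand side of the polar equation and \<open>V\<close> an inverse integrating factor. Where
  neither \<open>V\<close> nor the angular speed vanishes, the equation for \<open>V\<close> says that the 1-form
  \<open>(F d\<phi> - d\<rho>) / V\<close> is closed: both \<open>\<partial>(F / V) / \<partial>\<rho>\<close> and \<open>\<partial>(- 1 / V) / \<partial>\<phi>\<close> are equal to
  \<open>V\<^sub>\<phi> / V\<^sup>2\<close>. Everything follows from this.

  \<^item> The derivative of \<open>G(r) = \<integral> F(\<phi>, r) / V(\<phi>, r) d\<phi>\<close> is the integral of \<open>\<partial>(- 1 / V) / \<partial>\<phi>\<close> over
    a period, which is zero. Hence \<open>G\<close> is a constant \<open>g\<close> (\<open>integral_constant\<close>).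

  \<^item> On a rectangle the form has a potential. It is constant along the solutions of the polar
    equation. Its values at the two ends of the solution from \<open>(0, r)\<close> to \<open>(2\<pi>, \<Pi>(r))\<close>
    show that the integral of \<open>1 / V(0, \<rho>)\<close> from \<open>\<rho> = r\<close> to \<open>\<rho> = \<Pi>(r)\<close> is \<open>g\<close> (\<open>transit_identity\<close>).

  \<^item> The Laurent series gives \<open>V(0, \<rho>) / \<rho>\<^sup>m \<rightarrow> v\<^sub>m(0)\<close>. By the mean value theorem the identity then
    yields \<open>log (\<Pi>(r) / r) \<rightarrow> v\<^sub>m(0) g\<close> for \<open>m = 1\<close> and \<open>(\<Pi>(r) - r) / r\<^sup>m \<rightarrow> v\<^sub>m(0) g\<close> for \<open>m > 1\<close>
    (\<open>poincare_map_asymptotics\<close>). The coefficients of \<open>\<Pi>\<close> are read off from these limits.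

  Monodromy is used for two facts. First, \<open>V\<close> has no zeros near \<open>\<rho> = 0\<close>
  (\<open>nonvanishing_strip_exists\<close>). Along an orbit \<open>V\<close> solves a linear differential equation, so it
  vanishes everywhere on the orbit or nowhere. Every orbit close to the origin crosses
  \<open>\<phi> = 0\<close>, where \<open>V\<close> is a Laurent series: if that series were zero, \<open>V\<close> would be
  locally null, and otherwise it has no zeros close to \<open>0\<close>. Second, a solution that starts and
  ends close to \<open>\<rho> = 0\<close> stays where \<open>V\<close> has no zeros (\<open>solution_confined\<close>). The
  monodromic orbit through one of its ends makes a full turn at small radii, it has the same
  value of the potential, and the potential is injective in \<open>\<rho>\<close>. So the two curves coincide.

  Monodromy is a statement about curves in the plane and the Euclidean angle. It is carried over to
  the weighted angle \<open>\<phi>\<close> by an explicit lift (\<open>weighted_polar_lift\<close>). The lifted curve is only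
  known to be continuous; that it is differentiable follows from the invertibility of the Jacobian
  of the polar coordinates (\<open>has_derivative_lift\<close>).
\<close>

section \<open>Analytic functions are continuously differentiable\<close>

text \<open>
  The derivative is taken in the full plane, also when \<open>S\<close> is not open, so that it can be
  composed with any curve that meets \<open>S\<close>.
\<close>

definition C1_on :: "(real \<times> real) set \<Rightarrow> (real \<Rightarrow> real \<Rightarrow> real) \<Rightarrow> bool" where
  "C1_on S f \<longleftrightarrow> (\<exists>fx fy. continuous_on S fx \<and> continuous_on S fy \<and>
     (\<forall>z\<in>S. ((\<lambda>(x, y). f x y) has_derivative (\<lambda>(a, b). a * fx z + b * fy z)) (at z)))"

lemma C1_on_subset: "C1_on S f \<Longrightarrow> S' \<subseteq> S \<Longrightarrow> C1_on S' f"
  unfolding C1_on_def by (meson continuous_on_subset subsetD)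

text \<open>
  At \<open>\<nu> = \<mu>\<close> a monomial vanishes as soon as one of its exponents in the parameter directions is
  positive. What remains of the series is indexed by the exponents of \<open>x\<close> and \<open>y\<close>.
\<close>

lemma analytic_slice_double_series:
  fixes f :: "real ^ 'd \<Rightarrow> real \<Rightarrow> real \<Rightarrow> real"
  assumes "real_analytic_at (\<lambda>(x, y, \<nu>). f \<nu> x y) (0, 0, \<mu>)"
  shows "\<exists>c r. 0 < r \<and> (\<forall>x y. \<bar>x\<bar> < r \<and> \<bar>y\<bar> < r \<longrightarrow>
    ((\<lambda>(i, j). c i j * x ^ i * y ^ j) has_sum f \<mu> x y) UNIV)"
proof -
  obtain C r where r: "0 < r" and C: "\<And>z. z \<in> ball (0, 0, \<mu>) r \<Longrightarrow>
      ((\<lambda>\<alpha>::(real \<times> real \<times> (real^'d)) \<Rightarrow> nat. C \<alpha> * (\<Prod>b\<in>Basis. ((z - (0, 0, \<mu>)) \<bullet> b) ^ \<alpha> b))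
         has_sum (case z of (x, y, \<nu>) \<Rightarrow> f \<nu> x y)) (Basis \<rightarrow>\<^sub>E UNIV)"
    using assms unfolding real_analytic_at_def by blast
  define e1 :: "real \<times> real \<times> (real^'d)" where "e1 = (1, 0, 0)"
  define e2 :: "real \<times> real \<times> (real^'d)" where "e2 = (0, 1, 0)"
  define emb where "emb = (\<lambda>(i::nat, j::nat). \<lambda>b::real \<times> real \<times> (real^'d).
      if b \<in> Basis then (if b = e1 then i else if b = e2 then j else 0) else undefined)"
  have e: "e1 \<in> Basis" "e2 \<in> Basis" "e1 \<noteq> e2"
    by (auto simp: e1_def e2_def Basis_prod_def zero_prod_def)
  have inj: "inj emb"
  proof (rule injI)
    fix a b assume "emb a = emb b"
    then have "emb a e1 = emb b e1" "emb a e2 = emb b e2" by auto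
    then show "a = b" using e by (cases a; cases b) (auto simp: emb_def)
  qed
  have other: "((x, y, 0) :: real \<times> real \<times> (real^'d)) \<bullet> b = 0" if "b \<in> Basis - {e1, e2}" for x y b
    using that by (auto simp: e1_def e2_def Basis_prod_def zero_prod_def)
  have prod: "(\<Prod>b\<in>Basis. (((x, y, 0) :: real \<times> real \<times> (real^'d)) \<bullet> b) ^ \<alpha> b)
      = x ^ \<alpha> e1 * y ^ \<alpha> e2 * (\<Prod>b\<in>Basis - {e1, e2}. 0 ^ \<alpha> b)" for x y \<alpha>
  proof -
    have "Basis = insert e1 (insert e2 (Basis - {e1, e2}))" using e by auto
    then have "(\<Prod>b\<in>Basis. (((x, y, 0) :: real \<times> real \<times> (real^'d)) \<bullet> b) ^ \<alpha> b)
      = (\<Prod>b\<in>insert e1 (insert e2 (Basis - {e1, e2})). (((x, y, 0) :: real \<times> real \<times> (real^'d)) \<bullet> b) ^ \<alpha> b)"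
      by simp
    also have "\<dots> = ((x, y, 0) \<bullet> e1) ^ \<alpha> e1 * (((x, y, 0) \<bullet> e2) ^ \<alpha> e2 *
        (\<Prod>b\<in>Basis - {e1, e2}. (((x, y, 0) :: real \<times> real \<times> (real^'d)) \<bullet> b) ^ \<alpha> b))"
      using e by (subst prod.insert; simp)
    also have "(\<Prod>b\<in>Basis - {e1, e2}. (((x, y, 0) :: real \<times> real \<times> (real^'d)) \<bullet> b) ^ \<alpha> b)
        = (\<Prod>b\<in>Basis - {e1, e2}. 0 ^ \<alpha> b)"
      using other by (intro prod.cong) simp_all
    also have "(x, y, 0 :: real^'d) \<bullet> e1 = x" by (simp add: e1_def)
    also have "(x, y, 0 :: real^'d) \<bullet> e2 = y" by (simp add: e2_def)
    finally show ?thesis by simp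
  qed
  show ?thesis
  proof (rule exI[of _ "\<lambda>i j. C (emb (i, j))"], rule exI[of _ "r / 2"], intro conjI allI impI)
    show "0 < r / 2" using r by simp
    fix x y :: real assume xy: "\<bar>x\<bar> < r / 2 \<and> \<bar>y\<bar> < r / 2"
    have "norm (x, y, 0 :: real^'d) \<le> \<bar>x\<bar> + \<bar>y\<bar>"
      using norm_Pair_le[of x "(y, 0 :: real^'d)"] norm_Pair_le[of y "0 :: real^'d"] by simp
    then have "(x, y, \<mu>) \<in> ball (0, 0, \<mu>) r"
      using xy by (simp add: dist_norm norm_minus_commute norm_Pair)
    from C[OF this] have hs: "((\<lambda>\<alpha>. C \<alpha> * (x ^ \<alpha> e1 * y ^ \<alpha> e2 * (\<Prod>b\<in>Basis - {e1, e2}. 0 ^ \<alpha> b)))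
         has_sum f \<mu> x y) (Basis \<rightarrow>\<^sub>E UNIV)"
      by (simp add: prod)
    have "((\<lambda>\<alpha>. C \<alpha> * (x ^ \<alpha> e1 * y ^ \<alpha> e2 * (\<Prod>b\<in>Basis - {e1, e2}. 0 ^ \<alpha> b)))
         has_sum f \<mu> x y) (range emb)"
    proof (rule iffD1[OF has_sum_cong_neutral hs])
      fix \<alpha> assume "\<alpha> \<in> (Basis \<rightarrow>\<^sub>E UNIV) - range emb"
      then have "\<alpha> \<noteq> emb (\<alpha> e1, \<alpha> e2)" and ext: "\<alpha> \<in> Basis \<rightarrow>\<^sub>E UNIV" by auto
      then obtain b where "\<alpha> b \<noteq> emb (\<alpha> e1, \<alpha> e2) b" unfolding fun_eq_iff by blast
      moreover from this have "b \<in> Basis"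
        using PiE_arb[OF ext, of b] by (cases "b \<in> Basis") (auto simp: emb_def)
      ultimately have "b \<in> Basis - {e1, e2}" "\<alpha> b \<noteq> 0"
        using e by (auto simp: emb_def split: if_splits)
      then have "(\<Prod>b\<in>Basis - {e1, e2}. (0::real) ^ \<alpha> b) = 0"
        by (intro prod_zero) auto
      then show "C \<alpha> * (x ^ \<alpha> e1 * y ^ \<alpha> e2 * (\<Prod>b\<in>Basis - {e1, e2}. 0 ^ \<alpha> b)) = 0" by simp
    next
      fix \<alpha> assume "\<alpha> \<in> range emb - (Basis \<rightarrow>\<^sub>E UNIV)"
      then show "C \<alpha> * (x ^ \<alpha> e1 * y ^ \<alpha> e2 * (\<Prod>b\<in>Basis - {e1, e2}. 0 ^ \<alpha> b)) = 0"
        by (auto simp: emb_def)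
    qed auto
    then have "((\<lambda>\<alpha>. C \<alpha> * (x ^ \<alpha> e1 * y ^ \<alpha> e2 * (\<Prod>b\<in>Basis - {e1, e2}. 0 ^ \<alpha> b))) \<circ> emb
         has_sum f \<mu> x y) UNIV"
      using inj by (subst (asm) has_sum_reindex) auto
    then show "((\<lambda>(i, j). C (emb (i, j)) * x ^ i * y ^ j) has_sum f \<mu> x y) UNIV"
      by (rule iffD1[OF has_sum_cong, rotated])
        (use e in \<open>auto simp: emb_def intro!: prod.neutral\<close>)
  qed
qed

text \<open>
  The series is differentiated term by term. If it converges absolutely at \<open>(2s, 2s)\<close> then
  \<open>i \<le> 2\<^sup>i\<close> bounds the terms of the derived series on the square of half-width \<open>s\<close> by those of a
  convergent series.
\<close>

lemma double_power_series_C1: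
  fixes f :: "real \<Rightarrow> real \<Rightarrow> real" and c :: "nat \<Rightarrow> nat \<Rightarrow> real"
  assumes "0 < r"
    and f: "\<And>x y. \<bar>x\<bar> < r \<Longrightarrow> \<bar>y\<bar> < r \<Longrightarrow> ((\<lambda>(i, j). c i j * x ^ i * y ^ j) has_sum f x y) UNIV"
  shows "\<exists>s>0. C1_on ({-s<..<s} \<times> {-s<..<s}) f"
proof -
  \<comment> \<open>Any \<open>s\<close> with \<open>2 * s < r\<close> serves: the series is compared with its values at \<open>2 * s\<close>.\<close>
  define s where "s = r / 4"
  define B where "B = {-s<..<s} \<times> {-s<..<s}"
  have s: "0 < s" "2 * s < r" using \<open>0 < r\<close> by (auto simp: s_def)
  define I where "I n = fst (prod_decode n)" for n
  define J where "J n = snd (prod_decode n)" for n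
  define k where "k n = c (I n) (J n)" for n
  define M where "M n = \<bar>k n\<bar> * (2 * s) ^ I n * (2 * s) ^ J n" for n
  have sums: "(\<lambda>n. k n * x ^ I n * y ^ J n) sums f x y" if "\<bar>x\<bar> < r" "\<bar>y\<bar> < r" for x y
  proof -
    have "((\<lambda>(i, j). c i j * x ^ i * y ^ j) \<circ> prod_decode has_sum f x y) UNIV"
      using f[OF that] bij_prod_decode by (subst has_sum_reindex[symmetric]) (auto simp: bij_def)
    then show ?thesis
      using has_sum_imp_sums by (fastforce simp: k_def I_def J_def o_def case_prod_unfold)
  qed
  have "(\<lambda>(i, j). c i j * (2 * s) ^ i * (2 * s) ^ j) summable_on UNIV"
    using f[of "2 * s" "2 * s"] s by (auto simp: summable_on_def)
  then have "(\<lambda>z. norm (case z of (i, j) \<Rightarrow> c i j * (2 * s) ^ i * (2 * s) ^ j)) summable_on UNIV"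
    using summable_on_iff_abs_summable_on_real by blast
  then have "(\<lambda>z. norm (case z of (i, j) \<Rightarrow> c i j * (2 * s) ^ i * (2 * s) ^ j)) \<circ> prod_decode summable_on UNIV"
    using bij_prod_decode by (subst summable_on_reindex[symmetric]) (auto simp: bij_def)
  then have "summable ((\<lambda>z. norm (case z of (i, j) \<Rightarrow> c i j * (2 * s) ^ i * (2 * s) ^ j)) \<circ> prod_decode)"
    by (rule summable_on_imp_summable)
  then have sumM: "summable M"
    using s by (simp add: M_def[abs_def] k_def I_def J_def o_def case_prod_unfold abs_mult)
  define dx where "dx n = (\<lambda>z::real \<times> real. k n * (real (I n) * fst z ^ (I n - 1)) * snd z ^ J n)" for n
  define dy where "dy n = (\<lambda>z::real \<times> real. k n * fst z ^ I n * (real (J n) * snd z ^ (J n - 1)))" for n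
  have aux: "real i * \<bar>x\<bar> ^ (i - 1) * \<bar>y\<bar> ^ j \<le> (2 * s) ^ i * (2 * s) ^ j / s"
    if "\<bar>x\<bar> \<le> s" "\<bar>y\<bar> \<le> s" for x y i j
  proof (cases i)
    case (Suc l)
    have "real i * \<bar>x\<bar> ^ (i - 1) * \<bar>y\<bar> ^ j \<le> 2 ^ Suc l * s ^ l * (2 * s) ^ j"
      unfolding Suc diff_Suc_1 using that s of_nat_less_two_power[of "Suc l", where 'a = real]
      by (intro mult_mono power_mono) (auto simp del: power_Suc)
    also have "\<dots> = (2 * s) ^ i * (2 * s) ^ j / s"
      using s Suc by (simp add: power_mult_distrib field_simps)
    finally show ?thesis .
  qed (use s in simp)
  have bdx: "norm (dx n z) \<le> M n / s" if "z \<in> B" for n z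
  proof -
    have "norm (dx n z) = \<bar>k n\<bar> * (real (I n) * \<bar>fst z\<bar> ^ (I n - 1) * \<bar>snd z\<bar> ^ J n)"
      by (simp add: dx_def abs_mult power_abs)
    also have "\<dots> \<le> \<bar>k n\<bar> * ((2 * s) ^ I n * (2 * s) ^ J n / s)"
      using that by (intro mult_left_mono aux) (auto simp: B_def)
    finally show ?thesis by (simp add: M_def)
  qed
  have bdy: "norm (dy n z) \<le> M n / s" if "z \<in> B" for n z
  proof -
    have "norm (dy n z) = \<bar>k n\<bar> * (real (J n) * \<bar>snd z\<bar> ^ (J n - 1) * \<bar>fst z\<bar> ^ I n)"
      by (simp add: dy_def abs_mult power_abs)
    also have "\<dots> \<le> \<bar>k n\<bar> * ((2 * s) ^ J n * (2 * s) ^ I n / s)"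
      using that by (intro mult_left_mono aux) (auto simp: B_def)
    finally show ?thesis by (simp add: M_def mult_ac)
  qed
  define fx where "fx z = (\<Sum>n. dx n z)" for z
  define fy where "fy z = (\<Sum>n. dy n z)" for z
  have ux: "uniform_limit B (\<lambda>n z. \<Sum>i<n. dx i z) fx sequentially"
    unfolding fx_def by (rule Weierstrass_m_test[OF bdx summable_divide[OF sumM]])
  have uy: "uniform_limit B (\<lambda>n z. \<Sum>i<n. dy i z) fy sequentially"
    unfolding fy_def by (rule Weierstrass_m_test[OF bdy summable_divide[OF sumM]])
  have cx: "continuous_on B fx"
    by (rule uniform_limit_theorem[OF _ ux])
      (auto intro!: always_eventually continuous_intros simp: dx_def)
  have cy: "continuous_on B fy"
    by (rule uniform_limit_theorem[OF _ uy])
      (auto intro!: always_eventually continuous_intros simp: dy_def)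
  have "convex B" "open B" "(0, 0) \<in> B"
    using s by (auto simp: B_def intro: convex_Times open_Times)
  have "\<exists>g. \<forall>z\<in>B. (\<lambda>n. k n * fst z ^ I n * snd z ^ J n) sums g z \<and>
      (g has_derivative (\<lambda>h. fst h * fx z + snd h * fy z)) (at z within B)"
  proof (rule has_derivative_series[OF \<open>convex B\<close> _ _ \<open>(0, 0) \<in> B\<close>])
    fix n and z :: "real \<times> real" assume "z \<in> B"
    show "((\<lambda>z. k n * fst z ^ I n * snd z ^ J n) has_derivative
        (\<lambda>h. fst h * dx n z + snd h * dy n z)) (at z within B)"
      unfolding dx_def dy_def by (rule has_derivative_eq_rhs, (rule derivative_intros)+) (simp add: fun_eq_iff algebra_simps)
  next
    fix e :: real assume "0 < e"
    have "\<forall>\<^sub>F n in sequentially. \<forall>z\<in>B. dist (\<Sum>i<n. dx i z) (fx z) < e / 2"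
      "\<forall>\<^sub>F n in sequentially. \<forall>z\<in>B. dist (\<Sum>i<n. dy i z) (fy z) < e / 2"
      by (rule uniform_limitD[OF ux half_gt_zero[OF \<open>0 < e\<close>]], rule uniform_limitD[OF uy half_gt_zero[OF \<open>0 < e\<close>]])
    then show "\<forall>\<^sub>F n in sequentially. \<forall>z\<in>B. \<forall>h. norm ((\<Sum>i<n. fst h * dx i z + snd h * dy i z)
        - (fst h * fx z + snd h * fy z)) \<le> e * norm h"
    proof eventually_elim
      case (elim n)
      show ?case
      proof (intro ballI allI)
        fix z :: "real \<times> real" and h :: "real \<times> real" assume z: "z \<in> B"
        have "norm ((\<Sum>i<n. fst h * dx i z + snd h * dy i z) - (fst h * fx z + snd h * fy z))
          = \<bar>fst h * ((\<Sum>i<n. dx i z) - fx z) + snd h * ((\<Sum>i<n. dy i z) - fy z)\<bar>"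
          by (simp add: sum.distrib sum_distrib_left algebra_simps)
        also have "\<dots> \<le> \<bar>fst h\<bar> * \<bar>(\<Sum>i<n. dx i z) - fx z\<bar> + \<bar>snd h\<bar> * \<bar>(\<Sum>i<n. dy i z) - fy z\<bar>"
          by (rule order_trans[OF abs_triangle_ineq]) (simp add: abs_mult)
        also have "\<dots> \<le> norm h * (e / 2) + norm h * (e / 2)"
          using elim z norm_fst_le[of "fst h" "snd h"] norm_snd_le[of "snd h" "fst h"]
          by (intro add_mono mult_mono) (auto simp: dist_real_def less_imp_le)
        finally show "norm ((\<Sum>i<n. fst h * dx i z + snd h * dy i z) - (fst h * fx z + snd h * fy z)) \<le> e * norm h"
          by simp
      qed
    qed
  next
    show "(\<lambda>n. k n * fst (0, 0) ^ I n * snd (0, 0) ^ J n) sums f 0 0"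
      using sums[of 0 0] \<open>0 < r\<close> by simp
  qed
  then obtain g where g: "\<And>z. z \<in> B \<Longrightarrow> (\<lambda>n. k n * fst z ^ I n * snd z ^ J n) sums g z"
     "\<And>z. z \<in> B \<Longrightarrow> (g has_derivative (\<lambda>h. fst h * fx z + snd h * fy z)) (at z within B)" by blast
  have gf: "g z = (case z of (x, y) \<Rightarrow> f x y)" if "z \<in> B" for z
  proof -
    have "\<bar>fst z\<bar> < r" "\<bar>snd z\<bar> < r" using that s by (auto simp: B_def)
    from sums[OF this] g(1)[OF that] show ?thesis
      by (simp add: sums_unique2 case_prod_unfold)
  qed
  have "((\<lambda>(x, y). f x y) has_derivative (\<lambda>(a, b). a * fx z + b * fy z)) (at z)" if z: "z \<in> B" for z
  proof -
    have "(g has_derivative (\<lambda>h. fst h * fx z + snd h * fy z)) (at z)"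
      using g(2)[OF z] at_within_open[OF z \<open>open B\<close>] by simp
    then have "((\<lambda>(x, y). f x y) has_derivative (\<lambda>h. fst h * fx z + snd h * fy z)) (at z)"
      by (rule has_derivative_transform_within_open[OF _ \<open>open B\<close> z]) (simp add: gf)
    then show ?thesis by (simp add: case_prod_unfold)
  qed
  then have "C1_on B f" using cx cy unfolding C1_on_def by blast
  then show ?thesis using s(1) unfolding B_def by blast
qed

lemma analytic_slice_C1:
  fixes f :: "real ^ 'd \<Rightarrow> real \<Rightarrow> real \<Rightarrow> real"
  assumes "real_analytic_at (\<lambda>(x, y, \<nu>). f \<nu> x y) (0, 0, \<mu>)"
  shows "\<exists>r>0. C1_on ({-r<..<r} \<times> {-r<..<r}) (f \<mu>)"
proof -
  obtain c r where "0 < r" and series: "\<forall>x y. \<bar>x\<bar> < r \<and> \<bar>y\<bar> < r \<longrightarrow>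
      ((\<lambda>(i, j). c i j * x ^ i * y ^ j) has_sum f \<mu> x y) UNIV"
    using analytic_slice_double_series[OF assms] by (elim exE conjE) (rule that)
  show ?thesis
    by (rule double_power_series_C1[OF \<open>0 < r\<close>]) (rule series[THEN spec, THEN spec, THEN mp, OF conjI])
qed

section \<open>Closed 1-forms and linear differential equations\<close>

text \<open>
  Differentiation under the integral sign: for the closed form \<open>M d\<phi> + N d\<rho>\<close> the derivative of the
  integral of \<open>M\<close> is the integral of \<open>\<partial>N / \<partial>\<phi>\<close>, the difference of two equal boundary values.
\<close>

lemma integral_closed_form_constant:
  fixes M N K :: "real \<Rightarrow> real \<Rightarrow> real"
  assumes "\<alpha> \<le> \<beta>" "convex S"
    and M: "\<And>\<phi> \<rho>. \<phi> \<in> {\<alpha>..\<beta>} \<Longrightarrow> \<rho> \<in> S \<Longrightarrow> (M \<phi> has_real_derivative K \<phi> \<rho>) (at \<rho> within S)"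
    and N: "\<And>\<phi> \<rho>. \<phi> \<in> {\<alpha>..\<beta>} \<Longrightarrow> \<rho> \<in> S \<Longrightarrow>
      ((\<lambda>s. N s \<rho>) has_real_derivative K \<phi> \<rho>) (at \<phi> within {\<alpha>..\<beta>})"
    and contM: "\<And>\<rho>. \<rho> \<in> S \<Longrightarrow> continuous_on {\<alpha>..\<beta>} (\<lambda>\<phi>. M \<phi> \<rho>)"
    and contK: "continuous_on ({\<alpha>..\<beta>} \<times> S) (\<lambda>(\<phi>, \<rho>). K \<phi> \<rho>)"
    and periodic: "\<And>\<rho>. \<rho> \<in> S \<Longrightarrow> N \<beta> \<rho> = N \<alpha> \<rho>"
  shows "\<exists>g. \<forall>\<rho>\<in>S. ((\<lambda>\<phi>. M \<phi> \<rho>) has_integral g) {\<alpha>..\<beta>}"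
proof -
  have int: "(\<lambda>\<phi>. M \<phi> \<rho>) integrable_on {\<alpha>..\<beta>}" if "\<rho> \<in> S" for \<rho>
    using contM[OF that] by (rule integrable_continuous_real)
  have "continuous_on (S \<times> cbox \<alpha> \<beta>) ((\<lambda>(\<phi>, \<rho>). K \<phi> \<rho>) \<circ> (\<lambda>z. (snd z, fst z)))"
    by (intro continuous_on_compose continuous_intros continuous_on_subset[OF contK]) auto
  then have contK': "continuous_on (S \<times> cbox \<alpha> \<beta>) (\<lambda>(\<rho>, \<phi>). K \<phi> \<rho>)"
    by (simp add: o_def case_prod_unfold)
  have "((\<lambda>\<rho>. integral {\<alpha>..\<beta>} (\<lambda>\<phi>. M \<phi> \<rho>)) has_real_derivative 0) (at \<rho> within S)" if \<rho>: "\<rho> \<in> S" for \<rho>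
  proof -
    have "((\<lambda>\<rho>. integral (cbox \<alpha> \<beta>) (\<lambda>\<phi>. M \<phi> \<rho>)) has_real_derivative
        integral (cbox \<alpha> \<beta>) (\<lambda>\<phi>. K \<phi> \<rho>)) (at \<rho> within S)"
      by (rule leibniz_rule_field_derivative[OF _ _ contK' \<rho> \<open>convex S\<close>]) (use M int in auto)
    moreover have "((\<lambda>\<phi>. K \<phi> \<rho>) has_integral (N \<beta> \<rho> - N \<alpha> \<rho>)) {\<alpha>..\<beta>}"
      using N \<rho> \<open>\<alpha> \<le> \<beta>\<close>
      by (intro fundamental_theorem_of_calculus) (auto simp flip: has_real_derivative_iff_has_vector_derivative)
    ultimately show ?thesis using periodic[OF \<rho>] by (simp add: integral_unique)
  qed
  then obtain g where "\<forall>\<rho>\<in>S. integral {\<alpha>..\<beta>} (\<lambda>\<phi>. M \<phi> \<rho>) = g"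
    using has_field_derivative_zero_constant[OF \<open>convex S\<close>] by blast
  then show ?thesis using int by (metis integrable_integral)
qed

text \<open>
  The potential of \<open>M d\<phi> + N d\<rho>\<close> is its integral along the path that goes horizontally at height
  \<open>a\<close> and then vertically. The vertical part contributes \<open>M(\<phi>, \<rho>) - M(\<phi>, a)\<close> to the derivative
  in \<open>\<phi>\<close>, and the horizontal part the missing \<open>M(\<phi>, a)\<close>.
\<close>

lemma closed_form_potential:
  fixes M N K :: "real \<Rightarrow> real \<Rightarrow> real" and \<alpha> \<beta> a b :: real
  defines "R \<equiv> {\<alpha>..\<beta>} \<times> {a..b}"
  defines "H \<equiv> \<lambda>\<phi> \<rho>. integral {a..\<rho>} (N \<phi>) + integral {\<alpha>..\<phi>} (\<lambda>s. M s a)"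
  assumes M: "\<And>\<phi> \<rho>. (\<phi>, \<rho>) \<in> R \<Longrightarrow> (M \<phi> has_real_derivative K \<phi> \<rho>) (at \<rho> within {a..b})"
    and N: "\<And>\<phi> \<rho>. (\<phi>, \<rho>) \<in> R \<Longrightarrow>
      ((\<lambda>s. N s \<rho>) has_real_derivative K \<phi> \<rho>) (at \<phi> within {\<alpha>..\<beta>})"
    and contM: "continuous_on R (\<lambda>(\<phi>, \<rho>). M \<phi> \<rho>)"
    and contN: "continuous_on R (\<lambda>(\<phi>, \<rho>). N \<phi> \<rho>)"
    and contK: "continuous_on R (\<lambda>(\<phi>, \<rho>). K \<phi> \<rho>)"
    and "(\<phi>, \<rho>) \<in> R"
  shows "((\<lambda>(\<phi>, \<rho>). H \<phi> \<rho>) has_derivative (\<lambda>(u, w). u * M \<phi> \<rho> + w * N \<phi> \<rho>)) (at (\<phi>, \<rho>) within R)"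
proof -
  have mem: "\<phi> \<in> {\<alpha>..\<beta>}" "\<rho> \<in> {a..b}" using \<open>(\<phi>, \<rho>) \<in> R\<close> by (auto simp: R_def)
  have Nint: "continuous_on {a..b} (N x)" if "x \<in> {\<alpha>..\<beta>}" for x
  proof -
    have "continuous_on {a..b} ((\<lambda>(\<phi>, \<rho>). N \<phi> \<rho>) \<circ> (\<lambda>s. (x, s)))"
      using that by (intro continuous_on_compose continuous_intros continuous_on_subset[OF contN]) (auto simp: R_def)
    then show ?thesis by (simp add: o_def)
  qed
  have Mint: "continuous_on {\<alpha>..\<beta>} (\<lambda>s. M s a)"
  proof -
    have "continuous_on {\<alpha>..\<beta>} ((\<lambda>(\<phi>, \<rho>). M \<phi> \<rho>) \<circ> (\<lambda>s. (s, a)))"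
      using mem by (intro continuous_on_compose continuous_intros continuous_on_subset[OF contM]) (auto simp: R_def)
    then show ?thesis by (simp add: o_def)
  qed
  have "((\<lambda>x. integral (cbox a \<rho>) (N x)) has_real_derivative integral (cbox a \<rho>) (K \<phi>)) (at \<phi> within {\<alpha>..\<beta>})"
  proof (rule leibniz_rule_field_derivative)
    show "N x integrable_on cbox a \<rho>" if "x \<in> {\<alpha>..\<beta>}" for x
      using mem continuous_on_subset[OF Nint[OF that]] by (auto intro!: integrable_continuous_real)
    show "continuous_on ({\<alpha>..\<beta>} \<times> cbox a \<rho>) (\<lambda>(x, t). K x t)"
      using mem by (intro continuous_on_subset[OF contK]) (auto simp: R_def)
  qed (use mem N in \<open>auto simp: R_def\<close>)
  moreover have "(K \<phi> has_integral (M \<phi> \<rho> - M \<phi> a)) {a..\<rho>}"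
  proof (rule fundamental_theorem_of_calculus)
    fix x assume x: "x \<in> {a..\<rho>}"
    then have "(M \<phi> has_real_derivative K \<phi> x) (at x within {a..b})" using M mem by (auto simp: R_def)
    then have "(M \<phi> has_real_derivative K \<phi> x) (at x within {a..\<rho>})"
      by (rule DERIV_subset) (use mem in auto)
    then show "(M \<phi> has_vector_derivative K \<phi> x) (at x within {a..\<rho>})"
      by (simp add: has_real_derivative_iff_has_vector_derivative)
  qed (use mem in auto)
  moreover have "((\<lambda>x. integral {\<alpha>..x} (\<lambda>s. M s a)) has_real_derivative M \<phi> a) (at \<phi> within {\<alpha>..\<beta>})"
    using integral_has_real_derivative[OF Mint] mem by auto
  ultimately have "((\<lambda>x. H x \<rho>) has_real_derivative M \<phi> \<rho>) (at \<phi> within {\<alpha>..\<beta>})"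
    unfolding H_def by (auto intro!: derivative_eq_intros simp: integral_unique)
  then have 1: "((\<lambda>x. H x \<rho>) has_derivative (\<lambda>u. u * M \<phi> \<rho>)) (at \<phi> within {\<alpha>..\<beta>})"
    by (simp add: has_field_derivative_def mult_commute_abs)
  have 2: "(H x has_derivative blinfun_apply (blinfun_mult_left (N x y))) (at y within {a..b})"
    if "x \<in> {\<alpha>..\<beta>}" "y \<in> {a..b}" for x y
  proof -
    have "((\<lambda>y. integral {a..y} (N x)) has_real_derivative N x y) (at y within {a..b})"
      using integral_has_real_derivative[OF Nint[OF that(1)]] that by auto
    then have "(H x has_real_derivative N x y) (at y within {a..b})"
      unfolding H_def by (auto intro!: derivative_eq_intros)
    then show ?thesis by (simp add: has_field_derivative_def mult_commute_abs)
  qed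
  have 3: "continuous (at (\<phi>, \<rho>) within {\<alpha>..\<beta>} \<times> {a..b}) (\<lambda>(x, y). blinfun_mult_left (N x y))"
  proof -
    have "continuous_on R (\<lambda>z. blinfun_mult_left (case z of (x, y) \<Rightarrow> N x y))"
      by (intro continuous_intros contN)
    then show ?thesis using \<open>(\<phi>, \<rho>) \<in> R\<close>
      by (simp add: continuous_on_eq_continuous_within R_def case_prod_unfold)
  qed
  from has_derivative_partialsI[OF 1 2 3 mem(2)] show ?thesis
    by (simp add: R_def mult.commute)
qed

text \<open>
  The product of \<open>u\<close> with the integrating factor \<open>exp (- \<integral> a)\<close> is constant.
\<close>

lemma linear_ode_zero:
  fixes u a :: "real \<Rightarrow> real"
  assumes u: "\<And>t. t \<in> {0..T} \<Longrightarrow> (u has_real_derivative a t * u t) (at t within {0..T})"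
    and a: "continuous_on {0..T} a"
    and st: "s \<in> {0..T}" "t \<in> {0..T}" and "u s = 0"
  shows "u t = 0"
proof -
  define w where "w x = u x * exp (- integral {0..x} a)" for x
  have "(w has_real_derivative 0) (at x within {0..T})" if "x \<in> {0..T}" for x
  proof -
    have "((\<lambda>x. integral {0..x} a) has_real_derivative a x) (at x within {0..T})"
      using integral_has_real_derivative[OF a] that by auto
    then show ?thesis
      unfolding w_def using u[OF that]
      by (auto intro!: derivative_eq_intros simp: algebra_simps)
  qed
  then obtain k where "\<And>x. x \<in> {0..T} \<Longrightarrow> w x = k"
    using has_field_derivative_zero_constant[of "{0..T}" w] by auto
  then have "w t = w s" using st by simp
  then show ?thesis using \<open>u s = 0\<close> by (simp add: w_def)
qed

lemma nondecreasing_image: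
  fixes \<phi> :: "real \<Rightarrow> real"
  assumes "0 \<le> T"
    and d: "\<And>t. t \<in> {0..T} \<Longrightarrow> (\<phi> has_real_derivative w t) (at t within {0..T})"
    and w: "\<And>t. t \<in> {0..T} \<Longrightarrow> 0 \<le> w t"
  shows "\<phi> ` {0..T} = {\<phi> 0..\<phi> T}"
proof -
  have mono: "\<phi> s \<le> \<phi> t" if "s \<in> {0..T}" "t \<in> {0..T}" "s \<le> t" for s t
  proof -
    have "\<exists>x\<in>{s..t}. \<phi> t - \<phi> s = w x * (t - s)"
    proof (rule mvt_very_simple[OF \<open>s \<le> t\<close>, where f' = "\<lambda>x h. w x * h"])
      fix x assume "s \<le> x" "x \<le> t"
      then show "(\<phi> has_derivative (*) (w x)) (at x within {s..t})"
        using DERIV_subset[OF d, of x "{s..t}"] that by (simp add: has_field_derivative_def)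
    qed
    then obtain x where x: "x \<in> {s..t}" "\<phi> t - \<phi> s = w x * (t - s)" by blast
    have "0 \<le> w x * (t - s)" using w[of x] x(1) that by (intro mult_nonneg_nonneg) auto
    then show ?thesis using x(2) by simp
  qed
  have cont: "continuous_on {0..T} \<phi>" by (rule DERIV_continuous_on, erule d)
  show ?thesis
  proof (intro equalityI subsetI)
    fix v assume "v \<in> {\<phi> 0..\<phi> T}"
    then obtain t where "0 \<le> t" "t \<le> T" "\<phi> t = v"
      using IVT'[of \<phi> 0 v T] cont \<open>0 \<le> T\<close> by auto
    then show "v \<in> \<phi> ` {0..T}" by auto
  qed (use mono \<open>0 \<le> T\<close> in auto)
qed

lemma nonincreasing_image:
  fixes \<phi> :: "real \<Rightarrow> real"
  assumes "0 \<le> T"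
    and d: "\<And>t. t \<in> {0..T} \<Longrightarrow> (\<phi> has_real_derivative w t) (at t within {0..T})"
    and w: "\<And>t. t \<in> {0..T} \<Longrightarrow> w t \<le> 0"
  shows "\<phi> ` {0..T} = {\<phi> T..\<phi> 0}"
proof -
  have "(\<lambda>t. - \<phi> t) ` {0..T} = {- \<phi> 0..- \<phi> T}"
    by (rule nondecreasing_image[where w = "\<lambda>t. - w t", OF \<open>0 \<le> T\<close> DERIV_minus[OF d]]) (use w in auto)
  then have "uminus ` (\<lambda>t. - \<phi> t) ` {0..T} = uminus ` {- \<phi> 0..- \<phi> T}" by simp
  then show ?thesis by (simp add: image_image)
qed

section \<open>Leading terms at zero\<close>

text \<open>
  The top term is itself of smaller order than \<open>r\<^sup>N\<^sup>-\<^sup>1\<close>, so the induction hypothesis applies to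
  the lower terms; once they are gone, the top term must be of smaller order than itself.
\<close>

lemma polynomial_smallo_zero:
  fixes a :: "nat \<Rightarrow> real"
  assumes "(\<lambda>r. \<Sum>i=1..N. a i * r ^ i) \<in> o[at_right 0](\<lambda>r. r ^ N)" "i \<in> {1..N}"
  shows "a i = 0"
  using assms
proof (induction N arbitrary: i)
  case (Suc N)
  have pos: "\<forall>\<^sub>F r in at_right 0. r \<noteq> (0::real)"
    by (simp add: eventually_at_filter)
  have top: "(\<lambda>r. a (Suc N) * r ^ Suc N) \<in> o[at_right 0](\<lambda>r. r ^ N)"
    and le: "(\<lambda>r::real. r ^ Suc N) \<in> o[at_right 0](\<lambda>r. r ^ N)"
  proof -
    have "((\<lambda>r. c * r) \<longlongrightarrow> c * 0) (at_right 0)" for c :: real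
      by (intro tendsto_intros)
    then have *: "((\<lambda>r. c * r ^ Suc N / r ^ N) \<longlongrightarrow> 0) (at_right 0)" for c :: real
      by (rule Lim_transform_eventually[of "\<lambda>r. c * r", OF tendsto_eq_rhs])
        (use pos in \<open>auto elim!: eventually_mono\<close>)
    from *[of "a (Suc N)"] *[of 1] show "(\<lambda>r. a (Suc N) * r ^ Suc N) \<in> o[at_right 0](\<lambda>r. r ^ N)"
       "(\<lambda>r::real. r ^ Suc N) \<in> o[at_right 0](\<lambda>r. r ^ N)"
      using pos by (auto intro!: smalloI_tendsto elim!: eventually_mono)
  qed
  have "(\<lambda>r. \<Sum>i=1..Suc N. a i * r ^ i) \<in> o[at_right 0](\<lambda>r. r ^ N)"
    using landau_o.small_trans[OF Suc.prems(1) le] .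
  from sum_in_smallo(2)[OF this top]
  have lower: "a i = 0" if "i \<in> {1..N}" for i
    using Suc.IH[OF _ that] by simp
  then have "(\<lambda>r. a (Suc N) * r ^ Suc N) \<in> o[at_right 0](\<lambda>r. r ^ Suc N)"
    using Suc.prems(1) by simp
  then have "((\<lambda>r. a (Suc N) * r ^ Suc N / r ^ Suc N) \<longlongrightarrow> 0) (at_right 0)"
    by (rule smalloD_tendsto)
  then have "((\<lambda>r::real. a (Suc N)) \<longlongrightarrow> 0) (at_right 0)"
    by (rule Lim_transform_eventually) (rule eventually_mono[OF pos], simp)
  then have "a (Suc N) = 0"
    using tendsto_unique[OF _ tendsto_const] by (metis trivial_limit_at_right_real)
  with lower Suc.prems(2) show ?case by (cases "i = Suc N") auto
qed simp

lemma formal_expansion_unique: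
  assumes "formal_expansion f \<eta>"
    and "(\<lambda>r. f r - (\<Sum>i=1..N. b i * r ^ i)) \<in> o[at_right 0](\<lambda>r. r ^ N)"
    and "i \<in> {1..N}"
  shows "\<eta> i = b i"
proof -
  have "(\<lambda>r. f r - (\<Sum>i=1..N. \<eta> i * r ^ i)) \<in> o[at_right 0](\<lambda>r. r ^ N)"
    using assms(1) by (simp add: formal_expansion_def)
  from sum_in_smallo(2)[OF assms(2) this]
  have "(\<lambda>r. \<Sum>i=1..N. (\<eta> i - b i) * r ^ i) \<in> o[at_right 0](\<lambda>r. r ^ N)"
    by (simp add: sum_subtractf algebra_simps)
  from polynomial_smallo_zero[OF this assms(3)] show ?thesis by simp
qed

text \<open>
  After division by \<open>\<rho>\<^sup>m\<close> the function agrees for \<open>\<rho> > 0\<close> with a convergent power series, which is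
  continuous at \<open>0\<close>. The coefficient \<open>a m\<close> may be zero.
\<close>

lemma laurent_leading_tendsto:
  fixes a :: "int \<Rightarrow> real"
  assumes "0 < r"
    and "\<And>\<rho>. 0 < \<rho> \<Longrightarrow> \<rho> < r \<Longrightarrow> ((\<lambda>i. a i * \<rho> powi i) has_sum W \<rho>) {m..}"
  shows "((\<lambda>\<rho>. W \<rho> / \<rho> powi m) \<longlongrightarrow> a m) (at_right 0)"
proof -
  define b where "b n = a (m + int n)" for n
  have img: "{m..} = range (\<lambda>n. m + int n)"
  proof (intro equalityI subsetI)
    fix i assume "i \<in> {m..}"
    then have "i = m + int (nat (i - m))" by simp
    then show "i \<in> range (\<lambda>n. m + int n)" by blast
  qed auto
  have sums: "(\<lambda>n. b n * \<rho> ^ n) sums (W \<rho> / \<rho> powi m)" if "0 < \<rho>" "\<rho> < r" for \<rho>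
  proof -
    have "((\<lambda>i. a i * \<rho> powi i) \<circ> (\<lambda>n. m + int n) has_sum W \<rho>) UNIV"
      using assms(2)[OF that] unfolding img by (subst (asm) has_sum_reindex) (auto simp: inj_on_def)
    from has_sum_imp_sums[OF this] have "(\<lambda>n. a (m + int n) * \<rho> powi (m + int n)) sums W \<rho>"
      by (simp add: o_def)
    from sums_divide[OF this, of "\<rho> powi m"] show ?thesis
      using that by (simp add: b_def power_int_add)
  qed
  define f where "f x = (\<Sum>n. b n * x ^ n)" for x
  have "(f \<longlongrightarrow> b 0) (at 0)"
  proof (rule powser_limit_0[of "r / 2"])
    fix x :: real assume "norm x < r / 2"
    moreover have "summable (\<lambda>n. b n * (r / 2) ^ n)"
      using sums[of "r / 2"] \<open>0 < r\<close> by (auto simp: sums_iff)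
    ultimately have "summable (\<lambda>n. b n * x ^ n)"
      using powser_inside[of b "r / 2" x] \<open>0 < r\<close> by simp
    then show "(\<lambda>n. b n * x ^ n) sums f x" by (simp add: f_def summable_sums)
  qed (use \<open>0 < r\<close> in simp)
  then have "(f \<longlongrightarrow> b 0) (at_right 0)"
    by (rule filterlim_mono) (auto simp: at_within_le_at)
  moreover have "\<forall>\<^sub>F \<rho> in at_right 0. f \<rho> = W \<rho> / \<rho> powi m"
    using \<open>0 < r\<close> sums_unique[OF sums]
    by (auto simp: eventually_at_right_field f_def intro!: exI[of _ r])
  ultimately show ?thesis
    by (auto simp: b_def elim: Lim_transform_eventually)
qed

lemma laurent_eventually_nonzero:
  fixes a :: "int \<Rightarrow> real"
  assumes "0 < r"
    and W: "\<And>\<rho>. 0 < \<rho> \<Longrightarrow> \<rho> < r \<Longrightarrow> ((\<lambda>i. a i * \<rho> powi i) has_sum W \<rho>) {m..}"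
    and nz: "\<exists>i\<ge>m. a i \<noteq> 0"
  shows "\<exists>s>0. \<forall>\<rho>. 0 < \<rho> \<and> \<rho> < s \<longrightarrow> W \<rho> \<noteq> 0"
proof -
  \<comment> \<open>Dropping the vanishing terms makes \<open>m + n\<close> the index of the leading term.\<close>
  define n where "n = (LEAST n. a (m + int n) \<noteq> 0)"
  obtain i where i: "m \<le> i" "a i \<noteq> 0" using nz by blast
  then have "a (m + int (nat (i - m))) \<noteq> 0" by simp
  then have n: "a (m + int n) \<noteq> 0" unfolding n_def by (rule LeastI)
  have small: "a j = 0" if "m \<le> j" "j < m + int n" for j
    using not_less_Least[of "nat (j - m)" "\<lambda>n. a (m + int n) \<noteq> 0"] that by (auto simp: n_def)
  have "((\<lambda>i. a i * \<rho> powi i) has_sum W \<rho>) {m + int n..}" if "0 < \<rho>" "\<rho> < r" for \<rho>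
    by (rule iffD1[OF has_sum_cong_neutral W[OF that]]) (auto simp: small)
  from laurent_leading_tendsto[OF \<open>0 < r\<close> this]
  have "((\<lambda>\<rho>. W \<rho> / \<rho> powi (m + int n)) \<longlongrightarrow> a (m + int n)) (at_right 0)" by simp
  from tendsto_imp_eventually_ne[OF this n]
  show ?thesis by (auto simp: eventually_at_right_field)
qed

text \<open>
  Cauchy's mean value theorem for a function \<open>h\<close> and the primitive \<open>K\<close> of \<open>1 / W\<close> gives
  \<open>h(f(r)) - h(r) = g h'(c) W(c)\<close> for some \<open>c\<close> between \<open>r\<close> and \<open>f(r)\<close>. With \<open>h = ln\<close> the right-hand
  side is \<open>g W(c) / c\<close>, which shows that \<open>f(r) / r\<close> has a limit. For \<open>m > 1\<close> this limit is \<open>1\<close>,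
  hence \<open>c / r \<rightarrow> 1\<close> also for the point \<open>c\<close> that belongs to \<open>h(s) = s\<close>, and there the
  right-hand side is \<open>g W(c) \<approx> g L c\<^sup>m \<approx> g L r\<^sup>m\<close>.
\<close>

lemma poincare_map_asymptotics:
  fixes f W :: "real \<Rightarrow> real"
  assumes f0: "(f \<longlongrightarrow> 0) (at_right 0)"
    and K: "\<forall>\<^sub>F r in at_right 0. 0 < f r \<and> (\<exists>K. K (f r) - K r = g \<and>
       (\<forall>s. min r (f r) \<le> s \<and> s \<le> max r (f r) \<longrightarrow>
          W s \<noteq> 0 \<and> (K has_real_derivative 1 / W s) (at s)))"
    and W: "((\<lambda>\<rho>. W \<rho> / \<rho> ^ m) \<longlongrightarrow> L) (at_right 0)"
  shows "m = 1 \<Longrightarrow> ((\<lambda>r. f r / r) \<longlongrightarrow> exp (g * L)) (at_right 0)"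
    and "1 < m \<Longrightarrow> ((\<lambda>r. (f r - r) / r ^ m) \<longlongrightarrow> g * L) (at_right 0)"
proof -
  have pos: "\<forall>\<^sub>F r in at_right 0. (0::real) < r" by (rule eventually_at_right_less)
  have mvt: "\<exists>c. min r y \<le> c \<and> c \<le> max r y \<and> h y - h r = g * (h' c * W c)"
    if r: "0 < r" "0 < y" and "K y - K r = g"
      and K: "\<And>s. min r y \<le> s \<Longrightarrow> s \<le> max r y \<Longrightarrow> W s \<noteq> 0 \<and> (K has_real_derivative 1 / W s) (at s)"
      and h: "\<And>s. 0 < s \<Longrightarrow> (h has_real_derivative h' s) (at s)"
    for r y K and h h' :: "real \<Rightarrow> real"
  proof (cases "r = y")
    case True
    then show ?thesis using \<open>K y - K r = g\<close> by auto
  next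
    case False
    define a b where "a = min r y" and "b = max r y"
    have ab: "0 < a" "a < b" using r False by (auto simp: a_def b_def)
    have K': "\<And>s. a \<le> s \<Longrightarrow> s \<le> b \<Longrightarrow> W s \<noteq> 0 \<and> (K has_real_derivative 1 / W s) (at s)"
      using K by (simp add: a_def b_def)
    obtain c where c: "a < c" "c < b" "(h b - h a) * (1 / W c) = (K b - K a) * h' c"
    proof (rule exE[OF GMVT'[OF \<open>a < b\<close>, of h K "\<lambda>s. 1 / W s" h']])
      show "isCont h z" if "a \<le> z" for z using h[of z] ab that by (auto intro: DERIV_isCont)
      show "isCont K z" if "a \<le> z" "z \<le> b" for z using K'[OF that] by (auto intro: DERIV_isCont)
    qed (use K' h ab in auto)
    have "h b - h a = (K b - K a) * (h' c * W c)"
      using c K'[of c] by (simp add: field_simps)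
    then have "h y - h r = (K y - K r) * (h' c * W c)"
      by (auto simp: a_def b_def min_def max_def algebra_simps split: if_splits)
    then show ?thesis using c \<open>K y - K r = g\<close> unfolding a_def b_def
      by (intro exI[of _ c]) auto
  qed
  have between: "\<exists>c. (\<forall>\<^sub>F r in at_right 0. min r (f r) \<le> c r \<and> c r \<le> max r (f r) \<and>
       h (f r) - h r = g * (h' (c r) * W (c r)))"
    if h: "\<And>s. 0 < s \<Longrightarrow> (h has_real_derivative h' s) (at s)" for h h' :: "real \<Rightarrow> real"
  proof -
    have "\<forall>\<^sub>F r in at_right 0. \<exists>c. min r (f r) \<le> c \<and> c \<le> max r (f r) \<and>
       h (f r) - h r = g * (h' c * W c)"
      using K pos by eventually_elim (use mvt h in blast)
    then show ?thesis by (simp only: eventually_ex)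
  qed
  have id0: "((\<lambda>r::real. r) \<longlongrightarrow> 0) (at_right 0)" by (rule tendsto_ident_at)
  have to0: "filterlim c (at_right 0) (at_right 0)"
    if c: "\<forall>\<^sub>F r in at_right 0. min r (f r) \<le> c r \<and> c r \<le> max r (f r)" for c
  proof -
    have "((\<lambda>r. min r (f r)) \<longlongrightarrow> 0) (at_right 0)" "((\<lambda>r. max r (f r)) \<longlongrightarrow> 0) (at_right 0)"
      using tendsto_min[OF id0 f0] tendsto_max[OF id0 f0] by auto
    then have "(c \<longlongrightarrow> 0) (at_right 0)"
      by (rule tendsto_sandwich[rotated 2]) (use c in \<open>auto elim: eventually_mono\<close>)
    moreover have "\<forall>\<^sub>F r in at_right 0. 0 < c r"
      using c K pos by eventually_elim auto
    ultimately show ?thesis by (auto simp: filterlim_at elim: eventually_mono)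
  qed
  have ratio: "((\<lambda>r. f r / r) \<longlongrightarrow> exp (g * L')) (at_right 0)"
    if L': "((\<lambda>\<rho>. W \<rho> / \<rho>) \<longlongrightarrow> L') (at_right 0)" for L'
  proof -
    obtain c where c: "\<forall>\<^sub>F r in at_right 0. min r (f r) \<le> c r \<and> c r \<le> max r (f r) \<and>
       ln (f r) - ln r = g * (1 / c r * W (c r))"
      using between[of ln "\<lambda>s. 1 / s"] by (auto intro: DERIV_ln_divide)
    have "((\<lambda>r. W (c r) / c r) \<longlongrightarrow> L') (at_right 0)"
      by (rule filterlim_compose[OF L' to0]) (use c in \<open>auto elim: eventually_mono\<close>)
    then have "((\<lambda>r. exp (g * (W (c r) / c r))) \<longlongrightarrow> exp (g * L')) (at_right 0)"
      by (intro tendsto_intros)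
    then show ?thesis
    proof (rule Lim_transform_eventually)
      show "\<forall>\<^sub>F r in at_right 0. exp (g * (W (c r) / c r)) = f r / r"
        using c K pos
      proof eventually_elim
        case (elim r)
        then have "g * (W (c r) / c r) = ln (f r) - ln r" by simp
        then have "exp (g * (W (c r) / c r)) = exp (ln (f r) - ln r)" by (rule arg_cong)
        moreover have "0 < f r" "0 < r" using elim by auto
        then have "exp (ln (f r) - ln r) = f r / r" by (simp add: exp_diff)
        ultimately show ?case by simp
      qed
    qed
  qed
  show "((\<lambda>r. f r / r) \<longlongrightarrow> exp (g * L)) (at_right 0)" if "m = 1"
    using ratio[of L] W that by simp
  show "((\<lambda>r. (f r - r) / r ^ m) \<longlongrightarrow> g * L) (at_right 0)" if "1 < m"
  proof -
    have "((\<lambda>\<rho>. W \<rho> / \<rho> ^ m * \<rho> ^ (m - 1)) \<longlongrightarrow> L * 0 ^ (m - 1)) (at_right 0)"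
      by (intro tendsto_intros W)
    then have "((\<lambda>\<rho>. W \<rho> / \<rho>) \<longlongrightarrow> L * 0 ^ (m - 1)) (at_right 0)"
      by (rule Lim_transform_eventually)
        (use pos that in \<open>auto elim!: eventually_mono simp: field_simps simp flip: power_Suc\<close>)
    then have one: "((\<lambda>r. f r / r) \<longlongrightarrow> 1) (at_right 0)"
      using ratio[of 0] that by (simp add: power_0_left)
    obtain c where c: "\<forall>\<^sub>F r in at_right 0. min r (f r) \<le> c r \<and> c r \<le> max r (f r) \<and>
       f r - r = g * (1 * W (c r))"
      using between[of "\<lambda>s. s" "\<lambda>s. 1"] by auto
    have lim: "((\<lambda>r. W (c r) / c r ^ m) \<longlongrightarrow> L) (at_right 0)"
      by (rule filterlim_compose[OF W to0]) (use c in \<open>auto elim: eventually_mono\<close>)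
    have lo: "((\<lambda>r. min 1 (f r / r)) \<longlongrightarrow> 1) (at_right 0)" and hi: "((\<lambda>r. max 1 (f r / r)) \<longlongrightarrow> 1) (at_right 0)"
      using tendsto_min[OF tendsto_const one, of 1] tendsto_max[OF tendsto_const one, of 1] by simp_all
    have bounds: "\<forall>\<^sub>F r in at_right 0. min 1 (f r / r) \<le> c r / r \<and> c r / r \<le> max 1 (f r / r)"
      using c pos
    proof eventually_elim
      case (elim r)
      then have "min r (f r) / r \<le> c r / r" "c r / r \<le> max r (f r) / r"
        by (auto intro!: divide_right_mono)
      then show ?case using elim by (simp add: min_divide_distrib_right max_divide_distrib_right)
    qed
    have "((\<lambda>r. c r / r) \<longlongrightarrow> 1) (at_right 0)"
      by (rule tendsto_sandwich[OF _ _ lo hi]; rule eventually_mono[OF bounds]; simp)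
    then have "((\<lambda>r. g * (W (c r) / c r ^ m * (c r / r) ^ m)) \<longlongrightarrow> g * (L * 1 ^ m)) (at_right 0)"
      by (intro tendsto_intros lim)
    moreover have "\<forall>\<^sub>F r in at_right 0. g * (W (c r) / c r ^ m * (c r / r) ^ m) = (f r - r) / r ^ m"
      using c K pos by eventually_elim (auto simp: power_divide)
    ultimately have "((\<lambda>r. (f r - r) / r ^ m) \<longlongrightarrow> g * (L * 1 ^ m)) (at_right 0)"
      by (rule Lim_transform_eventually)
    then show ?thesis by simp
  qed
qed

lemma formal_expansion_coefficients:
  assumes \<eta>: "formal_expansion f \<eta>"
  shows "((\<lambda>r. f r / r) \<longlongrightarrow> a) (at_right 0) \<Longrightarrow> \<eta> 1 = a"
    and "1 < m \<Longrightarrow> ((\<lambda>r. (f r - r) / r ^ m) \<longlongrightarrow> a) (at_right 0) \<Longrightarrow> \<eta> m = a"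
proof -
  have pos: "\<forall>\<^sub>F r in at_right 0. (0::real) < r" by (rule eventually_at_right_less)
  have small: "(\<lambda>r. h r - a * r ^ m) \<in> o[at_right 0](\<lambda>r. r ^ m)"
    if "((\<lambda>r. h r / r ^ m) \<longlongrightarrow> a) (at_right 0)" for h m
  proof (rule smalloI_tendsto)
    have "((\<lambda>r. h r / r ^ m - a) \<longlongrightarrow> 0) (at_right 0)"
      using tendsto_diff[OF that tendsto_const[of a]] by simp
    then show "((\<lambda>r. (h r - a * r ^ m) / r ^ m) \<longlongrightarrow> 0) (at_right 0)"
      by (rule Lim_transform_eventually) (rule eventually_mono[OF pos], simp add: diff_divide_distrib)
    show "\<forall>\<^sub>F r in at_right 0. r ^ m \<noteq> (0::real)" by (rule eventually_mono[OF pos]) simp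
  qed
  show "\<eta> 1 = a" if "((\<lambda>r. f r / r) \<longlongrightarrow> a) (at_right 0)"
    using formal_expansion_unique[OF \<eta>, where N = 1 and b = "\<lambda>_. a" and i = 1] small[of f 1] that by simp
  show "\<eta> m = a" if m: "1 < m" and "((\<lambda>r. (f r - r) / r ^ m) \<longlongrightarrow> a) (at_right 0)"
  proof -
    \<comment> \<open>The coefficients of the polynomial \<open>r + a * r ^ m\<close>.\<close>
    define b :: "nat \<Rightarrow> real" where "b i = (if i = 1 then 1 else 0) + (if i = m then a else 0)" for i
    have "(\<Sum>i=1..m. b i * r ^ i) = r + a * r ^ m" for r
      using m by (simp add: b_def distrib_right sum.distrib if_distrib[of "\<lambda>c. c * _"] cong: if_cong)
    then have "\<eta> m = b m"
      using formal_expansion_unique[OF \<eta>, where N = m and b = b and i = m] small[OF that(2)] m by (simp add: algebra_simps)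
    then show ?thesis using m by (simp add: b_def)
  qed
qed

lemma formal_expansion_tendsto_0:
  assumes "formal_expansion f \<eta>"
  shows "(f \<longlongrightarrow> 0) (at_right 0)"
proof -
  have "(\<lambda>r. f r - (\<Sum>i=1..0. \<eta> i * r ^ i)) \<in> o[at_right 0](\<lambda>r. r ^ 0)"
    using assms unfolding formal_expansion_def by blast
  from smalloD_tendsto[OF this] show ?thesis by simp
qed

section \<open>The vector field in weighted polar coordinates\<close>

text \<open>
  This is the Jacobian determinant of \<open>(\<rho>, \<phi>) \<mapsto> (\<rho>\<^sup>p cos \<phi>, \<rho>\<^sup>q sin \<phi>)\<close>. Divided by it, the two
  numerators below are \<open>\<rho>'\<close> and \<open>\<phi>'\<close> in the original time of the vector field. Their ratio is the
  right-hand side of the polar equation, because the rescaling of time cancels.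
\<close>

definition polar_jacobian :: "nat \<Rightarrow> nat \<Rightarrow> real \<Rightarrow> real \<Rightarrow> real" where
  "polar_jacobian p q \<phi> \<rho> = \<rho> ^ (p + q - 1) * (real p * (cos \<phi>)\<^sup>2 + real q * (sin \<phi>)\<^sup>2)"

definition radial_numerator ::
    "(real \<Rightarrow> real \<Rightarrow> real) \<Rightarrow> (real \<Rightarrow> real \<Rightarrow> real) \<Rightarrow> nat \<Rightarrow> nat \<Rightarrow> real \<Rightarrow> real \<Rightarrow> real" where
  "radial_numerator P Q p q \<phi> \<rho> =
     \<rho> ^ q * cos \<phi> * P (\<rho> ^ p * cos \<phi>) (\<rho> ^ q * sin \<phi>)
     + \<rho> ^ p * sin \<phi> * Q (\<rho> ^ p * cos \<phi>) (\<rho> ^ q * sin \<phi>)"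

definition angular_numerator ::
    "(real \<Rightarrow> real \<Rightarrow> real) \<Rightarrow> (real \<Rightarrow> real \<Rightarrow> real) \<Rightarrow> nat \<Rightarrow> nat \<Rightarrow> real \<Rightarrow> real \<Rightarrow> real" where
  "angular_numerator P Q p q \<phi> \<rho> =
     real p * \<rho> ^ (p - 1) * cos \<phi> * Q (\<rho> ^ p * cos \<phi>) (\<rho> ^ q * sin \<phi>)
     - real q * \<rho> ^ (q - 1) * sin \<phi> * P (\<rho> ^ p * cos \<phi>) (\<rho> ^ q * sin \<phi>)"

lemma weighted_square_sum_pos:
  assumes "0 < p" "0 < q"
  shows "0 < real p * (cos \<phi>)\<^sup>2 + real q * (sin \<phi>)\<^sup>2"
proof (cases "cos \<phi> = 0")
  case True
  then have "sin \<phi> \<noteq> 0" using sin_cos_squared_add[of \<phi>] by auto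
  then show ?thesis using True assms by simp
next
  case False
  then show ?thesis using assms by (intro add_pos_nonneg) auto
qed

lemma polar_jacobian_pos: "0 < p \<Longrightarrow> 0 < q \<Longrightarrow> 0 < \<rho> \<Longrightarrow> 0 < polar_jacobian p q \<phi> \<rho>"
  unfolding polar_jacobian_def using weighted_square_sum_pos by (intro mult_pos_pos) auto

lemma polar_R_pos_radius:
  "0 < \<rho> \<Longrightarrow> polar_R P Q p q \<phi> \<rho> =
     radial_numerator P Q p q \<phi> \<rho> / polar_jacobian p q \<phi> \<rho> / \<rho> powi leading_degree P Q p q"
  by (simp add: polar_R_def radial_numerator_def polar_jacobian_def Let_def)

lemma polar_Theta_pos_radius:
  "0 < \<rho> \<Longrightarrow> polar_Theta P Q p q \<phi> \<rho> =
     angular_numerator P Q p q \<phi> \<rho> / polar_jacobian p q \<phi> \<rho> / \<rho> powi leading_degree P Q p q"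
  by (simp add: polar_Theta_def angular_numerator_def polar_jacobian_def Let_def)

lemma polar_Theta_eq_0_iff:
  "0 < p \<Longrightarrow> 0 < q \<Longrightarrow> 0 < \<rho> \<Longrightarrow> polar_Theta P Q p q \<phi> \<rho> = 0 \<longleftrightarrow> angular_numerator P Q p q \<phi> \<rho> = 0"
  using polar_jacobian_pos[of p q \<rho> \<phi>] by (simp add: polar_Theta_pos_radius)

lemma polar_F_pos_radius:
  "0 < p \<Longrightarrow> 0 < q \<Longrightarrow> 0 < \<rho> \<Longrightarrow>
     polar_F P Q p q \<phi> \<rho> = radial_numerator P Q p q \<phi> \<rho> / angular_numerator P Q p q \<phi> \<rho>"
  using polar_jacobian_pos[of p q \<rho> \<phi>]
  by (simp add: polar_F_def polar_R_pos_radius polar_Theta_pos_radius)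

text \<open>
  For \<open>\<rho> < 1\<close> both \<open>\<rho>\<^sup>p\<close> and \<open>\<rho>\<^sup>q\<close> are at most \<open>\<rho>\<close>, so the points with \<open>\<rho> < r\<close> lie in the square of
  half-width \<open>r\<close>.
\<close>

lemma C1_in_weighted_polar:
  fixes f :: "real \<Rightarrow> real \<Rightarrow> real"
  assumes "0 < p" "0 < q" "0 < \<delta>" "\<delta> \<le> 1" "\<delta> \<le> r"
    and f: "C1_on ({-r<..<r} \<times> {-r<..<r}) f"
  shows "continuous_on (UNIV \<times> {0<..<\<delta>}) (\<lambda>(\<phi>, \<rho>). f (\<rho> ^ p * cos \<phi>) (\<rho> ^ q * sin \<phi>))"
    and "\<exists>f1. continuous_on (UNIV \<times> {0<..<\<delta>}) f1 \<and> (\<forall>\<phi>. \<forall>\<rho>\<in>{0<..<\<delta>}.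
      ((\<lambda>s. f (s ^ p * cos \<phi>) (s ^ q * sin \<phi>)) has_real_derivative f1 (\<phi>, \<rho>)) (at \<rho>))"
proof -
  define B where "B r = {-r<..<r} \<times> {-r<..<r}" for r :: real
  obtain fx fy where fx: "continuous_on (B r) fx" and fy: "continuous_on (B r) fy"
    and "\<forall>z\<in>B r. ((\<lambda>(x, y). f x y) has_derivative (\<lambda>(a, b). a * fx z + b * fy z)) (at z)"
    using f unfolding C1_on_def B_def by blast
  note deriv = bspec[OF this(3)]
  define h where "h = (\<lambda>z::real \<times> real. (snd z ^ p * cos (fst z), snd z ^ q * sin (fst z)))"
  have abs_less: "\<bar>\<rho> ^ k * c\<bar> < r" if "0 < \<rho>" "\<rho> < \<delta>" "0 < k" "\<bar>c\<bar> \<le> 1" for \<rho> c :: real and k :: nat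
  proof -
    have "\<bar>\<rho> ^ k * c\<bar> \<le> \<rho> ^ k" using that by (simp add: abs_mult mult_left_le)
    also have "\<dots> \<le> \<rho> ^ 1" using that \<open>\<delta> \<le> 1\<close> by (intro power_decreasing) auto
    finally show ?thesis using that \<open>\<delta> \<le> r\<close> by simp
  qed
  have hB: "h z \<in> B r" if "z \<in> UNIV \<times> {0<..<\<delta>}" for z
    using abs_less[of "snd z" p "cos (fst z)"] abs_less[of "snd z" q "sin (fst z)"] that assms(1,2)
    by (auto simp: h_def B_def abs_less_iff)
  have hcont: "continuous_on (UNIV \<times> {0<..<\<delta>}) h"
    unfolding h_def by (intro continuous_intros)
  have fcont: "continuous_on (B r) (\<lambda>(x, y). f x y)"
    by (intro continuous_at_imp_continuous_on ballI) (rule has_derivative_continuous, erule deriv)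
  have comp: "continuous_on (UNIV \<times> {0<..<\<delta>}) (\<lambda>z. g (h z))" if "continuous_on (B r) g"
    for g :: "real \<times> real \<Rightarrow> real"
    by (rule continuous_on_compose2[OF that hcont]) (use hB in auto)
  show "continuous_on (UNIV \<times> {0<..<\<delta>}) (\<lambda>(\<phi>, \<rho>). f (\<rho> ^ p * cos \<phi>) (\<rho> ^ q * sin \<phi>))"
    using comp[OF fcont] by (simp add: h_def case_prod_unfold)
  define f1 where "f1 z = real p * snd z ^ (p - 1) * cos (fst z) * fx (h z)
    + real q * snd z ^ (q - 1) * sin (fst z) * fy (h z)" for z
  have "continuous_on (UNIV \<times> {0<..<\<delta>}) f1"
    unfolding f1_def by (intro continuous_intros comp fx fy)
  moreover have "((\<lambda>s. f (s ^ p * cos \<phi>) (s ^ q * sin \<phi>)) has_real_derivative f1 (\<phi>, \<rho>)) (at \<rho>)"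
    if "\<rho> \<in> {0<..<\<delta>}" for \<phi> \<rho>
  proof -
    have "((\<lambda>s. (s ^ p * cos \<phi>, s ^ q * sin \<phi>)) has_derivative
        (\<lambda>t. (t * (real p * \<rho> ^ (p - 1) * cos \<phi>), t * (real q * \<rho> ^ (q - 1) * sin \<phi>)))) (at \<rho>)"
      by (intro has_derivative_Pair) (rule has_derivative_eq_rhs, (rule derivative_intros)+,
         simp add: fun_eq_iff)+
    moreover have "((\<lambda>(x, y). f x y) has_derivative
        (\<lambda>(a, b). a * fx (h (\<phi>, \<rho>)) + b * fy (h (\<phi>, \<rho>)))) (at (\<rho> ^ p * cos \<phi>, \<rho> ^ q * sin \<phi>))"
      using deriv[OF hB[of "(\<phi>, \<rho>)"]] that by (simp add: h_def)
    ultimately have "((\<lambda>s. f (s ^ p * cos \<phi>) (s ^ q * sin \<phi>)) has_derivative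
        (\<lambda>t. t * (real p * \<rho> ^ (p - 1) * cos \<phi>) * fx (h (\<phi>, \<rho>))
           + t * (real q * \<rho> ^ (q - 1) * sin \<phi>) * fy (h (\<phi>, \<rho>)))) (at \<rho>)"
      by (auto dest: has_derivative_compose)
    then show ?thesis
      unfolding has_field_derivative_def
      by (rule has_derivative_eq_rhs) (simp add: fun_eq_iff f1_def algebra_simps)
  qed
  ultimately show "\<exists>f1. continuous_on (UNIV \<times> {0<..<\<delta>}) f1 \<and> (\<forall>\<phi>. \<forall>\<rho>\<in>{0<..<\<delta>}.
      ((\<lambda>s. f (s ^ p * cos \<phi>) (s ^ q * sin \<phi>)) has_real_derivative f1 (\<phi>, \<rho>)) (at \<rho>))"
    by blast
qed

lemma polar_numerators_C1:
  fixes P Q :: "real \<Rightarrow> real \<Rightarrow> real"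
  assumes "0 < p" "0 < q" "0 < \<delta>" "\<delta> \<le> 1" "\<delta> \<le> r"
    and P: "C1_on ({-r<..<r} \<times> {-r<..<r}) P" and Q: "C1_on ({-r<..<r} \<times> {-r<..<r}) Q"
  shows "continuous_on (UNIV \<times> {0<..<\<delta>}) (\<lambda>(\<phi>, \<rho>). radial_numerator P Q p q \<phi> \<rho>)"
    and "continuous_on (UNIV \<times> {0<..<\<delta>}) (\<lambda>(\<phi>, \<rho>). angular_numerator P Q p q \<phi> \<rho>)"
    and "\<exists>R1. continuous_on (UNIV \<times> {0<..<\<delta>}) R1 \<and> (\<forall>\<phi>. \<forall>\<rho>\<in>{0<..<\<delta>}.
      (radial_numerator P Q p q \<phi> has_real_derivative R1 (\<phi>, \<rho>)) (at \<rho>))"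
    and "\<exists>A1. continuous_on (UNIV \<times> {0<..<\<delta>}) A1 \<and> (\<forall>\<phi>. \<forall>\<rho>\<in>{0<..<\<delta>}.
      (angular_numerator P Q p q \<phi> has_real_derivative A1 (\<phi>, \<rho>)) (at \<rho>))"
proof -
  note cP = C1_in_weighted_polar(1)[OF assms(1-5) P]
  note cQ = C1_in_weighted_polar(1)[OF assms(1-5) Q]
  obtain P1 where P1: "continuous_on (UNIV \<times> {0<..<\<delta>}) P1"
    "\<And>\<phi> \<rho>. \<rho> \<in> {0<..<\<delta>} \<Longrightarrow>
      ((\<lambda>s. P (s ^ p * cos \<phi>) (s ^ q * sin \<phi>)) has_real_derivative P1 (\<phi>, \<rho>)) (at \<rho>)"
    using C1_in_weighted_polar(2)[OF assms(1-5) P] by blast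
  obtain Q1 where Q1: "continuous_on (UNIV \<times> {0<..<\<delta>}) Q1"
    "\<And>\<phi> \<rho>. \<rho> \<in> {0<..<\<delta>} \<Longrightarrow>
      ((\<lambda>s. Q (s ^ p * cos \<phi>) (s ^ q * sin \<phi>)) has_real_derivative Q1 (\<phi>, \<rho>)) (at \<rho>)"
    using C1_in_weighted_polar(2)[OF assms(1-5) Q] by blast
  show "continuous_on (UNIV \<times> {0<..<\<delta>}) (\<lambda>(\<phi>, \<rho>). radial_numerator P Q p q \<phi> \<rho>)"
    and "continuous_on (UNIV \<times> {0<..<\<delta>}) (\<lambda>(\<phi>, \<rho>). angular_numerator P Q p q \<phi> \<rho>)"
    using cP cQ unfolding radial_numerator_def angular_numerator_def case_prod_unfold
    by (intro continuous_intros; simp)+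
  let ?P = "\<lambda>z. P (snd z ^ p * cos (fst z)) (snd z ^ q * sin (fst z))"
  let ?Q = "\<lambda>z. Q (snd z ^ p * cos (fst z)) (snd z ^ q * sin (fst z))"
  have c: "continuous_on (UNIV \<times> {0<..<\<delta>}) ?P" "continuous_on (UNIV \<times> {0<..<\<delta>}) ?Q"
    using cP cQ by (simp_all add: case_prod_unfold)
  have D: "((\<lambda>s. s ^ k * a * G s) has_real_derivative real k * \<rho> ^ (k - 1) * a * G \<rho> + \<rho> ^ k * a * G1) (at \<rho>)"
    if "(G has_real_derivative G1) (at \<rho>)" for G and G1 a \<rho> :: real and k
    by (auto intro!: derivative_eq_intros that)
  show "\<exists>R1. continuous_on (UNIV \<times> {0<..<\<delta>}) R1 \<and> (\<forall>\<phi>. \<forall>\<rho>\<in>{0<..<\<delta>}.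
      (radial_numerator P Q p q \<phi> has_real_derivative R1 (\<phi>, \<rho>)) (at \<rho>))"
  proof (intro exI conjI allI ballI)
    define R1 where "R1 z = real q * snd z ^ (q - 1) * cos (fst z) * ?P z + snd z ^ q * cos (fst z) * P1 z
        + (real p * snd z ^ (p - 1) * sin (fst z) * ?Q z + snd z ^ p * sin (fst z) * Q1 z)" for z
    show "continuous_on (UNIV \<times> {0<..<\<delta>}) R1"
      unfolding R1_def by (intro continuous_intros c P1 Q1)
    fix \<phi> \<rho> assume \<rho>: "\<rho> \<in> {0<..<\<delta>}"
    show "(radial_numerator P Q p q \<phi> has_real_derivative R1 (\<phi>, \<rho>)) (at \<rho>)"
      using DERIV_add[OF D[OF P1(2)[OF \<rho>], of q "cos \<phi>"] D[OF Q1(2)[OF \<rho>], of p "sin \<phi>"]]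
      by (simp add: R1_def radial_numerator_def[abs_def])
  qed
  show "\<exists>A1. continuous_on (UNIV \<times> {0<..<\<delta>}) A1 \<and> (\<forall>\<phi>. \<forall>\<rho>\<in>{0<..<\<delta>}.
      (angular_numerator P Q p q \<phi> has_real_derivative A1 (\<phi>, \<rho>)) (at \<rho>))"
  proof (intro exI conjI allI ballI)
    define A1 where "A1 z = real (p - 1) * snd z ^ (p - 1 - 1) * (real p * cos (fst z)) * ?Q z
          + snd z ^ (p - 1) * (real p * cos (fst z)) * Q1 z
        - (real (q - 1) * snd z ^ (q - 1 - 1) * (real q * sin (fst z)) * ?P z
          + snd z ^ (q - 1) * (real q * sin (fst z)) * P1 z)" for z
    show "continuous_on (UNIV \<times> {0<..<\<delta>}) A1"
      unfolding A1_def by (intro continuous_intros c P1 Q1)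
    fix \<phi> \<rho> assume \<rho>: "\<rho> \<in> {0<..<\<delta>}"
    have "angular_numerator P Q p q \<phi> = (\<lambda>s. s ^ (p - 1) * (real p * cos \<phi>) * Q (s ^ p * cos \<phi>) (s ^ q * sin \<phi>)
        - s ^ (q - 1) * (real q * sin \<phi>) * P (s ^ p * cos \<phi>) (s ^ q * sin \<phi>))"
      by (simp add: fun_eq_iff angular_numerator_def)
    then show "(angular_numerator P Q p q \<phi> has_real_derivative A1 (\<phi>, \<rho>)) (at \<rho>)"
      using DERIV_diff[OF D[OF Q1(2)[OF \<rho>], of "p - 1" "real p * cos \<phi>"]
          D[OF P1(2)[OF \<rho>], of "q - 1" "real q * sin \<phi>"]]
      by (simp only: A1_def fst_conv snd_conv)
  qed
qed

lemma polar_F_C1: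
  fixes P Q :: "real \<Rightarrow> real \<Rightarrow> real"
  assumes pq: "0 < p" "0 < q" and \<delta>: "0 < \<delta>" "\<delta> \<le> 1" "\<delta> \<le> r"
    and P: "C1_on ({-r<..<r} \<times> {-r<..<r}) P" and Q: "C1_on ({-r<..<r} \<times> {-r<..<r}) Q"
    and nz: "\<And>\<phi> \<rho>. 0 < \<rho> \<Longrightarrow> \<rho> < \<delta> \<Longrightarrow> angular_numerator P Q p q \<phi> \<rho> \<noteq> 0"
  shows "continuous_on (UNIV \<times> {0<..<\<delta>}) (\<lambda>(\<phi>, \<rho>). polar_F P Q p q \<phi> \<rho>)"
    and "\<exists>F1. continuous_on (UNIV \<times> {0<..<\<delta>}) F1 \<and> (\<forall>\<phi>. \<forall>\<rho>\<in>{0<..<\<delta>}.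
      (polar_F P Q p q \<phi> has_real_derivative F1 (\<phi>, \<rho>)) (at \<rho>))"
proof -
  note C1 = polar_numerators_C1[OF pq \<delta> P Q]
  let ?R = "\<lambda>z. radial_numerator P Q p q (fst z) (snd z)"
  let ?A = "\<lambda>z. angular_numerator P Q p q (fst z) (snd z)"
  have c: "continuous_on (UNIV \<times> {0<..<\<delta>}) ?R" "continuous_on (UNIV \<times> {0<..<\<delta>}) ?A"
    using C1(1,2) by (simp_all add: case_prod_unfold)
  have "continuous_on (UNIV \<times> {0<..<\<delta>}) (\<lambda>z. ?R z / ?A z)"
    by (intro continuous_intros c) (use nz in auto)
  then show "continuous_on (UNIV \<times> {0<..<\<delta>}) (\<lambda>(\<phi>, \<rho>). polar_F P Q p q \<phi> \<rho>)"
    by (rule continuous_on_cong[THEN iffD1, rotated 2]) (auto simp: polar_F_pos_radius pq)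
  obtain R1 where R1: "continuous_on (UNIV \<times> {0<..<\<delta>}) R1"
    "\<And>\<phi> \<rho>. \<rho> \<in> {0<..<\<delta>} \<Longrightarrow> (radial_numerator P Q p q \<phi> has_real_derivative R1 (\<phi>, \<rho>)) (at \<rho>)"
    using C1(3) by blast
  obtain A1 where A1: "continuous_on (UNIV \<times> {0<..<\<delta>}) A1"
    "\<And>\<phi> \<rho>. \<rho> \<in> {0<..<\<delta>} \<Longrightarrow> (angular_numerator P Q p q \<phi> has_real_derivative A1 (\<phi>, \<rho>)) (at \<rho>)"
    using C1(4) by blast
  show "\<exists>F1. continuous_on (UNIV \<times> {0<..<\<delta>}) F1 \<and> (\<forall>\<phi>. \<forall>\<rho>\<in>{0<..<\<delta>}.
      (polar_F P Q p q \<phi> has_real_derivative F1 (\<phi>, \<rho>)) (at \<rho>))"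
  proof (intro exI conjI allI ballI)
    define F1 where "F1 z = (R1 z * ?A z - ?R z * A1 z) / (?A z * ?A z)" for z
    show "continuous_on (UNIV \<times> {0<..<\<delta>}) F1"
      unfolding F1_def by (intro continuous_intros c R1 A1) (use nz in auto)
    fix \<phi> \<rho> assume \<rho>: "\<rho> \<in> {0<..<\<delta>}"
    have "((\<lambda>s. radial_numerator P Q p q \<phi> s / angular_numerator P Q p q \<phi> s)
        has_real_derivative F1 (\<phi>, \<rho>)) (at \<rho>)"
      using DERIV_divide[OF R1(2)[OF \<rho>] A1(2)[OF \<rho>]] nz \<rho> by (simp add: F1_def)
    then show "(polar_F P Q p q \<phi> has_real_derivative F1 (\<phi>, \<rho>)) (at \<rho>)"
      by (rule has_field_derivative_transform_within_open[of _ _ _ "{0<..}"])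
        (use \<rho> pq in \<open>auto simp: polar_F_pos_radius\<close>)
  qed
qed

section \<open>Monodromic orbits in weighted polar coordinates\<close>

text \<open>
  A continuous lift \<open>c\<close> of a differentiable curve through \<open>\<Psi>\<close> is differentiable where the
  derivative of \<open>\<Psi>\<close> has a left inverse \<open>B\<close>. Applying \<open>B\<close> to the first-order expansions of \<open>\<Psi>\<close>
  and \<open>\<Psi> \<circ> c\<close> bounds the error of \<open>c\<close> by \<open>e (|\<Delta>c| + |\<Delta>t|)\<close>. Taking \<open>e = 1/2\<close> shows that \<open>c\<close> is
  Lipschitz at the point, after which the error is \<open>o(|\<Delta>t|)\<close>.
\<close>

lemma has_derivative_lift:
  fixes c :: "'a::real_normed_vector \<Rightarrow> 'b::real_normed_vector" and \<Psi> :: "'b \<Rightarrow> 'c::real_normed_vector"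
  assumes \<Psi>: "(\<Psi> has_derivative A) (at (c t))"
    and B: "bounded_linear B" "\<And>v. B (A v) = v"
    and c: "continuous (at t within S) c"
    and D: "((\<lambda>s. \<Psi> (c s)) has_derivative D) (at t within S)"
  shows "(c has_derivative (\<lambda>h. B (D h))) (at t within S)"
proof -
  interpret B: bounded_linear B by (rule B(1))
  obtain k where k: "0 < k" "\<And>x. norm (B x) \<le> norm x * k" using B.pos_bounded by blast
  have blD: "bounded_linear D" using D by (rule has_derivative_bounded_linear)
  obtain l where l: "0 < l" "\<And>x. norm (D x) \<le> norm x * l"
    using bounded_linear.pos_bounded[OF blD] by blast
  have lin: "linear A" using \<Psi> has_derivative_linear by blast
  have err: "\<forall>\<^sub>F s in at t within S.
      norm (c s - c t - B (D (s - t))) \<le> e * norm (c s - c t) + e * norm (s - t)" if "0 < e" for e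
  proof -
    define d where "d = e / k"
    have d: "0 < d" "d * k = e" using k that by (auto simp: d_def)
    have "\<forall>\<^sub>F y in nhds (c t). norm (\<Psi> y - \<Psi> (c t) - A (y - c t)) \<le> d * norm (y - c t)"
      using \<Psi> d unfolding has_derivative_at_alt eventually_nhds_metric dist_norm by blast
    then have 1: "\<forall>\<^sub>F s in at t within S. norm (\<Psi> (c s) - \<Psi> (c t) - A (c s - c t)) \<le> d * norm (c s - c t)"
      by (rule eventually_compose_filterlim) (use c in \<open>simp add: continuous_within\<close>)
    have 2: "\<forall>\<^sub>F s in at t within S. norm (\<Psi> (c s) - \<Psi> (c t) - D (s - t)) \<le> d * norm (s - t)"
      using D d unfolding has_derivative_within_alt2 by blast
    show ?thesis
      using 1 2
    proof eventually_elim
      case (elim s)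
      have "c s - c t - B (D (s - t))
        = B (\<Psi> (c s) - \<Psi> (c t) - D (s - t)) - B (\<Psi> (c s) - \<Psi> (c t) - A (c s - c t))"
        using B(2) by (simp add: B.diff)
      also have "norm \<dots> \<le> norm (B (\<Psi> (c s) - \<Psi> (c t) - D (s - t))) + norm (B (\<Psi> (c s) - \<Psi> (c t) - A (c s - c t)))"
        by (rule norm_triangle_ineq4)
      also have "\<dots> \<le> d * norm (s - t) * k + d * norm (c s - c t) * k"
        using elim k by (intro add_mono order_trans[OF k(2)] mult_right_mono) auto
      also have "\<dots> = e * norm (c s - c t) + e * norm (s - t)"
        using d(2) by (simp add: algebra_simps flip: d(2))
      finally show ?case .
    qed
  qed
  have lip: "\<forall>\<^sub>F s in at t within S. norm (c s - c t) \<le> (2 * k * l + 1) * norm (s - t)"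
    using err[of "1 / 2"]
  proof (rule eventually_mono)
    show "(0::real) < 1 / 2" by simp
    fix s assume "norm (c s - c t - B (D (s - t))) \<le> 1 / 2 * norm (c s - c t) + 1 / 2 * norm (s - t)"
    moreover have "norm (c s - c t) \<le> norm (c s - c t - B (D (s - t))) + norm (B (D (s - t)))"
      by (metis diff_add_cancel norm_triangle_ineq)
    moreover have "norm (B (D (s - t))) \<le> norm (s - t) * l * k"
      using order_trans[OF k(2) mult_right_mono[OF l(2)]] k(1) by simp
    ultimately show "norm (c s - c t) \<le> (2 * k * l + 1) * norm (s - t)"
      by (simp add: algebra_simps)
  qed
  show ?thesis
    unfolding has_derivative_within_alt2
  proof (intro conjI allI impI)
    show "bounded_linear (\<lambda>h. B (D h))" by (rule bounded_linear_compose[OF B(1) blD])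
    fix e :: real assume "0 < e"
    define m where "m = 2 * k * l + 2"
    have m: "0 < m" using k l by (simp add: m_def add_pos_pos)
    have "\<forall>\<^sub>F s in at t within S. norm (c s - c t - B (D (s - t))) \<le> e / m * norm (c s - c t) + e / m * norm (s - t)"
      using err[of "e / m"] m \<open>0 < e\<close> by simp
    then show "\<forall>\<^sub>F s in at t within S. norm (c s - c t - B (D (s - t))) \<le> e * norm (s - t)"
      using lip
    proof eventually_elim
      case (elim s)
      have "norm (c s - c t - B (D (s - t))) \<le> e / m * ((2 * k * l + 1) * norm (s - t)) + e / m * norm (s - t)"
        using elim(1) mult_left_mono[OF elim(2), of "e / m"] m \<open>0 < e\<close> by simp
      also have "\<dots> = e / m * (m * norm (s - t))" by (simp add: m_def algebra_simps)
      also have "\<dots> = e * norm (s - t)" using m by simp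
      finally show ?case .
    qed
  qed
qed

text \<open>
  The weighted radius of \<open>(x, y)\<close> is the \<open>\<rho>\<close> at which this sum of squares is \<open>1\<close>. Strict
  monotonicity makes it unique, and continuous in \<open>(x, y)\<close>.
\<close>

lemma weighted_radius_decreasing:
  fixes x y :: real
  assumes "0 < p" "0 < q" "0 < a" "a < b" "(x, y) \<noteq> (0, 0)"
  shows "(x / b ^ p)\<^sup>2 + (y / b ^ q)\<^sup>2 < (x / a ^ p)\<^sup>2 + (y / a ^ q)\<^sup>2"
proof -
  have lt: "(z / b ^ k)\<^sup>2 < (z / a ^ k)\<^sup>2" if "z \<noteq> 0" "0 < k" for z :: real and k :: nat
  proof -
    have "a ^ k < b ^ k" using assms that by (intro power_strict_mono) auto
    then have "\<bar>z / b ^ k\<bar> < \<bar>z / a ^ k\<bar>"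
      using that assms by (simp add: abs_divide frac_less2)
    from power_strict_mono[OF this abs_ge_zero pos2] show ?thesis by (simp only: power2_abs)
  qed
  show ?thesis
  proof (cases "x = 0")
    case True
    then show ?thesis using assms lt[of y q] by simp
  next
    case False
    then show ?thesis using assms lt[of x p] lt[of y q]
      by (cases "y = 0") (auto intro: add_strict_mono)
  qed
qed

lemma weighted_radius_exists:
  fixes x y :: real
  assumes "0 < p" "0 < q" "(x, y) \<noteq> (0, 0)"
  shows "\<exists>\<rho>>0. (x / \<rho> ^ p)\<^sup>2 + (y / \<rho> ^ q)\<^sup>2 = 1"
proof -
  define h where "h \<rho> = (x / \<rho> ^ p)\<^sup>2 + (y / \<rho> ^ q)\<^sup>2" for \<rho>
  have big: "1 \<le> (z / (min 1 \<bar>z\<bar>) ^ k)\<^sup>2" if "z \<noteq> 0" "0 < k" for z :: real and k :: nat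
  proof -
    have "(min 1 \<bar>z\<bar>) ^ k \<le> (min 1 \<bar>z\<bar>) ^ 1" using that by (intro power_decreasing) auto
    then have "1 \<le> \<bar>z / (min 1 \<bar>z\<bar>) ^ k\<bar>" using that by (simp add: le_divide_eq)
    then show ?thesis by (simp add: one_le_power flip: power2_abs[of "z / _"])
  qed
  obtain a where a: "0 < a" "a \<le> 1" "1 \<le> h a"
  proof (cases "x = 0")
    case True
    then show ?thesis using that[of "min 1 \<bar>y\<bar>"] big[of y q] assms by (auto simp: h_def)
  next
    case False
    then show ?thesis using that[of "min 1 \<bar>x\<bar>"] big[of x p] assms by (simp add: h_def add_increasing2)
  qed
  define b where "b = 1 + \<bar>x\<bar> + \<bar>y\<bar>"
  have "(z / b ^ k)\<^sup>2 \<le> (z / b)\<^sup>2" if "0 < k" for z :: real and k :: nat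
  proof -
    have "b ^ 1 \<le> b ^ k" using that by (intro power_increasing) (auto simp: b_def)
    then have "\<bar>z / b ^ k\<bar> \<le> \<bar>z / b\<bar>"
      by (auto simp: abs_divide b_def intro!: divide_left_mono)
    then show ?thesis by (rule abs_le_square_iff[THEN iffD1])
  qed
  then have "h b \<le> (x / b)\<^sup>2 + (y / b)\<^sup>2" unfolding h_def using assms by (intro add_mono) auto
  also have "\<dots> \<le> 1"
  proof -
    have "x\<^sup>2 + y\<^sup>2 \<le> (\<bar>x\<bar> + \<bar>y\<bar>)\<^sup>2" by (simp add: power2_sum)
    also have "\<dots> \<le> b\<^sup>2" by (intro power_mono) (auto simp: b_def)
    finally show ?thesis by (simp add: power_divide b_def flip: add_divide_distrib)
  qed
  finally have "h b \<le> 1" .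
  moreover have "continuous_on {a..b} h"
    unfolding h_def using a by (intro continuous_intros) auto
  moreover have "a \<le> b" using a by (simp add: b_def)
  ultimately obtain \<rho> where "a \<le> \<rho>" "\<rho> \<le> b" "h \<rho> = 1"
    using IVT2'[of h b 1 a] a by (metis \<open>a \<le> b\<close>)
  then show ?thesis using a by (intro exI[of _ \<rho>]) (auto simp: h_def)
qed

lemma polar_curve_has_derivative:
  fixes \<phi> \<rho> :: "real \<Rightarrow> real"
  assumes "0 < p" "0 < q" "0 < \<rho> t" and cont: "continuous (at t within S) \<phi>" "continuous (at t within S) \<rho>"
    and D: "((\<lambda>s. (\<rho> s ^ p * cos (\<phi> s), \<rho> s ^ q * sin (\<phi> s))) has_vector_derivative
        (P (\<rho> t ^ p * cos (\<phi> t)) (\<rho> t ^ q * sin (\<phi> t)), Q (\<rho> t ^ p * cos (\<phi> t)) (\<rho> t ^ q * sin (\<phi> t))))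
        (at t within S)"
  shows "(\<phi> has_real_derivative angular_numerator P Q p q (\<phi> t) (\<rho> t) / polar_jacobian p q (\<phi> t) (\<rho> t)) (at t within S)"
    and "(\<rho> has_real_derivative radial_numerator P Q p q (\<phi> t) (\<rho> t) / polar_jacobian p q (\<phi> t) (\<rho> t)) (at t within S)"
proof -
  define f r where "f = \<phi> t" and "r = \<rho> t"
  define J where "J = polar_jacobian p q f r"
  have r: "0 < r" "J \<noteq> 0" using polar_jacobian_pos[of p q r f] assms by (auto simp: r_def J_def)
  define \<Psi> where "\<Psi> = (\<lambda>z::real \<times> real. (snd z ^ p * cos (fst z), snd z ^ q * sin (fst z)))"
  define A where "A = (\<lambda>v::real \<times> real.
    (real p * r ^ (p - 1) * cos f * snd v - r ^ p * sin f * fst v,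
     real q * r ^ (q - 1) * sin f * snd v + r ^ q * cos f * fst v))"
  \<comment> \<open>\<open>A\<close> is the derivative of \<open>\<Psi>\<close>, and \<open>B\<close> is its inverse by Cramer's rule.\<close>
  define B where "B = (\<lambda>w::real \<times> real.
    ((real p * r ^ (p - 1) * cos f * snd w - real q * r ^ (q - 1) * sin f * fst w) / J,
     (r ^ q * cos f * fst w + r ^ p * sin f * snd w) / J))"
  have 1: "(\<Psi> has_derivative A) (at (\<phi> t, \<rho> t))"
    unfolding \<Psi>_def A_def
    by (intro has_derivative_Pair) (rule has_derivative_eq_rhs, (rule derivative_intros)+,
         simp add: fun_eq_iff f_def r_def algebra_simps)+
  have 2: "bounded_linear B"
    unfolding B_def
    by (rule linear_conv_bounded_linear[THEN iffD1], rule linearI) (use r in \<open>simp_all add: field_simps\<close>)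
  have pow: "r ^ p = r * r ^ (p - 1)" "r ^ q = r * r ^ (q - 1)"
     "r ^ (p + q - 1) = r * r ^ (p - 1) * r ^ (q - 1)"
    using assms by (cases p; cases q; simp add: power_add)+
  have 3: "B (A v) = v" for v
  proof -
    have "(real p * r ^ (p - 1) * cos f * snd (A v) - real q * r ^ (q - 1) * sin f * fst (A v)) = J * fst v"
      "(r ^ q * cos f * fst (A v) + r ^ p * sin f * snd (A v)) = J * snd v"
      unfolding A_def J_def polar_jacobian_def pow fst_conv snd_conv
      by (simp_all add: algebra_simps power2_eq_square)
    then show ?thesis using r by (simp add: B_def)
  qed
  have 4: "continuous (at t within S) (\<lambda>s. (\<phi> s, \<rho> s))"
    using cont by (intro continuous_intros)
  have 5: "((\<lambda>s. \<Psi> (\<phi> s, \<rho> s)) has_derivative (\<lambda>h. h *\<^sub>R (P (r ^ p * cos f) (r ^ q * sin f), Q (r ^ p * cos f) (r ^ q * sin f))))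
     (at t within S)"
    using D by (simp add: has_vector_derivative_def \<Psi>_def f_def r_def)
  have "((\<lambda>s. (\<phi> s, \<rho> s)) has_derivative (\<lambda>h. h *\<^sub>R
      (angular_numerator P Q p q f r / J, radial_numerator P Q p q f r / J))) (at t within S)"
    by (rule has_derivative_eq_rhs[OF has_derivative_lift[OF 1 2 3 4 5]])
      (simp add: B_def angular_numerator_def radial_numerator_def fun_eq_iff algebra_simps diff_divide_distrib add_divide_distrib)
  from has_derivative_fst[OF this] has_derivative_snd[OF this]
  show "(\<phi> has_real_derivative angular_numerator P Q p q (\<phi> t) (\<rho> t) / polar_jacobian p q (\<phi> t) (\<rho> t)) (at t within S)"
    "(\<rho> has_real_derivative radial_numerator P Q p q (\<phi> t) (\<rho> t) / polar_jacobian p q (\<phi> t) (\<rho> t)) (at t within S)"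
    unfolding has_field_derivative_def f_def r_def J_def
    by (auto elim!: has_derivative_eq_rhs)
qed

text \<open>
  The points \<open>(x, y)\<close> and \<open>(x / a, y / b)\<close> have coordinates of the same signs, so the angle between
  them is less than \<open>\<pi> / 2\<close>; its sine is the argument of \<open>arcsin\<close> below. This turns a continuous
  Euclidean angle \<open>\<theta>\<close> into a continuous weighted angle, and the two agree on the positive
  \<open>x\<close>-axis.
\<close>

lemma weighted_polar_lift:
  fixes x y \<theta> n :: real
  assumes "0 < a" "0 < b" "0 < n" "x = n * cos \<theta>" "y = n * sin \<theta>"
    and "(x / a)\<^sup>2 + (y / b)\<^sup>2 = 1"
  defines "\<phi> \<equiv> \<theta> + arcsin (y / b * cos \<theta> - x / a * sin \<theta>)"
  shows "\<bar>y / b * cos \<theta> - x / a * sin \<theta>\<bar> \<le> 1" "x = a * cos \<phi>" "y = b * sin \<phi>"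
proof -
  define u w where "u = x / a" and "w = y / b"
  define s k where "s = w * cos \<theta> - u * sin \<theta>" and "k = u * cos \<theta> + w * sin \<theta>"
  have uw: "u\<^sup>2 + w\<^sup>2 = 1" using assms(6) by (simp add: u_def w_def)
  have "s\<^sup>2 + k\<^sup>2 = (u\<^sup>2 + w\<^sup>2) * ((sin \<theta>)\<^sup>2 + (cos \<theta>)\<^sup>2)"
    unfolding s_def k_def power2_eq_square by algebra
  then have sk: "s\<^sup>2 + k\<^sup>2 = 1" using uw by simp
  have "k = n * ((cos \<theta>)\<^sup>2 / a + (sin \<theta>)\<^sup>2 / b)"
    using assms by (simp add: k_def u_def w_def power2_eq_square algebra_simps)
  moreover have "0 < (cos \<theta>)\<^sup>2 / a + (sin \<theta>)\<^sup>2 / b"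
  proof (cases "cos \<theta> = 0")
    case True
    then have "sin \<theta> \<noteq> 0" using sin_cos_squared_add[of \<theta>] by auto
    then show ?thesis using True assms by simp
  next
    case False
    then show ?thesis using assms by (intro add_pos_nonneg) auto
  qed
  ultimately have "0 < k" using assms by simp
  have "s\<^sup>2 \<le> 1" using sk by (metis le_add_same_cancel1 zero_le_power2)
  then have s1: "\<bar>s\<bar> \<le> 1" by (simp add: abs_square_le_1)
  then show "\<bar>y / b * cos \<theta> - x / a * sin \<theta>\<bar> \<le> 1" by (simp add: s_def u_def w_def)
  have "cos (arcsin s) = k"
    using s1 sk \<open>0 < k\<close> by (simp add: cos_arcsin abs_le_iff real_sqrt_unique algebra_simps)
  moreover have "sin (arcsin s) = s" using s1 by (simp add: abs_le_iff)
  ultimately have "cos \<phi> = cos \<theta> * k - sin \<theta> * s" "sin \<phi> = sin \<theta> * k + cos \<theta> * s"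
    by (simp_all add: \<phi>_def s_def u_def w_def cos_add sin_add)
  moreover have "cos \<theta> * k - sin \<theta> * s = u * ((sin \<theta>)\<^sup>2 + (cos \<theta>)\<^sup>2)"
    "sin \<theta> * k + cos \<theta> * s = w * ((sin \<theta>)\<^sup>2 + (cos \<theta>)\<^sup>2)"
    unfolding s_def k_def power2_eq_square by algebra+
  ultimately have "cos \<phi> = u" "sin \<phi> = w" by simp_all
  then show "x = a * cos \<phi>" "y = b * sin \<phi>" using assms by (simp_all add: u_def w_def)
qed

lemma weighted_radius_continuous:
  fixes x y \<rho> :: "real \<Rightarrow> real"
  assumes pq: "0 < p" "0 < q" and cont: "continuous_on S x" "continuous_on S y"
    and \<rho>: "\<And>t. t \<in> S \<Longrightarrow> 0 < \<rho> t" "\<And>t. t \<in> S \<Longrightarrow> (x t / \<rho> t ^ p)\<^sup>2 + (y t / \<rho> t ^ q)\<^sup>2 = 1"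
  shows "continuous_on S \<rho>"
  unfolding continuous_on_def
proof (intro ballI order_tendstoI)
  fix t a assume t: "t \<in> S"
  have nz: "(x s, y s) \<noteq> (0, 0)" if "s \<in> S" for s using \<rho>(2)[OF that] by auto
  have lim: "((\<lambda>s. (x s / a ^ p)\<^sup>2 + (y s / a ^ q)\<^sup>2) \<longlongrightarrow> (x t / a ^ p)\<^sup>2 + (y t / a ^ q)\<^sup>2) (at t within S)"
    if "a \<noteq> 0" for a
    using cont t that unfolding continuous_on_def by (intro tendsto_intros) auto
  have inS: "\<forall>\<^sub>F s in at t within S. s \<in> S" by (simp add: eventually_at_filter)
  show "\<forall>\<^sub>F s in at t within S. a < \<rho> s" if a: "a < \<rho> t"
  proof (cases "0 < a")
    case True
    have "1 < (x t / a ^ p)\<^sup>2 + (y t / a ^ q)\<^sup>2"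
      using weighted_radius_decreasing[OF pq True a nz[OF t]] \<rho>(2)[OF t] by simp
    then have "\<forall>\<^sub>F s in at t within S. 1 < (x s / a ^ p)\<^sup>2 + (y s / a ^ q)\<^sup>2"
      using order_tendstoD(1)[OF lim] True by simp
    then show ?thesis using inS
    proof eventually_elim
      case (elim s)
      then show ?case using weighted_radius_decreasing[OF pq \<rho>(1)[OF elim(2)], of a] \<rho>(2)[OF elim(2)] nz[OF elim(2)]
        by (metis less_asym linorder_neqE_linordered_idom order_less_irrefl)
    qed
  next
    case False
    then show ?thesis
      by (intro eventually_mono[OF inS]) (meson \<rho>(1) not_less order_le_less_trans)
  qed
  show "\<forall>\<^sub>F s in at t within S. \<rho> s < a" if a: "\<rho> t < a"
  proof -
    have pos: "0 < a" using \<rho>(1)[OF t] a by simp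
    have "(x t / a ^ p)\<^sup>2 + (y t / a ^ q)\<^sup>2 < 1"
      using weighted_radius_decreasing[OF pq \<rho>(1)[OF t] a nz[OF t]] \<rho>(2)[OF t] by simp
    then have "\<forall>\<^sub>F s in at t within S. (x s / a ^ p)\<^sup>2 + (y s / a ^ q)\<^sup>2 < 1"
      using order_tendstoD(2)[OF lim] pos by simp
    then show ?thesis using inS
    proof eventually_elim
      case (elim s)
      then show ?case using weighted_radius_decreasing[OF pq pos, of "\<rho> s"] \<rho>(2)[OF elim(2)] nz[OF elim(2)]
        by (metis less_asym linorder_neqE_linordered_idom order_less_irrefl)
    qed
  qed
qed

lemma continuous_attains_multiple_of_2pi:
  fixes \<theta> :: "real \<Rightarrow> real"
  assumes "0 \<le> T" "continuous_on {0..T} \<theta>" "2 * pi \<le> \<bar>\<theta> T - \<theta> 0\<bar>"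
  shows "\<exists>t\<in>{0..T}. \<exists>n::int. \<theta> t = 2 * pi * of_int n"
proof -
  define l where "l = min (\<theta> 0) (\<theta> T)"
  define n where "n = \<lceil>l / (2 * pi)\<rceil>"
  have "l / (2 * pi) \<le> of_int n" "of_int n < l / (2 * pi) + 1"
    unfolding n_def by linarith+
  then have "l \<le> 2 * pi * of_int n" "2 * pi * of_int n \<le> l + 2 * pi"
    using pi_gt_zero by (simp_all add: field_simps)
  then have "min (\<theta> 0) (\<theta> T) \<le> 2 * pi * of_int n" "2 * pi * of_int n \<le> max (\<theta> 0) (\<theta> T)"
    using assms(3) by (auto simp: l_def)
  then have "(\<theta> 0 \<le> 2 * pi * of_int n \<and> 2 * pi * of_int n \<le> \<theta> T) \<or>
     (\<theta> T \<le> 2 * pi * of_int n \<and> 2 * pi * of_int n \<le> \<theta> 0)"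
    by (auto simp: min_def max_def split: if_splits)
  then show ?thesis
    using IVT'[of \<theta> 0 "2 * pi * of_int n" T] IVT2'[of \<theta> T "2 * pi * of_int n" 0] assms(1,2)
    by (metis atLeastAtMost_iff)
qed

text \<open>
  Time is that of the original vector field, so that \<open>\<phi>\<close> need not be monotone a priori and the
  definition makes sense without any assumption on the zeros of the angular speed.
\<close>

definition polar_orbit ::
    "(real \<Rightarrow> real \<Rightarrow> real) \<Rightarrow> (real \<Rightarrow> real \<Rightarrow> real) \<Rightarrow> nat \<Rightarrow> nat \<Rightarrow> real
      \<Rightarrow> real \<Rightarrow> (real \<Rightarrow> real) \<Rightarrow> (real \<Rightarrow> real) \<Rightarrow> bool" where
  "polar_orbit P Q p q \<delta> T \<phi> \<rho> \<longleftrightarrow> 0 < T \<and>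
    (\<forall>t\<in>{0..T}. 0 < \<rho> t \<and> \<rho> t < \<delta> \<and>
      (\<phi> has_real_derivative angular_numerator P Q p q (\<phi> t) (\<rho> t) / polar_jacobian p q (\<phi> t) (\<rho> t))
        (at t within {0..T}) \<and>
      (\<rho> has_real_derivative radial_numerator P Q p q (\<phi> t) (\<rho> t) / polar_jacobian p q (\<phi> t) (\<rho> t))
        (at t within {0..T}))"

text \<open>
  The full turn of the Euclidean angle passes through a multiple of \<open>2\<pi>\<close>, where the weighted angle
  is the same; this is the crossing of the positive \<open>x\<close>-axis. If the orbit starts on this half-axis
  then it also ends there, so the weighted angle makes exactly one full turn.
\<close>

lemma monodromic_polar_orbits:
  fixes P Q :: "real \<Rightarrow> real \<Rightarrow> real"
  assumes mono: "monodromic P Q" and pq: "0 < p" "0 < q" and "0 < \<delta>"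
  shows "\<exists>\<delta>'>0. \<forall>f r. 0 < r \<and> r < \<delta>' \<longrightarrow>
    (\<exists>T \<phi> \<rho>. polar_orbit P Q p q \<delta> T \<phi> \<rho> \<and> \<phi> 0 = f \<and> \<rho> 0 = r \<and>
      (\<exists>t\<in>{0..T}. \<exists>n::int. \<phi> t = 2 * pi * of_int n) \<and>
      (\<forall>n::int. f = 2 * pi * of_int n \<longrightarrow> \<bar>\<phi> T - f\<bar> = 2 * pi))"
proof -
  \<comment> \<open>Both coordinates of an orbit of norm less than \<open>e\<close> are so small that at \<open>\<rho> = \<delta>\<close> the sum of squares
    which defines the weighted radius is at most \<open>1 / 4 + 1 / 4\<close>; so the radius is less than \<open>\<delta>\<close>.\<close>
  define e where "e = min (\<delta> ^ p) (\<delta> ^ q) / 2"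
  have e: "0 < e" "e \<le> \<delta> ^ p / 2" "e \<le> \<delta> ^ q / 2" using \<open>0 < \<delta>\<close> by (auto simp: e_def)
  obtain d where d: "0 < d" and orbit: "\<forall>z::real \<times> real. 0 < norm z \<and> norm z < d \<longrightarrow>
        (\<exists>T \<gamma> \<theta>. 0 < T \<and> \<gamma> 0 = z \<and>
           (\<forall>t\<in>{0..T}.
              (\<gamma> has_vector_derivative
                 (P (fst (\<gamma> t)) (snd (\<gamma> t)), Q (fst (\<gamma> t)) (snd (\<gamma> t)))) (at t within {0..T}) \<and>
              0 < norm (\<gamma> t) \<and> norm (\<gamma> t) < e \<and>
              \<gamma> t = norm (\<gamma> t) *\<^sub>R (cos (\<theta> t), sin (\<theta> t))) \<and>
           continuous_on {0..T} \<theta> \<and> \<bar>\<theta> T - \<theta> 0\<bar> = 2 * pi)"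
    using mono[unfolded monodromic_def, THEN conjunct2, THEN conjunct2, THEN spec, THEN mp, OF e(1)]
    by (elim exE conjE) (rule that)
  show ?thesis
  proof (rule exI[of _ "min 1 (d / 2)"], intro conjI allI impI)
    show "0 < min 1 (d / 2)" using d by simp
    fix f r :: real assume r: "0 < r \<and> r < min 1 (d / 2)"
    define z where "z = (r ^ p * cos f, r ^ q * sin f)"
    have z0: "0 < norm z"
      using r sin_zero_abs_cos_one[of f] by (auto simp: z_def zero_prod_def)
    have "r ^ k * \<bar>c\<bar> \<le> r" if "0 < k" "\<bar>c\<bar> \<le> 1" for c and k :: nat
    proof -
      have "r ^ k * \<bar>c\<bar> \<le> r ^ 1 * 1" using that r by (intro mult_mono power_decreasing) auto
      then show ?thesis by simp
    qed
    from this[of p "cos f"] this[of q "sin f"] have "\<bar>fst z\<bar> \<le> r" "\<bar>snd z\<bar> \<le> r"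
      using pq r by (auto simp: z_def abs_mult)
    then have zd: "norm z < d"
      using norm_Pair_le[of "fst z" "snd z"] r by simp
    obtain T \<gamma> \<theta> where T: "0 < T" "\<gamma> 0 = z"
      and all: "\<forall>t\<in>{0..T}. (\<gamma> has_vector_derivative
             (P (fst (\<gamma> t)) (snd (\<gamma> t)), Q (fst (\<gamma> t)) (snd (\<gamma> t)))) (at t within {0..T}) \<and>
           0 < norm (\<gamma> t) \<and> norm (\<gamma> t) < e \<and> \<gamma> t = norm (\<gamma> t) *\<^sub>R (cos (\<theta> t), sin (\<theta> t))"
      and \<theta>: "continuous_on {0..T} \<theta>" "\<bar>\<theta> T - \<theta> 0\<bar> = 2 * pi"
      using orbit[THEN spec, THEN mp, OF conjI[OF z0 zd]] by (elim exE conjE) (rule that)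
    have \<gamma>: "(\<gamma> has_vector_derivative
             (P (fst (\<gamma> t)) (snd (\<gamma> t)), Q (fst (\<gamma> t)) (snd (\<gamma> t)))) (at t within {0..T})"
        "0 < norm (\<gamma> t)" "norm (\<gamma> t) < e" "\<gamma> t = norm (\<gamma> t) *\<^sub>R (cos (\<theta> t), sin (\<theta> t))"
      if "t \<in> {0..T}" for t
      using bspec[OF all that] by blast+
    define x y where "x t = fst (\<gamma> t)" and "y t = snd (\<gamma> t)" for t
    have xy0: "(x t, y t) \<noteq> (0, 0)" if "t \<in> {0..T}" for t
      using \<gamma>(2)[OF that] by (auto simp: x_def y_def prod_eq_iff)
    have "\<forall>t. \<exists>\<rho>. t \<in> {0..T} \<longrightarrow> 0 < \<rho> \<and> (x t / \<rho> ^ p)\<^sup>2 + (y t / \<rho> ^ q)\<^sup>2 = 1"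
      using weighted_radius_exists[OF pq xy0] by blast
    then obtain \<rho> where \<rho>: "\<And>t. t \<in> {0..T} \<Longrightarrow> 0 < \<rho> t"
       "\<And>t. t \<in> {0..T} \<Longrightarrow> (x t / \<rho> t ^ p)\<^sup>2 + (y t / \<rho> t ^ q)\<^sup>2 = 1"
      by metis
    have c\<gamma>: "continuous_on {0..T} \<gamma>"
      unfolding continuous_on_eq_continuous_within
      using has_vector_derivative_continuous[OF \<gamma>(1)] by blast
    then have cxy: "continuous_on {0..T} x" "continuous_on {0..T} y"
      unfolding x_def y_def by (auto intro: continuous_intros)
    have c\<rho>: "continuous_on {0..T} \<rho>"
      by (rule weighted_radius_continuous[OF pq cxy \<rho>])
    have small: "\<rho> t < \<delta>" if t: "t \<in> {0..T}" for t
    proof (rule ccontr)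
      assume "\<not> \<rho> t < \<delta>"
      then have "(x t / \<rho> t ^ p)\<^sup>2 + (y t / \<rho> t ^ q)\<^sup>2 \<le> (x t / \<delta> ^ p)\<^sup>2 + (y t / \<delta> ^ q)\<^sup>2"
        using weighted_radius_decreasing[OF pq \<open>0 < \<delta>\<close> _ xy0[OF t], of "\<rho> t"]
        by (cases "\<rho> t = \<delta>") auto
      moreover have "(x t / \<delta> ^ p)\<^sup>2 \<le> (1 / 2)\<^sup>2" "(y t / \<delta> ^ q)\<^sup>2 \<le> (1 / 2)\<^sup>2"
      proof -
        have "\<bar>x t\<bar> \<le> e" "\<bar>y t\<bar> \<le> e"
          using \<gamma>(3)[OF t] norm_fst_le[of "x t" "y t"] norm_snd_le[of "y t" "x t"]
          by (auto simp: x_def y_def)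
        then have "\<bar>x t / \<delta> ^ p\<bar> \<le> \<bar>1 / 2\<bar>" "\<bar>y t / \<delta> ^ q\<bar> \<le> \<bar>1 / 2\<bar>"
          using e \<open>0 < \<delta>\<close> by (auto simp: abs_divide field_simps)
        then show "(x t / \<delta> ^ p)\<^sup>2 \<le> (1 / 2)\<^sup>2" "(y t / \<delta> ^ q)\<^sup>2 \<le> (1 / 2)\<^sup>2"
          by (simp_all only: abs_le_square_iff)
      qed
      moreover have "(1 / 2 :: real)\<^sup>2 = 1 / 4" by (simp add: power2_eq_square)
      ultimately show False using \<rho>(2)[OF t] by linarith
    qed
    define \<psi> where "\<psi> t = \<theta> t + arcsin (y t / \<rho> t ^ q * cos (\<theta> t) - x t / \<rho> t ^ p * sin (\<theta> t))" for t
    have lift: "\<bar>y t / \<rho> t ^ q * cos (\<theta> t) - x t / \<rho> t ^ p * sin (\<theta> t)\<bar> \<le> 1"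
        "x t = \<rho> t ^ p * cos (\<psi> t)" "y t = \<rho> t ^ q * sin (\<psi> t)" if t: "t \<in> {0..T}" for t
    proof -
      have "fst (\<gamma> t) = norm (\<gamma> t) * cos (\<theta> t)" "snd (\<gamma> t) = norm (\<gamma> t) * sin (\<theta> t)"
        using arg_cong[OF \<gamma>(4)[OF t], of fst] arg_cong[OF \<gamma>(4)[OF t], of snd] by simp_all
      then have xy: "x t = norm (\<gamma> t) * cos (\<theta> t)" "y t = norm (\<gamma> t) * sin (\<theta> t)"
        by (simp_all add: x_def y_def)
      have pos: "0 < \<rho> t ^ p" "0 < \<rho> t ^ q" using \<rho>(1)[OF t] by auto
      note l = weighted_polar_lift[OF pos \<gamma>(2)[OF t] xy \<rho>(2)[OF t]]
      show "\<bar>y t / \<rho> t ^ q * cos (\<theta> t) - x t / \<rho> t ^ p * sin (\<theta> t)\<bar> \<le> 1" by (rule l(1))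
      show "x t = \<rho> t ^ p * cos (\<psi> t)" unfolding \<psi>_def by (rule l(2))
      show "y t = \<rho> t ^ q * sin (\<psi> t)" unfolding \<psi>_def by (rule l(3))
    qed
    have c\<psi>: "continuous_on {0..T} \<psi>"
      unfolding \<psi>_def using \<rho>(1) lift(1)
      by (intro continuous_intros \<theta> cxy c\<rho>) (fastforce simp: abs_le_iff)+
    have axis: "\<psi> t = \<theta> t" if t: "t \<in> {0..T}" "\<theta> t = 2 * pi * of_int n" for t and n :: int
    proof -
      have "sin (\<theta> t) = 0" using that by (simp add: sin_int_2pin)
      moreover have "y t = 0" using arg_cong[OF \<gamma>(4)[OF t(1)], of snd] \<open>sin (\<theta> t) = 0\<close>
        by (simp add: y_def)
      ultimately show ?thesis by (simp add: \<psi>_def)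
    qed
    have \<psi>0: "cos (\<psi> 0) = cos f" "sin (\<psi> 0) = sin f" and \<rho>0: "\<rho> 0 = r"
    proof -
      have 0: "0 \<in> {0..T}" using T by simp
      have xy: "x 0 = r ^ p * cos f" "y 0 = r ^ q * sin f" using T by (simp_all add: x_def y_def z_def)
      have "(x 0 / r ^ p)\<^sup>2 + (y 0 / r ^ q)\<^sup>2 = 1" using r xy by simp
      then show "\<rho> 0 = r"
        using weighted_radius_decreasing[OF pq _ _ xy0[OF 0]] \<rho>[OF 0] r
        by (metis less_irrefl linorder_neqE_linordered_idom)
      then show "cos (\<psi> 0) = cos f" "sin (\<psi> 0) = sin f"
        using lift(2,3)[OF 0] xy r by simp_all
    qed
    then obtain k :: int where k: "\<psi> 0 = f + 2 * pi * of_int k"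
      using sin_cos_eq_iff[of "\<psi> 0" f] by auto
    \<comment> \<open>The lift starts at the prescribed angle \<open>f\<close> only modulo \<open>2 * pi\<close>.\<close>
    define \<phi> where "\<phi> t = \<psi> t - 2 * pi * of_int k" for t
    have trig: "cos (\<phi> t) = cos (\<psi> t)" "sin (\<phi> t) = sin (\<psi> t)" for t
      using sin_cos_eq_iff[of "\<psi> t" "\<phi> t"] by (auto simp: \<phi>_def)
    have D: "((\<lambda>s. (\<rho> s ^ p * cos (\<phi> s), \<rho> s ^ q * sin (\<phi> s))) has_vector_derivative
        (P (\<rho> t ^ p * cos (\<phi> t)) (\<rho> t ^ q * sin (\<phi> t)), Q (\<rho> t ^ p * cos (\<phi> t)) (\<rho> t ^ q * sin (\<phi> t))))
        (at t within {0..T})" if t: "t \<in> {0..T}" for t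
    proof -
      have eq: "\<gamma> s = (\<rho> s ^ p * cos (\<phi> s), \<rho> s ^ q * sin (\<phi> s))" if "s \<in> {0..T}" for s
        using lift(2,3)[OF that] by (simp add: trig x_def y_def prod_eq_iff)
      from has_vector_derivative_transform[OF t _ \<gamma>(1)[OF t]] eq
      show ?thesis unfolding eq[OF t] by simp
    qed
    show "\<exists>T \<phi> \<rho>. polar_orbit P Q p q \<delta> T \<phi> \<rho> \<and> \<phi> 0 = f \<and> \<rho> 0 = r \<and>
      (\<exists>t\<in>{0..T}. \<exists>n::int. \<phi> t = 2 * pi * of_int n) \<and>
      (\<forall>n::int. f = 2 * pi * of_int n \<longrightarrow> \<bar>\<phi> T - f\<bar> = 2 * pi)"
      unfolding polar_orbit_def
    proof (rule exI[of _ T], rule exI[of _ \<phi>], rule exI[of _ \<rho>], intro conjI ballI allI impI)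
      show "0 < T" "\<rho> 0 = r" by fact+
      show "\<phi> 0 = f" by (simp add: \<phi>_def k)
      fix t assume t: "t \<in> {0..T}"
      show "0 < \<rho> t" "\<rho> t < \<delta>" using \<rho>(1) small t by auto
      have "continuous (at t within {0..T}) \<phi>" "continuous (at t within {0..T}) \<rho>"
        using t c\<psi> c\<rho> unfolding \<phi>_def continuous_on_eq_continuous_within by (auto intro: continuous_intros)
      from polar_curve_has_derivative[where \<phi> = \<phi> and \<rho> = \<rho> and t = t and S = "{0..T}"
          and P = P and Q = Q, OF pq \<rho>(1)[OF t] this D[OF t]]
      show "(\<phi> has_real_derivative angular_numerator P Q p q (\<phi> t) (\<rho> t) / polar_jacobian p q (\<phi> t) (\<rho> t))
          (at t within {0..T})"
        "(\<rho> has_real_derivative radial_numerator P Q p q (\<phi> t) (\<rho> t) / polar_jacobian p q (\<phi> t) (\<rho> t))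
          (at t within {0..T})" .
    next
      obtain t and n :: int where "t \<in> {0..T}" "\<theta> t = 2 * pi * of_int n"
        using continuous_attains_multiple_of_2pi[of T \<theta>] T \<theta> by auto
      then have "\<phi> t = 2 * pi * of_int (n - k)" using axis by (simp add: \<phi>_def algebra_simps)
      then show "\<exists>t\<in>{0..T}. \<exists>n::int. \<phi> t = 2 * pi * of_int n" using \<open>t \<in> {0..T}\<close> by blast
    next
      fix n :: int assume n: "f = 2 * pi * of_int n"
      have 0: "0 \<in> {0..T}" and TT: "T \<in> {0..T}" using T by simp_all
      have cf: "cos f = 1" "sin f = 0" by (simp_all add: n sin_int_2pin cos_int_2pin)
      then have "y 0 = 0" "0 < x 0" using lift(2,3)[OF 0] \<psi>0 \<rho>(1)[OF 0] by simp_all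
      then have "sin (\<theta> 0) = 0" "0 < norm (\<gamma> 0) * cos (\<theta> 0)"
        using arg_cong[OF \<gamma>(4)[OF 0], of snd] arg_cong[OF \<gamma>(4)[OF 0], of fst] \<gamma>(2)[OF 0] by (simp_all add: x_def y_def)
      then have "sin (\<theta> 0) = sin 0" "cos (\<theta> 0) = cos 0"
        using \<gamma>(2)[OF 0] sin_zero_abs_cos_one[of "\<theta> 0"] by (auto simp: zero_less_mult_iff)
      then obtain l :: int where l: "\<theta> 0 = 2 * pi * of_int l"
        using sin_cos_eq_iff[of "\<theta> 0" 0] by auto
      have "\<theta> T = 2 * pi * of_int (l + 1) \<or> \<theta> T = 2 * pi * of_int (l - 1)"
        using \<theta>(2) l by (auto simp: abs_if algebra_simps split: if_splits)
      then have "\<psi> T = \<theta> T" using axis[OF TT] by blast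
      moreover have "\<psi> 0 = \<theta> 0" using axis[OF 0 l] .
      ultimately show "\<bar>\<phi> T - f\<bar> = 2 * pi" using \<theta>(2) k by (simp add: \<phi>_def)
    qed
  qed
qed

section \<open>Inverse integrating factors on a strip\<close>

locale inverse_integrating_factor_on_strip =
  fixes F V :: "real \<Rightarrow> real \<Rightarrow> real" and F1 V1 V2 :: "real \<times> real \<Rightarrow> real" and \<delta> :: real
  assumes F_cont: "continuous_on (UNIV \<times> {0<..<\<delta>}) (\<lambda>(\<phi>, \<rho>). F \<phi> \<rho>)"
    and F1_cont: "continuous_on (UNIV \<times> {0<..<\<delta>}) F1"
    and F_deriv: "0 < \<rho> \<Longrightarrow> \<rho> < \<delta> \<Longrightarrow> (F \<phi> has_real_derivative F1 (\<phi>, \<rho>)) (at \<rho>)"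
    and V1_cont: "continuous_on (UNIV \<times> {0<..<\<delta>}) V1"
    and V2_cont: "continuous_on (UNIV \<times> {0<..<\<delta>}) V2"
    and V_deriv: "0 < \<rho> \<Longrightarrow> \<rho> < \<delta> \<Longrightarrow>
      ((\<lambda>(\<phi>, \<rho>). V \<phi> \<rho>) has_derivative (\<lambda>(a, b). a * V1 (\<phi>, \<rho>) + b * V2 (\<phi>, \<rho>))) (at (\<phi>, \<rho>))"
    and V_periodic: "0 < \<rho> \<Longrightarrow> \<rho> < \<delta> \<Longrightarrow> V (\<phi> + 2 * pi) \<rho> = V \<phi> \<rho>"
    and V_eq: "0 < \<rho> \<Longrightarrow> \<rho> < \<delta> \<Longrightarrow> V1 (\<phi>, \<rho>) + V2 (\<phi>, \<rho>) * F \<phi> \<rho> = F1 (\<phi>, \<rho>) * V \<phi> \<rho>"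
begin

lemma V_cont: "continuous_on (UNIV \<times> {0<..<\<delta>}) (\<lambda>(\<phi>, \<rho>). V \<phi> \<rho>)"
  using V_deriv by (intro continuous_at_imp_continuous_on) (auto intro!: has_derivative_continuous)

text \<open>
  Along a solution the chain rule and the equation for \<open>V\<close> give the linear equation
  \<open>(V \<circ> (\<phi>, \<rho>))' = F\<^sub>\<rho> \<phi>' V\<close>. So the set of zeros of \<open>V\<close> is a union of orbits.
\<close>

lemma zero_along_solution:
  fixes \<phi> \<rho> a :: "real \<Rightarrow> real"
  assumes \<rho>: "\<And>t. t \<in> {0..T} \<Longrightarrow> 0 < \<rho> t \<and> \<rho> t < \<delta>"
    and d\<phi>: "\<And>t. t \<in> {0..T} \<Longrightarrow> (\<phi> has_real_derivative a t) (at t within {0..T})"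
    and d\<rho>: "\<And>t. t \<in> {0..T} \<Longrightarrow> (\<rho> has_real_derivative F (\<phi> t) (\<rho> t) * a t) (at t within {0..T})"
    and a: "continuous_on {0..T} a"
    and st: "s \<in> {0..T}" "t \<in> {0..T}" "V (\<phi> s) (\<rho> s) = 0"
  shows "V (\<phi> t) (\<rho> t) = 0"
proof (rule linear_ode_zero[of T "\<lambda>t. V (\<phi> t) (\<rho> t)" "\<lambda>t. F1 (\<phi> t, \<rho> t) * a t" s t])
  fix t assume t: "t \<in> {0..T}"
  have "((\<lambda>t. (\<phi> t, \<rho> t)) has_derivative (\<lambda>h. (a t * h, F (\<phi> t) (\<rho> t) * a t * h))) (at t within {0..T})"
    using d\<phi>[OF t] d\<rho>[OF t] unfolding has_field_derivative_def by (intro has_derivative_Pair)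
  from has_derivative_compose[OF this V_deriv] \<rho>[OF t]
  have "((\<lambda>t. V (\<phi> t) (\<rho> t)) has_derivative
      (\<lambda>h. a t * h * V1 (\<phi> t, \<rho> t) + F (\<phi> t) (\<rho> t) * a t * h * V2 (\<phi> t, \<rho> t))) (at t within {0..T})"
    by simp
  then show "((\<lambda>t. V (\<phi> t) (\<rho> t)) has_real_derivative F1 (\<phi> t, \<rho> t) * a t * V (\<phi> t) (\<rho> t)) (at t within {0..T})"
    unfolding has_field_derivative_def
  proof (rule has_derivative_eq_rhs, intro ext)
    fix h
    have "a t * h * V1 (\<phi> t, \<rho> t) + F (\<phi> t) (\<rho> t) * a t * h * V2 (\<phi> t, \<rho> t)
      = a t * h * (V1 (\<phi> t, \<rho> t) + V2 (\<phi> t, \<rho> t) * F (\<phi> t) (\<rho> t))" by (simp add: algebra_simps)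
    also have "\<dots> = F1 (\<phi> t, \<rho> t) * a t * V (\<phi> t) (\<rho> t) * h"
      using V_eq[of "\<rho> t" "\<phi> t"] \<rho>[OF t] by simp
    finally show "a t * h * V1 (\<phi> t, \<rho> t) + F (\<phi> t) (\<rho> t) * a t * h * V2 (\<phi> t, \<rho> t)
      = F1 (\<phi> t, \<rho> t) * a t * V (\<phi> t) (\<rho> t) * h" .
  qed
next
  have "continuous_on {0..T} \<phi>" "continuous_on {0..T} \<rho>"
    by (rule DERIV_continuous_on, erule d\<phi>) (rule DERIV_continuous_on, erule d\<rho>)
  then have "continuous_on {0..T} (\<lambda>t. F1 (\<phi> t, \<rho> t))"
    using \<rho> by (intro continuous_on_compose2[OF F1_cont] continuous_intros) auto
  then show "continuous_on {0..T} (\<lambda>t. F1 (\<phi> t, \<rho> t) * a t)"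
    by (intro continuous_intros a)
qed (use st in auto)

end

locale nonvanishing_inverse_integrating_factor = inverse_integrating_factor_on_strip +
  assumes V_nonzero: "0 < \<rho> \<Longrightarrow> \<rho> < \<delta> \<Longrightarrow> V \<phi> \<rho> \<noteq> 0"
begin

text \<open>
  Closedness of \<open>(F d\<phi> - d\<rho>) / V\<close>: the equation for \<open>V\<close> turns the numerator \<open>F\<^sub>\<rho> V - F V\<^sub>\<rho>\<close> of the
  first derivative into \<open>V\<^sub>\<phi>\<close>.
\<close>

lemma closed_form:
  assumes "0 < \<rho>" "\<rho> < \<delta>"
  shows "((\<lambda>s. F \<phi> s / V \<phi> s) has_real_derivative V1 (\<phi>, \<rho>) / (V \<phi> \<rho>)\<^sup>2) (at \<rho>)"
    and "((\<lambda>s. - 1 / V s \<rho>) has_real_derivative V1 (\<phi>, \<rho>) / (V \<phi> \<rho>)\<^sup>2) (at \<phi>)"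
proof -
  have "((\<lambda>s. (\<phi>, s)) has_derivative (\<lambda>h. (0, h))) (at \<rho>)"
    "((\<lambda>s. (s, \<rho>)) has_derivative (\<lambda>h. (h, 0))) (at \<phi>)"
    by (auto intro!: derivative_eq_intros)
  from has_derivative_compose[OF this(1) V_deriv[OF assms]] has_derivative_compose[OF this(2) V_deriv[OF assms]]
  have dV: "(V \<phi> has_real_derivative V2 (\<phi>, \<rho>)) (at \<rho>)" "((\<lambda>s. V s \<rho>) has_real_derivative V1 (\<phi>, \<rho>)) (at \<phi>)"
    by (simp_all add: has_field_derivative_def mult_commute_abs)
  have "(F1 (\<phi>, \<rho>) * V \<phi> \<rho> - F \<phi> \<rho> * V2 (\<phi>, \<rho>)) / (V \<phi> \<rho> * V \<phi> \<rho>) = V1 (\<phi>, \<rho>) / (V \<phi> \<rho>)\<^sup>2"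
    using V_eq[OF assms, of \<phi>] by (simp add: power2_eq_square algebra_simps)
  then show "((\<lambda>s. F \<phi> s / V \<phi> s) has_real_derivative V1 (\<phi>, \<rho>) / (V \<phi> \<rho>)\<^sup>2) (at \<rho>)"
    using DERIV_divide[OF F_deriv[OF assms, of \<phi>] dV(1) V_nonzero[OF assms]] by simp
  show "((\<lambda>s. - 1 / V s \<rho>) has_real_derivative V1 (\<phi>, \<rho>) / (V \<phi> \<rho>)\<^sup>2) (at \<phi>)"
    by (rule derivative_eq_intros dV(2) refl | simp add: V_nonzero[OF assms] power2_eq_square)+
qed

lemma closed_form_cont:
  "continuous_on (UNIV \<times> {0<..<\<delta>}) (\<lambda>(\<phi>, \<rho>). F \<phi> \<rho> / V \<phi> \<rho>)"
  "continuous_on (UNIV \<times> {0<..<\<delta>}) (\<lambda>(\<phi>, \<rho>). - 1 / V \<phi> \<rho>)"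
  "continuous_on (UNIV \<times> {0<..<\<delta>}) (\<lambda>(\<phi>, \<rho>). V1 (\<phi>, \<rho>) / (V \<phi> \<rho>)\<^sup>2)"
  using F_cont V1_cont V_cont V_nonzero unfolding case_prod_unfold
  by (auto intro!: continuous_intros)

lemma integral_constant:
  "\<exists>g. \<forall>r. 0 < r \<and> r < \<delta> \<longrightarrow> ((\<lambda>\<phi>. F \<phi> r / V \<phi> r) has_integral g) {0..2 * pi}"
proof -
  have "\<exists>g. \<forall>r\<in>{0<..<\<delta>}. ((\<lambda>\<phi>. F \<phi> r / V \<phi> r) has_integral g) {0..2 * pi}"
  proof (rule integral_closed_form_constant)
    fix \<phi> \<rho> :: real assume "\<phi> \<in> {0..2 * pi}" and \<rho>: "\<rho> \<in> {0<..<\<delta>}"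
    show "((\<lambda>s. F \<phi> s / V \<phi> s) has_real_derivative V1 (\<phi>, \<rho>) / (V \<phi> \<rho>)\<^sup>2) (at \<rho> within {0<..<\<delta>})"
      "((\<lambda>s. - 1 / V s \<rho>) has_real_derivative V1 (\<phi>, \<rho>) / (V \<phi> \<rho>)\<^sup>2) (at \<phi> within {0..2 * pi})"
      using closed_form[of \<rho> \<phi>] \<rho> by (auto intro: has_field_derivative_at_within)
  next
    fix \<rho> assume \<rho>: "\<rho> \<in> {0<..<\<delta>}"
    have "continuous_on {0..2 * pi} ((\<lambda>(\<phi>, \<rho>). F \<phi> \<rho> / V \<phi> \<rho>) \<circ> (\<lambda>s. (s, \<rho>)))"
      using \<rho> by (intro continuous_on_compose continuous_intros continuous_on_subset[OF closed_form_cont(1)]) auto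
    then show "continuous_on {0..2 * pi} (\<lambda>\<phi>. F \<phi> \<rho> / V \<phi> \<rho>)" by (simp add: o_def)
    show "- 1 / V (2 * pi) \<rho> = - 1 / V 0 \<rho>" using V_periodic[of \<rho> 0] \<rho> by simp
  next
    show "continuous_on ({0..2 * pi} \<times> {0<..<\<delta>}) (\<lambda>(\<phi>, \<rho>). V1 (\<phi>, \<rho>) / (V \<phi> \<rho>)\<^sup>2)"
      by (rule continuous_on_subset[OF closed_form_cont(3)]) auto
  qed auto
  then show ?thesis unfolding Ball_def greaterThanLessThan_iff .
qed

text \<open>
  The formula gives a potential only for \<open>\<rho> \<ge> a\<close>, because the integral over \<open>{a..\<rho>}\<close> is \<open>0\<close> for
  smaller radii. As the radii of interest tend to \<open>0\<close>, each argument below chooses an \<open>a\<close> under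
  the curves that it compares.
\<close>

definition potential :: "real \<Rightarrow> real \<Rightarrow> real \<Rightarrow> real" where
  "potential a \<phi> \<rho> = integral {a..\<rho>} (\<lambda>s. - 1 / V \<phi> s) + integral {0..\<phi>} (\<lambda>s. F s a / V s a)"

lemma potential_derivative:
  assumes "0 < a" "b < \<delta>" "\<phi> \<in> {0..2 * pi}" "\<rho> \<in> {a..b}"
  shows "((\<lambda>(\<phi>, \<rho>). potential a \<phi> \<rho>) has_derivative (\<lambda>(u, w). u * (F \<phi> \<rho> / V \<phi> \<rho>) + w * (- 1 / V \<phi> \<rho>)))
    (at (\<phi>, \<rho>) within {0..2 * pi} \<times> {a..b})"
  unfolding potential_def
proof (rule closed_form_potential)
  show "(\<phi>, \<rho>) \<in> {0..2 * pi} \<times> {a..b}" using assms by simp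
  fix \<phi> \<rho> assume "(\<phi>, \<rho>) \<in> {0..2 * pi} \<times> {a..b}"
  then have \<rho>: "0 < \<rho>" "\<rho> < \<delta>" using assms by auto
  from closed_form[OF this, of \<phi>]
  show "((\<lambda>s. F \<phi> s / V \<phi> s) has_real_derivative V1 (\<phi>, \<rho>) / (V \<phi> \<rho>)\<^sup>2) (at \<rho> within {a..b})"
    "((\<lambda>s. - 1 / V s \<rho>) has_real_derivative V1 (\<phi>, \<rho>) / (V \<phi> \<rho>)\<^sup>2) (at \<phi> within {0..2 * pi})"
    by (auto intro: has_field_derivative_at_within)
qed (rule continuous_on_subset[OF closed_form_cont(1)] continuous_on_subset[OF closed_form_cont(2)]
      continuous_on_subset[OF closed_form_cont(3)]; use assms in auto)+

lemma potential_along_solution: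
  fixes \<phi> \<rho> w :: "real \<Rightarrow> real"
  assumes ab: "0 < a" "b < \<delta>"
    and \<rho>: "\<And>t. t \<in> {l..u} \<Longrightarrow> \<phi> t \<in> {0..2 * pi} \<and> \<rho> t \<in> {a..b}"
    and d\<phi>: "\<And>t. t \<in> {l..u} \<Longrightarrow> (\<phi> has_real_derivative w t) (at t within {l..u})"
    and d\<rho>: "\<And>t. t \<in> {l..u} \<Longrightarrow> (\<rho> has_real_derivative F (\<phi> t) (\<rho> t) * w t) (at t within {l..u})"
    and st: "s \<in> {l..u}" "t \<in> {l..u}"
  shows "potential a (\<phi> s) (\<rho> s) = potential a (\<phi> t) (\<rho> t)"
proof -
  have "((\<lambda>t. potential a (\<phi> t) (\<rho> t)) has_real_derivative 0) (at t within {l..u})" if t: "t \<in> {l..u}" for t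
  proof -
    have 1: "((\<lambda>t. (\<phi> t, \<rho> t)) has_derivative (\<lambda>h. (w t * h, F (\<phi> t) (\<rho> t) * w t * h))) (at t within {l..u})"
      using d\<phi>[OF t] d\<rho>[OF t] unfolding has_field_derivative_def by (intro has_derivative_Pair)
    have 2: "((\<lambda>(\<phi>, \<rho>). potential a \<phi> \<rho>) has_derivative
        (\<lambda>(x, y). x * (F (\<phi> t) (\<rho> t) / V (\<phi> t) (\<rho> t)) + y * (- 1 / V (\<phi> t) (\<rho> t))))
        (at (\<phi> t, \<rho> t) within {0..2 * pi} \<times> {a..b})"
      using potential_derivative[OF ab] \<rho>[OF t] by blast
    have img: "(\<lambda>t. (\<phi> t, \<rho> t)) ` {l..u} \<subseteq> {0..2 * pi} \<times> {a..b}" using \<rho> by blast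
    have "((\<lambda>t. potential a (\<phi> t) (\<rho> t)) has_derivative (\<lambda>h. 0)) (at t within {l..u})"
      using has_derivative_in_compose[OF 1 has_derivative_subset[OF 2 img]] by simp
    then show ?thesis
      unfolding has_field_derivative_def by (rule has_derivative_eq_rhs) auto
  qed
  then obtain k where "\<And>t. t \<in> {l..u} \<Longrightarrow> potential a (\<phi> t) (\<rho> t) = k"
    using has_field_derivative_zero_constant[of "{l..u}" "\<lambda>t. potential a (\<phi> t) (\<rho> t)"] by auto
  then show ?thesis using st by simp
qed

lemma potential_inj:
  assumes ab: "0 < a" "b < \<delta>" and \<phi>: "\<phi> \<in> {0..2 * pi}"
    and xy: "x \<in> {a..b}" "y \<in> {a..b}" and eq: "potential a \<phi> x = potential a \<phi> y"
  shows "x = y"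
proof -
  have cont: "continuous_on {a..b} (\<lambda>s. - 1 / V \<phi> s)"
  proof -
    have "continuous_on {a..b} ((\<lambda>(\<phi>, \<rho>). - 1 / V \<phi> \<rho>) \<circ> (\<lambda>s. (\<phi>, s)))"
      using ab by (intro continuous_on_compose continuous_intros continuous_on_subset[OF closed_form_cont(2)]) auto
    then show ?thesis by (simp add: o_def)
  qed
  have d: "(potential a \<phi> has_real_derivative - 1 / V \<phi> s) (at s within {a..b})" if "s \<in> {a..b}" for s
    unfolding potential_def
    using DERIV_add[OF integral_has_real_derivative[OF cont that] DERIV_const] by (simp del: integral_neg)
  have "False" if "u \<in> {a..b}" "v \<in> {a..b}" "u < v" "potential a \<phi> u = potential a \<phi> v" for u v
  proof -
    have "\<exists>s\<in>{u<..<v}. potential a \<phi> v - potential a \<phi> u = (- 1 / V \<phi> s) * (v - u)"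
    proof (rule mvt_simple[OF \<open>u < v\<close>, where f' = "\<lambda>s h. (- 1 / V \<phi> s) * h"])
      fix s assume "u \<le> s" "s \<le> v"
      then show "(potential a \<phi> has_derivative (*) (- 1 / V \<phi> s)) (at s within {u..v})"
        using DERIV_subset[OF d, of s "{u..v}"] that by (simp add: has_field_derivative_def)
    qed
    then show False using that V_nonzero ab by auto
  qed
  then show ?thesis using xy eq by (metis linorder_neqE_linordered_idom)
qed

text \<open>
  The solution \<open>y\<close> is only known to be positive, and the comparison curve \<open>(\<phi>, \<rho>)\<close> covers all angles,
  starts on the graph of \<open>y\<close> at \<open>0\<close> or \<open>2\<pi>\<close> and stays below a height \<open>b < \<delta>\<close>. If \<open>y\<close> reached \<open>b\<close>,
  then up to the first such angle (seen from the common point) both curves would lie on the same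
  level of the potential. At that angle the injectivity of the potential forces the comparison
  curve to be at height \<open>b\<close> too.
\<close>

lemma solution_confined:
  fixes y \<phi> \<rho> w :: "real \<Rightarrow> real"
  assumes y: "\<And>s. s \<in> {0..2 * pi} \<Longrightarrow> 0 < y s"
      "\<And>s. s \<in> {0..2 * pi} \<Longrightarrow> (y has_real_derivative F s (y s)) (at s within {0..2 * pi})"
    and "0 \<le> T"
    and \<phi>: "\<phi> ` {0..T} = {0..2 * pi}"
    and \<rho>: "\<And>t. t \<in> {0..T} \<Longrightarrow> 0 < \<rho> t \<and> \<rho> t < \<delta>"
    and d\<phi>: "\<And>t. t \<in> {0..T} \<Longrightarrow> (\<phi> has_real_derivative w t) (at t within {0..T})"
    and d\<rho>: "\<And>t. t \<in> {0..T} \<Longrightarrow> (\<rho> has_real_derivative F (\<phi> t) (\<rho> t) * w t) (at t within {0..T})"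
    and start: "\<phi> 0 = 0 \<or> \<phi> 0 = 2 * pi" "\<rho> 0 = y (\<phi> 0)"
    and s: "s \<in> {0..2 * pi}"
  shows "y s < \<delta>"
proof (rule ccontr)
  assume "\<not> y s < \<delta>"
  have cont: "continuous_on {0..2 * pi} y" "continuous_on {0..T} \<rho>"
    by (rule DERIV_continuous_on, erule y(2)) (rule DERIV_continuous_on, erule d\<rho>)
  have 0: "0 \<in> {0..T}" using \<open>0 \<le> T\<close> by simp
  obtain t1 where t1: "t1 \<in> {0..T}" "\<And>t. t \<in> {0..T} \<Longrightarrow> \<rho> t \<le> \<rho> t1"
    using continuous_attains_sup[OF compact_Icc _ cont(2)] 0 by blast
  obtain t2 where t2: "t2 \<in> {0..T}" "\<And>t. t \<in> {0..T} \<Longrightarrow> \<rho> t2 \<le> \<rho> t"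
    using continuous_attains_inf[OF compact_Icc _ cont(2)] 0 by blast
  obtain s2 where s2: "s2 \<in> {0..2 * pi}" "\<And>s. s \<in> {0..2 * pi} \<Longrightarrow> y s2 \<le> y s"
    using continuous_attains_inf[OF compact_Icc _ cont(1)] s by blast
  define a where "a = min (\<rho> t2) (y s2)"
  define b where "b = (\<rho> t1 + \<delta>) / 2"
  have ab: "0 < a" "\<rho> t1 < b" "b < \<delta>"
    using \<rho>[OF t1(1)] \<rho>[OF t2(1)] y(1)[OF s2(1)] by (auto simp: a_def b_def)
  have below: "\<rho> t \<in> {a..b}" if "t \<in> {0..T}" for t
    using t1(2)[OF that] t2(2)[OF that] ab by (auto simp: a_def)
  have ay: "a \<le> y s" if "s \<in> {0..2 * pi}" for s
    using s2(2)[OF that] by (simp add: a_def)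
  have level: "potential a (\<phi> t) (\<rho> t) = potential a (\<phi> 0) (y (\<phi> 0))" if "t \<in> {0..T}" for t
    unfolding start(2)[symmetric]
  proof (rule potential_along_solution[OF ab(1,3) _ d\<phi> d\<rho> that 0])
    fix t assume t: "t \<in> {0..T}"
    then have "\<phi> t \<in> {0..2 * pi}" unfolding \<phi>[symmetric] by (rule imageI)
    then show "\<phi> t \<in> {0..2 * pi} \<and> \<rho> t \<in> {a..b}" using below[OF t] by (rule conjI)
  qed
  have hit: False if "u \<in> {0..2 * pi}" "y u = b" "potential a u (y u) = potential a (\<phi> 0) (y (\<phi> 0))" for u
  proof -
    have "u \<in> \<phi> ` {0..T}" unfolding \<phi> by (rule that(1))
    then obtain t where t: "t \<in> {0..T}" "\<phi> t = u" by blast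
    have "potential a u (\<rho> t) = potential a u b"
      using level[OF t(1)] that(3) unfolding t(2) that(2) by (rule trans[OF _ sym])
    moreover have "b \<in> {a..b}" using below[OF t(1)] by simp
    ultimately have "\<rho> t = b"
      using potential_inj[OF ab(1,3) that(1) below[OF t(1)]] by blast
    then show False using t1(2)[OF t(1)] ab by simp
  qed
  have const: "potential a u (y u) = potential a v (y v)"
    if "u \<in> {0..2 * pi}" "v \<in> {0..2 * pi}" "u \<le> v" "\<And>x. x \<in> {u..v} \<Longrightarrow> y x \<le> b" for u v
  proof (rule potential_along_solution[OF ab(1,3), of u v "\<lambda>s. s" y "\<lambda>_. 1"])
    fix x assume x: "x \<in> {u..v}"
    then show "x \<in> {0..2 * pi} \<and> y x \<in> {a..b}" using that ay[of x] by auto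
    show "((\<lambda>s. s) has_real_derivative 1) (at x within {u..v})" by (rule DERIV_ident)
    show "(y has_real_derivative F x (y x) * 1) (at x within {u..v})"
      using DERIV_subset[OF y(2), of x "{u..v}"] x that by auto
  qed (use that in auto)
  define S where "S = {x \<in> {0..2 * pi}. b \<le> y x}"
  have S: "compact S" "S \<noteq> {}"
  proof -
    have "closed S" unfolding S_def using continuous_on_closed_Collect_le[OF continuous_on_const cont(1)] by simp
    moreover have "bounded S" unfolding S_def by (rule bounded_subset[OF bounded_closed_interval]) auto
    ultimately show "compact S" by (simp add: compact_eq_bounded_closed)
    show "S \<noteq> {}" using s \<open>\<not> y s < \<delta>\<close> ab by (auto simp: S_def)
  qed
  have y0: "y (\<phi> 0) < b" using t1(2)[OF 0] ab start by simp
  from start(1) show False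
  proof
    assume p0: "\<phi> 0 = 0"
    obtain v where v: "v \<in> S" "\<And>x. x \<in> S \<Longrightarrow> v \<le> x" using compact_attains_inf[OF S] by blast
    have "continuous_on {0..v} y" using continuous_on_subset[OF cont(1), of "{0..v}"] v(1) by (auto simp: S_def)
    then obtain x where x: "0 \<le> x" "x \<le> v" "y x = b"
      using IVT'[of y 0 b v] y0 p0 v(1) by (auto simp: S_def)
    have "x \<in> S" using x v(1) by (auto simp: S_def)
    then have "x = v" using v(2)[of x] x by simp
    have "y x' \<le> b" if "x' \<in> {0..v}" for x'
      using v(2)[of x'] v(1) that x \<open>x = v\<close> by (cases "x' = v") (force simp: S_def)+
    then have "potential a 0 (y 0) = potential a v (y v)"
      using const[of 0 v] v(1) by (auto simp: S_def)
    then show False using hit[of v] v(1) x \<open>x = v\<close> p0 by (auto simp: S_def)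
  next
    assume p0: "\<phi> 0 = 2 * pi"
    obtain v where v: "v \<in> S" "\<And>x. x \<in> S \<Longrightarrow> x \<le> v" using compact_attains_sup[OF S] by blast
    have "continuous_on {v..2 * pi} y" using continuous_on_subset[OF cont(1), of "{v..2 * pi}"] v(1) by (auto simp: S_def)
    then obtain x where x: "v \<le> x" "x \<le> 2 * pi" "y x = b"
      using IVT2'[of y "2 * pi" b v] y0 p0 v(1) by (auto simp: S_def)
    have "x \<in> S" using x v(1) by (auto simp: S_def)
    then have "x = v" using v(2)[of x] x by simp
    have "y x' \<le> b" if "x' \<in> {v..2 * pi}" for x'
      using v(2)[of x'] v(1) that x \<open>x = v\<close> by (cases "x' = v") (force simp: S_def)+
    then have "potential a v (y v) = potential a (2 * pi) (y (2 * pi))"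
      using const[of v "2 * pi"] v(1) by (auto simp: S_def)
    then show False using hit[of v] v(1) x \<open>x = v\<close> p0 by (auto simp: S_def)
  qed
qed

text \<open>
  The potential has equal values at \<open>(0, y 0)\<close> and \<open>(2\<pi>, y (2\<pi>))\<close>. Since \<open>V\<close> is periodic, these are
  \<open>- K (y 0)\<close> and \<open>- K (y (2\<pi>)) + g\<close> for the same primitive \<open>K\<close> of \<open>1 / V(0, \<rho>)\<close>.
\<close>

lemma transit_identity:
  fixes y :: "real \<Rightarrow> real"
  assumes y: "\<And>s. s \<in> {0..2 * pi} \<Longrightarrow> 0 < y s \<and> y s < \<delta>"
      "\<And>s. s \<in> {0..2 * pi} \<Longrightarrow> (y has_real_derivative F s (y s)) (at s within {0..2 * pi})"
    and g: "\<And>r. 0 < r \<Longrightarrow> r < \<delta> \<Longrightarrow> ((\<lambda>\<phi>. F \<phi> r / V \<phi> r) has_integral g) {0..2 * pi}"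
  shows "\<exists>K. K (y (2 * pi)) - K (y 0) = g \<and>
    (\<forall>s. min (y 0) (y (2 * pi)) \<le> s \<and> s \<le> max (y 0) (y (2 * pi)) \<longrightarrow>
       V 0 s \<noteq> 0 \<and> (K has_real_derivative 1 / V 0 s) (at s))"
proof -
  have cont: "continuous_on {0..2 * pi} y"
    by (rule DERIV_continuous_on, erule y(2))
  have pts: "0 \<in> {0..2 * pi}" "2 * pi \<in> {0..2 * pi}" by auto
  obtain s1 where s1: "s1 \<in> {0..2 * pi}" "\<And>s. s \<in> {0..2 * pi} \<Longrightarrow> y s \<le> y s1"
    using continuous_attains_sup[OF compact_Icc _ cont] pts by blast
  obtain s2 where s2: "s2 \<in> {0..2 * pi}" "\<And>s. s \<in> {0..2 * pi} \<Longrightarrow> y s2 \<le> y s"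
    using continuous_attains_inf[OF compact_Icc _ cont] pts by blast
  define a b where "a = y s2 / 2" and "b = (y s1 + \<delta>) / 2"
  have ab: "0 < a" "b < \<delta>" and in_ab: "\<And>s. s \<in> {0..2 * pi} \<Longrightarrow> a < y s \<and> y s < b"
    using y(1)[OF s1(1)] y(1)[OF s2(1)] s1(2) s2(2) by (force simp: a_def b_def)+
  \<comment> \<open>Since \<open>a\<close> and \<open>b\<close> are strictly outside the range of \<open>y\<close>, the derivative of \<open>K\<close> is two-sided on that range.\<close>
  define K where "K x = integral {a..x} (\<lambda>s. 1 / V 0 s)" for x
  have "potential a 0 (y 0) = potential a (2 * pi) (y (2 * pi))"
  proof (rule potential_along_solution[OF ab, of 0 "2 * pi" "\<lambda>s. s" y "\<lambda>_. 1"])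
    fix x :: real assume x: "x \<in> {0..2 * pi}"
    then show "x \<in> {0..2 * pi} \<and> y x \<in> {a..b}" using in_ab[OF x] by auto
    show "((\<lambda>s. s) has_real_derivative 1) (at x within {0..2 * pi})" by (rule DERIV_ident)
    show "(y has_real_derivative F x (y x) * 1) (at x within {0..2 * pi})" using y(2)[OF x] by simp
  qed auto
  moreover have "potential a 0 (y 0) = - K (y 0)"
    by (simp add: potential_def K_def flip: integral_neg)
  moreover have "potential a (2 * pi) (y (2 * pi)) = - K (y (2 * pi)) + g"
  proof -
    have "integral {a..y (2 * pi)} (\<lambda>s. - 1 / V (2 * pi) s) = integral {a..y (2 * pi)} (\<lambda>s. - (1 / V 0 s))"
      using V_periodic[of _ 0] ab in_ab[OF pts(2)] by (intro integral_cong) auto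
    moreover have "integral {0..2 * pi} (\<lambda>s. F s a / V s a) = g"
      using g[of a] ab in_ab[OF pts(1)] by (intro integral_unique) auto
    ultimately show ?thesis by (simp add: potential_def K_def)
  qed
  ultimately have "K (y (2 * pi)) - K (y 0) = g" by simp
  moreover have "V 0 s \<noteq> 0 \<and> (K has_real_derivative 1 / V 0 s) (at s)"
    if "min (y 0) (y (2 * pi)) \<le> s" "s \<le> max (y 0) (y (2 * pi))" for s
  proof
    have s: "a < s" "s < b" using that in_ab[OF pts(1)] in_ab[OF pts(2)] by auto
    then show "V 0 s \<noteq> 0" using V_nonzero ab by simp
    have "continuous_on {a..b} ((\<lambda>(\<phi>, \<rho>). V \<phi> \<rho>) \<circ> (\<lambda>s. (0, s)))"
      using ab by (intro continuous_on_compose continuous_intros continuous_on_subset[OF V_cont]) auto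
    then have "continuous_on {a..b} (\<lambda>s. 1 / V 0 s)"
      using V_nonzero ab by (intro continuous_intros) (auto simp: o_def)
    from integral_has_real_derivative[OF this, of s] s
    have "(K has_real_derivative 1 / V 0 s) (at s within {a..b})" by (simp add: K_def[abs_def])
    then show "(K has_real_derivative 1 / V 0 s) (at s)"
      using at_within_Icc_at[OF s] by simp
  qed
  ultimately show ?thesis by blast
qed

end

section \<open>Inverse integrating factors of monodromic vector fields\<close>

locale monodromic_strip =
  inverse_integrating_factor_on_strip "polar_F P Q p q" V F1 V1 V2 \<delta>
  for P Q :: "real \<Rightarrow> real \<Rightarrow> real" and p q :: nat and V :: "real \<Rightarrow> real \<Rightarrow> real"
    and F1 V1 V2 :: "real \<times> real \<Rightarrow> real" and \<delta> :: real +
  assumes p_pos: "0 < p" and q_pos: "0 < q"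
    and monodromic: "monodromic P Q"
    and angular_cont: "continuous_on (UNIV \<times> {0<..<\<delta>}) (\<lambda>(\<phi>, \<rho>). angular_numerator P Q p q \<phi> \<rho>)"
    and angular_nonzero: "0 < \<rho> \<Longrightarrow> \<rho> < \<delta> \<Longrightarrow> angular_numerator P Q p q \<phi> \<rho> \<noteq> 0"
begin

lemma polar_orbitD:
  fixes \<phi> \<rho> :: "real \<Rightarrow> real"
  defines "w \<equiv> \<lambda>t. angular_numerator P Q p q (\<phi> t) (\<rho> t) / polar_jacobian p q (\<phi> t) (\<rho> t)"
  assumes orbit: "polar_orbit P Q p q d T \<phi> \<rho>" and d: "d \<le> \<delta>"
  shows "0 < T" and "t \<in> {0..T} \<Longrightarrow> 0 < \<rho> t \<and> \<rho> t < d"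
    and "t \<in> {0..T} \<Longrightarrow> (\<phi> has_real_derivative w t) (at t within {0..T})"
    and "t \<in> {0..T} \<Longrightarrow>
      (\<rho> has_real_derivative polar_F P Q p q (\<phi> t) (\<rho> t) * w t) (at t within {0..T})"
    and "continuous_on {0..T} w"
proof -
  show "0 < T" using orbit by (simp add: polar_orbit_def)
  have \<rho>: "0 < \<rho> t \<and> \<rho> t < d"
    and d\<phi>: "(\<phi> has_real_derivative w t) (at t within {0..T})"
    and d\<rho>: "(\<rho> has_real_derivative radial_numerator P Q p q (\<phi> t) (\<rho> t) / polar_jacobian p q (\<phi> t) (\<rho> t))
        (at t within {0..T})" if "t \<in> {0..T}" for t
    using orbit that unfolding polar_orbit_def w_def by blast+
  show "t \<in> {0..T} \<Longrightarrow> 0 < \<rho> t \<and> \<rho> t < d" by (rule \<rho>)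
  show "t \<in> {0..T} \<Longrightarrow> (\<phi> has_real_derivative w t) (at t within {0..T})" by (rule d\<phi>)
  show "(\<rho> has_real_derivative polar_F P Q p q (\<phi> t) (\<rho> t) * w t) (at t within {0..T})"
    if t: "t \<in> {0..T}"
    using d\<rho>[OF t] angular_nonzero[of "\<rho> t" "\<phi> t"] \<rho>[OF t] d
    by (simp add: polar_F_pos_radius[OF p_pos q_pos] w_def)
  have c: "continuous_on {0..T} \<phi>" "continuous_on {0..T} \<rho>"
    by (rule DERIV_continuous_on, erule d\<phi>) (rule DERIV_continuous_on, erule d\<rho>)
  show "continuous_on {0..T} w"
    unfolding w_def
  proof (intro continuous_on_divide ballI)
    have "continuous_on {0..T} (\<lambda>t. (\<lambda>(\<phi>, \<rho>). angular_numerator P Q p q \<phi> \<rho>) (\<phi> t, \<rho> t))"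
      using \<rho> d by (intro continuous_on_compose2[OF angular_cont] continuous_intros c) fastforce
    then show "continuous_on {0..T} (\<lambda>t. angular_numerator P Q p q (\<phi> t) (\<rho> t))" by simp
    show "continuous_on {0..T} (\<lambda>t. polar_jacobian p q (\<phi> t) (\<rho> t))"
      unfolding polar_jacobian_def by (intro continuous_intros c)
    show "polar_jacobian p q (\<phi> t) (\<rho> t) \<noteq> 0" if "t \<in> {0..T}" for t
      using polar_jacobian_pos[OF p_pos q_pos, of "\<rho> t" "\<phi> t"] \<rho>[OF that] by simp
  qed
qed

lemma V_periodic_int:
  assumes "0 < \<rho>" "\<rho> < \<delta>"
  shows "V (2 * pi * of_int n) \<rho> = V 0 \<rho>"
proof -
  have nat: "V (\<phi> + 2 * pi * of_nat k) \<rho> = V \<phi> \<rho>" for k \<phi>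
  proof (induction k)
    case (Suc k)
    have "V (\<phi> + 2 * pi * of_nat (Suc k)) \<rho> = V (\<phi> + 2 * pi * of_nat k + 2 * pi) \<rho>"
      by (simp add: algebra_simps)
    then show ?case using V_periodic[OF assms] Suc by simp
  qed simp
  show ?thesis
  proof (cases "0 \<le> n")
    case True
    then show ?thesis using nat[of 0 "nat n"] by simp
  next
    case False
    then show ?thesis using nat[of "2 * pi * of_int n" "nat (- n)"] by (simp add: algebra_simps)
  qed
qed

text \<open>
  Every point close to \<open>\<rho> = 0\<close> is joined by a monodromic orbit to a small point of the half-axis
  \<open>\<phi> = 0\<close>, up to the period of \<open>V\<close>.
\<close>

lemma zero_transfer:
  assumes "0 < d" "d \<le> \<delta>"
  shows "\<exists>d'>0. \<forall>f r. 0 < r \<and> r < d' \<longrightarrow> (\<exists>s. 0 < s \<and> s < d \<and> (V f r = 0 \<longleftrightarrow> V 0 s = 0))"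
proof -
  obtain d' where "0 < d'" and orb: "\<And>f r. 0 < r \<Longrightarrow> r < d' \<Longrightarrow>
    (\<exists>T \<phi> \<rho>. polar_orbit P Q p q d T \<phi> \<rho> \<and> \<phi> 0 = f \<and> \<rho> 0 = r \<and>
      (\<exists>t\<in>{0..T}. \<exists>n::int. \<phi> t = 2 * pi * of_int n))"
    using monodromic_polar_orbits[OF monodromic p_pos q_pos assms(1)] by meson
  have "\<exists>s. 0 < s \<and> s < d \<and> (V f r = 0 \<longleftrightarrow> V 0 s = 0)" if r: "0 < r" "r < d'" for f r
  proof -
    obtain T \<phi> \<rho> t and n :: int where orbit: "polar_orbit P Q p q d T \<phi> \<rho>"
      and start: "\<phi> 0 = f" "\<rho> 0 = r" and t: "t \<in> {0..T}" "\<phi> t = 2 * pi * of_int n"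
      using orb[OF r] by meson
    note D = polar_orbitD[OF orbit assms(2)]
    have \<rho>: "0 < \<rho> t \<and> \<rho> t < \<delta>" if "t \<in> {0..T}" for t
      using D(2)[OF that] assms(2) by simp
    have 0: "0 \<in> {0..T}" using D(1) by simp
    have "V (\<phi> 0) (\<rho> 0) = 0 \<longleftrightarrow> V (\<phi> t) (\<rho> t) = 0"
      using zero_along_solution[OF \<rho> D(3,4,5) 0 t(1)] zero_along_solution[OF \<rho> D(3,4,5) t(1) 0]
      by blast
    moreover have "V (\<phi> t) (\<rho> t) = V 0 (\<rho> t)"
      unfolding t(2) using V_periodic_int \<rho>[OF t(1)] by blast
    ultimately show ?thesis using D(2)[OF t(1)] start by (intro exI[of _ "\<rho> t"]) simp
  qed
  then show ?thesis using \<open>0 < d'\<close> by blast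
qed

lemma angular_sign:
  "(\<forall>\<phi> \<rho>. 0 < \<rho> \<and> \<rho> < \<delta> \<longrightarrow> 0 < angular_numerator P Q p q \<phi> \<rho>) \<or>
   (\<forall>\<phi> \<rho>. 0 < \<rho> \<and> \<rho> < \<delta> \<longrightarrow> angular_numerator P Q p q \<phi> \<rho> < 0)"
proof (rule ccontr)
  let ?A = "(\<lambda>(\<phi>, \<rho>). angular_numerator P Q p q \<phi> \<rho>) ` (UNIV \<times> {0<..<\<delta>})"
  assume "\<not> ?thesis"
  then obtain a b c e where ab: "0 < b" "b < \<delta>" "angular_numerator P Q p q a b \<le> 0"
    and ce: "0 < e" "e < \<delta>" "0 \<le> angular_numerator P Q p q c e"
    by (meson not_less)
  have "connected ?A"
    by (rule connected_continuous_image[OF angular_cont]) (auto intro: connected_Times)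
  moreover have "angular_numerator P Q p q a b \<in> ?A" "angular_numerator P Q p q c e \<in> ?A"
    using ab ce by (auto intro: image_eqI[of _ _ "(a, b)"] image_eqI[of _ _ "(c, e)"])
  ultimately have "{angular_numerator P Q p q a b..angular_numerator P Q p q c e} \<subseteq> ?A"
    by (rule connected_contains_Icc)
  then have "0 \<in> ?A" using ab(3) ce(3) by auto
  then show False using angular_nonzero by fastforce
qed

text \<open>
  The direction of rotation is that of the sign of the angular speed. An orbit that rotates
  positively runs from angle \<open>0\<close> to \<open>2\<pi>\<close>, and one that rotates negatively from \<open>2\<pi>\<close> to \<open>0\<close>; so it
  is the sign that decides from which end of a solution on \<open>[0, 2\<pi>]\<close> the comparison can start.
\<close>

lemma full_turn:
  assumes "0 < d" "d \<le> \<delta>"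
  shows "\<exists>d'>0. \<forall>r r'. 0 < r \<and> r < d' \<and> 0 < r' \<and> r' < d' \<longrightarrow>
    (\<exists>T \<phi> \<rho>. polar_orbit P Q p q d T \<phi> \<rho> \<and> \<phi> ` {0..T} = {0..2 * pi} \<and>
      (\<phi> 0 = 0 \<and> \<rho> 0 = r \<or> \<phi> 0 = 2 * pi \<and> \<rho> 0 = r'))"
proof -
  obtain d' where "0 < d'" and orb: "\<And>f r. 0 < r \<Longrightarrow> r < d' \<Longrightarrow>
    (\<exists>T \<phi> \<rho>. polar_orbit P Q p q d T \<phi> \<rho> \<and> \<phi> 0 = f \<and> \<rho> 0 = r \<and>
      (\<forall>n::int. f = 2 * pi * of_int n \<longrightarrow> \<bar>\<phi> T - f\<bar> = 2 * pi))"
    using monodromic_polar_orbits[OF monodromic p_pos q_pos assms(1)] by meson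
  have "\<exists>T \<phi> \<rho>. polar_orbit P Q p q d T \<phi> \<rho> \<and> \<phi> ` {0..T} = {0..2 * pi} \<and>
      (\<phi> 0 = 0 \<and> \<rho> 0 = r \<or> \<phi> 0 = 2 * pi \<and> \<rho> 0 = r')"
    if r: "0 < r" "r < d'" and r': "0 < r'" "r' < d'" for r r'
  proof -
    have J: "0 < polar_jacobian p q \<phi> \<rho>" if "0 < \<rho>" for \<phi> \<rho>
      using polar_jacobian_pos[OF p_pos q_pos that] .
    from angular_sign show ?thesis
    proof
      assume A: "\<forall>\<phi> \<rho>. 0 < \<rho> \<and> \<rho> < \<delta> \<longrightarrow> 0 < angular_numerator P Q p q \<phi> \<rho>"
      obtain T \<phi> \<rho> where orbit: "polar_orbit P Q p q d T \<phi> \<rho>" and start: "\<phi> 0 = 0" "\<rho> 0 = r"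
        and turn: "\<forall>n::int. 0 = 2 * pi * of_int n \<longrightarrow> \<bar>\<phi> T - 0\<bar> = 2 * pi"
        using orb[OF r, of 0] by (elim exE conjE) (rule that)
      note D = polar_orbitD[OF orbit assms(2)]
      have img: "\<phi> ` {0..T} = {\<phi> 0..\<phi> T}"
      proof (rule nondecreasing_image[OF _ D(3)])
        fix t assume t: "t \<in> {0..T}"
        have "0 < \<rho> t" "\<rho> t < \<delta>" using D(2)[OF t] assms(2) by auto
        then show "0 \<le> angular_numerator P Q p q (\<phi> t) (\<rho> t) / polar_jacobian p q (\<phi> t) (\<rho> t)"
          using A J[of "\<rho> t" "\<phi> t"] by (simp add: less_imp_le)
      qed (use D(1) in simp_all)
      have "T \<in> {0..T}" using D(1) by simp
      then have "\<phi> T \<in> {\<phi> 0..\<phi> T}" using img by blast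
      then have "\<phi> T = 2 * pi" using turn[THEN spec, of 0] start by auto
      then show ?thesis using orbit img start by metis
    next
      assume A: "\<forall>\<phi> \<rho>. 0 < \<rho> \<and> \<rho> < \<delta> \<longrightarrow> angular_numerator P Q p q \<phi> \<rho> < 0"
      obtain T \<phi> \<rho> where orbit: "polar_orbit P Q p q d T \<phi> \<rho>" and start: "\<phi> 0 = 2 * pi" "\<rho> 0 = r'"
        and turn: "\<forall>n::int. 2 * pi = 2 * pi * of_int n \<longrightarrow> \<bar>\<phi> T - 2 * pi\<bar> = 2 * pi"
        using orb[OF r', of "2 * pi"] by (elim exE conjE) (rule that)
      note D = polar_orbitD[OF orbit assms(2)]
      have img: "\<phi> ` {0..T} = {\<phi> T..\<phi> 0}"
      proof (rule nonincreasing_image[OF _ D(3)])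
        fix t assume t: "t \<in> {0..T}"
        have "0 < \<rho> t" "\<rho> t < \<delta>" using D(2)[OF t] assms(2) by auto
        then show "angular_numerator P Q p q (\<phi> t) (\<rho> t) / polar_jacobian p q (\<phi> t) (\<rho> t) \<le> 0"
          using A J[of "\<rho> t" "\<phi> t"] by (intro divide_nonpos_pos) (auto simp: less_imp_le)
      qed (use D(1) in simp_all)
      have "T \<in> {0..T}" using D(1) by simp
      then have "\<phi> T \<in> {\<phi> T..\<phi> 0}" using img by blast
      then have "\<phi> T = 0" using turn[THEN spec, of 1] start by auto
      then show ?thesis using orbit img start by metis
    qed
  qed
  then show ?thesis using \<open>0 < d'\<close> by blast
qed

end

lemma monodromic_strip_subset:
  assumes "monodromic_strip P Q p q V F1 V1 V2 \<delta>" "d \<le> \<delta>"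
  shows "monodromic_strip P Q p q V F1 V1 V2 d"
proof -
  interpret monodromic_strip P Q p q V F1 V1 V2 \<delta> by fact
  have sub: "UNIV \<times> {0<..<d} \<subseteq> UNIV \<times> {0<..<\<delta>}" using assms(2) by auto
  show ?thesis
  proof
    fix \<phi> \<rho> :: real assume "0 < \<rho>" "\<rho> < d"
    then have \<rho>: "0 < \<rho>" "\<rho> < \<delta>" using assms(2) by auto
    show "(polar_F P Q p q \<phi> has_real_derivative F1 (\<phi>, \<rho>)) (at \<rho>)" by (rule F_deriv[OF \<rho>])
    show "((\<lambda>(\<phi>, \<rho>). V \<phi> \<rho>) has_derivative (\<lambda>(a, b). a * V1 (\<phi>, \<rho>) + b * V2 (\<phi>, \<rho>))) (at (\<phi>, \<rho>))"
      by (rule V_deriv[OF \<rho>])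
    show "V (\<phi> + 2 * pi) \<rho> = V \<phi> \<rho>" by (rule V_periodic[OF \<rho>])
    show "V1 (\<phi>, \<rho>) + V2 (\<phi>, \<rho>) * polar_F P Q p q \<phi> \<rho> = F1 (\<phi>, \<rho>) * V \<phi> \<rho>" by (rule V_eq[OF \<rho>])
    show "angular_numerator P Q p q \<phi> \<rho> \<noteq> 0" by (rule angular_nonzero[OF \<rho>])
  next
    show "continuous_on (UNIV \<times> {0<..<d}) (\<lambda>(\<phi>, \<rho>). polar_F P Q p q \<phi> \<rho>)"
      by (rule continuous_on_subset[OF F_cont sub])
    show "continuous_on (UNIV \<times> {0<..<d}) F1" by (rule continuous_on_subset[OF F1_cont sub])
    show "continuous_on (UNIV \<times> {0<..<d}) V1" by (rule continuous_on_subset[OF V1_cont sub])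
    show "continuous_on (UNIV \<times> {0<..<d}) V2" by (rule continuous_on_subset[OF V2_cont sub])
    show "continuous_on (UNIV \<times> {0<..<d}) (\<lambda>(\<phi>, \<rho>). angular_numerator P Q p q \<phi> \<rho>)"
      by (rule continuous_on_subset[OF angular_cont sub])
    show "0 < p" "0 < q" "monodromic P Q" by (fact p_pos, fact q_pos, fact monodromic)
  qed
qed

locale nonvanishing_monodromic_strip =
  monodromic_strip P Q p q V F1 V1 V2 \<delta> +
  nonvanishing_inverse_integrating_factor "polar_F P Q p q" V F1 V1 V2 \<delta>
  for P Q :: "real \<Rightarrow> real \<Rightarrow> real" and p q :: nat and V :: "real \<Rightarrow> real \<Rightarrow> real"
    and F1 V1 V2 :: "real \<times> real \<Rightarrow> real" and \<delta> :: real
begin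

lemma small_transit_identity:
  assumes "0 < \<delta>"
    and g: "\<forall>r. 0 < r \<and> r < \<delta> \<longrightarrow> ((\<lambda>\<phi>. polar_F P Q p q \<phi> r / V \<phi> r) has_integral g) {0..2 * pi}"
  shows "\<exists>d'>0. \<forall>y. (\<forall>s\<in>{0..2 * pi}. 0 < y s \<and>
        (y has_real_derivative polar_F P Q p q s (y s)) (at s within {0..2 * pi})) \<and>
      y 0 < d' \<and> y (2 * pi) < d' \<longrightarrow>
    (\<exists>K. K (y (2 * pi)) - K (y 0) = g \<and>
      (\<forall>s. min (y 0) (y (2 * pi)) \<le> s \<and> s \<le> max (y 0) (y (2 * pi)) \<longrightarrow>
         V 0 s \<noteq> 0 \<and> (K has_real_derivative 1 / V 0 s) (at s)))"
proof -
  obtain d' where "0 < d'" and turn: "\<forall>r r'. 0 < r \<and> r < d' \<and> 0 < r' \<and> r' < d' \<longrightarrow>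
    (\<exists>T \<phi> \<rho>. polar_orbit P Q p q \<delta> T \<phi> \<rho> \<and> \<phi> ` {0..T} = {0..2 * pi} \<and>
      (\<phi> 0 = 0 \<and> \<rho> 0 = r \<or> \<phi> 0 = 2 * pi \<and> \<rho> 0 = r'))"
    using full_turn[OF assms(1) order_refl] by (elim exE conjE) (rule that)
  show ?thesis
  proof (rule exI[of _ d'], intro conjI allI impI, rule \<open>0 < d'\<close>)
    fix y assume y: "(\<forall>s\<in>{0..2 * pi}. 0 < y s \<and>
        (y has_real_derivative polar_F P Q p q s (y s)) (at s within {0..2 * pi})) \<and>
      y 0 < d' \<and> y (2 * pi) < d'"
    have pos: "0 < y s" and dy: "(y has_real_derivative polar_F P Q p q s (y s)) (at s within {0..2 * pi})"
      if "s \<in> {0..2 * pi}" for s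
      using y that by blast+
    have "0 < y 0" "0 < y (2 * pi)" by (rule pos, simp)+
    then have "0 < y 0 \<and> y 0 < d' \<and> 0 < y (2 * pi) \<and> y (2 * pi) < d'" using y by blast
    from turn[THEN spec[of _ "y 0"], THEN spec[of _ "y (2 * pi)"], THEN mp, OF this]
    obtain T \<phi> \<rho> where orbit: "polar_orbit P Q p q \<delta> T \<phi> \<rho>" and img: "\<phi> ` {0..T} = {0..2 * pi}"
      and start: "\<phi> 0 = 0 \<and> \<rho> 0 = y 0 \<or> \<phi> 0 = 2 * pi \<and> \<rho> 0 = y (2 * pi)"
      by (elim exE conjE) (rule that)
    note D = polar_orbitD[OF orbit order_refl]
    have start': "\<phi> 0 = 0 \<or> \<phi> 0 = 2 * pi" "\<rho> 0 = y (\<phi> 0)" using start by auto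
    have "y s < \<delta>" if "s \<in> {0..2 * pi}" for s
      by (rule solution_confined[OF pos dy less_imp_le[OF D(1)] img D(2,3,4) start' that])
    then show "\<exists>K. K (y (2 * pi)) - K (y 0) = g \<and>
      (\<forall>s. min (y 0) (y (2 * pi)) \<le> s \<and> s \<le> max (y 0) (y (2 * pi)) \<longrightarrow>
         V 0 s \<noteq> 0 \<and> (K has_real_derivative 1 / V 0 s) (at s))"
      by (intro transit_identity dy) (use pos g in auto)
  qed
qed

end

lemma monodromic_strip_exists:
  fixes P Q :: "real ^ 'd \<Rightarrow> real \<Rightarrow> real \<Rightarrow> real"
  assumes fam: "analytic_family P Q"
    and \<mu>: "\<mu> \<in> monodromic_parameters P Q - critical_parameters P Q p q"
    and pq: "0 < p" "0 < q" and "0 < \<epsilon>"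
    and iif: "inverse_integrating_factor (P \<mu>) (Q \<mu>) p q \<epsilon> V"
  shows "\<exists>\<delta> F1 V1 V2. 0 < \<delta> \<and> \<delta> \<le> \<epsilon> \<and> UNIV \<times> {0<..<\<delta>} \<subseteq> polar_domain (P \<mu>) (Q \<mu>) p q \<epsilon> \<and>
    monodromic_strip (P \<mu>) (Q \<mu>) p q V F1 V1 V2 \<delta>"
proof -
  have mono: "monodromic (P \<mu>) (Q \<mu>)" using \<mu> by (simp add: monodromic_parameters_def)
  obtain e where e: "0 < e" "\<And>\<phi> \<rho>. 0 < \<rho> \<Longrightarrow> \<rho> < e \<Longrightarrow> polar_Theta (P \<mu>) (Q \<mu>) p q \<phi> \<rho> \<noteq> 0"
    using \<mu> unfolding critical_parameters_def by auto
  note analytic = fam[unfolded analytic_family_def, THEN spec[of _ \<mu>]]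
  obtain r1 where r1: "0 < r1" "C1_on ({-r1<..<r1} \<times> {-r1<..<r1}) (P \<mu>)"
    using analytic_slice_C1[OF conjunct1[OF analytic]] by blast
  obtain r2 where r2: "0 < r2" "C1_on ({-r2<..<r2} \<times> {-r2<..<r2}) (Q \<mu>)"
    using analytic_slice_C1[OF conjunct2[OF analytic]] by blast
  define r where "r = min r1 r2"
  have r: "0 < r" using r1(1) r2(1) by (simp add: r_def)
  have P: "C1_on ({-r<..<r} \<times> {-r<..<r}) (P \<mu>)"
    by (rule C1_on_subset[OF r1(2)]) (auto simp: r_def)
  have Q: "C1_on ({-r<..<r} \<times> {-r<..<r}) (Q \<mu>)"
    by (rule C1_on_subset[OF r2(2)]) (auto simp: r_def)
  define \<delta> where "\<delta> = min (min e \<epsilon>) (min r 1)"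
  have \<delta>: "0 < \<delta>" "\<delta> \<le> 1" "\<delta> \<le> r" "\<delta> \<le> e" "\<delta> \<le> \<epsilon>"
    using e r \<open>0 < \<epsilon>\<close> by (auto simp: \<delta>_def)
  have nz: "angular_numerator (P \<mu>) (Q \<mu>) p q \<phi> \<rho> \<noteq> 0" if "0 < \<rho>" "\<rho> < \<delta>" for \<phi> \<rho>
    using e(2)[of \<rho> \<phi>] that \<delta> polar_Theta_eq_0_iff[OF pq that(1)] by auto
  have sub: "UNIV \<times> {0<..<\<delta>} \<subseteq> polar_domain (P \<mu>) (Q \<mu>) p q \<epsilon>"
    using e(2) \<delta> by (auto simp: polar_domain_def)
  have dom: "(\<phi>, \<rho>) \<in> polar_domain (P \<mu>) (Q \<mu>) p q \<epsilon>" if "0 < \<rho>" "\<rho> < \<delta>" for \<phi> \<rho>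
    using that sub by auto
  note C1 = polar_F_C1[OF pq \<delta>(1-3) P Q nz]
  obtain F1 where F1: "continuous_on (UNIV \<times> {0<..<\<delta>}) F1"
    "\<And>\<phi> \<rho>. \<rho> \<in> {0<..<\<delta>} \<Longrightarrow> (polar_F (P \<mu>) (Q \<mu>) p q \<phi> has_real_derivative F1 (\<phi>, \<rho>)) (at \<rho>)"
    using C1(2) by blast
  note iif' = iif[unfolded inverse_integrating_factor_def]
  note periodic = conjunct1[OF iif']
    and V_C1 = conjunct1[OF conjunct2[OF iif']]
    and pde = conjunct2[OF conjunct2[OF conjunct2[OF iif']]]
  obtain V1 V2 where V: "continuous_on (polar_domain (P \<mu>) (Q \<mu>) p q \<epsilon>) V1"
     "continuous_on (polar_domain (P \<mu>) (Q \<mu>) p q \<epsilon>) V2"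
     "\<forall>z\<in>polar_domain (P \<mu>) (Q \<mu>) p q \<epsilon>.
       ((\<lambda>(\<phi>, \<rho>). V \<phi> \<rho>) has_derivative (\<lambda>(a, b). a * V1 z + b * V2 z)) (at z)"
    using V_C1 by (elim exE conjE) (rule that)
  have "monodromic_strip (P \<mu>) (Q \<mu>) p q V F1 V1 V2 \<delta>"
  proof
    fix \<phi> \<rho> :: real assume \<rho>: "0 < \<rho>" "\<rho> < \<delta>"
    show dF: "(polar_F (P \<mu>) (Q \<mu>) p q \<phi> has_real_derivative F1 (\<phi>, \<rho>)) (at \<rho>)"
      using F1(2) \<rho> by simp
    show dV: "((\<lambda>(\<phi>, \<rho>). V \<phi> \<rho>) has_derivative (\<lambda>(a, b). a * V1 (\<phi>, \<rho>) + b * V2 (\<phi>, \<rho>))) (at (\<phi>, \<rho>))"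
      by (rule bspec[OF V(3) dom[OF \<rho>]])
    show "V (\<phi> + 2 * pi) \<rho> = V \<phi> \<rho>"
      using bspec[OF periodic dom[OF \<rho>]] by simp
    have "((\<lambda>s. (\<phi>, s)) has_derivative (\<lambda>h. (0, h))) (at \<rho>)"
      "((\<lambda>s. (s, \<rho>)) has_derivative (\<lambda>h. (h, 0))) (at \<phi>)"
      by (auto intro!: derivative_eq_intros)
    from has_derivative_compose[OF this(1) dV] has_derivative_compose[OF this(2) dV]
    have "(V \<phi> has_real_derivative V2 (\<phi>, \<rho>)) (at \<rho>)" "((\<lambda>s. V s \<rho>) has_real_derivative V1 (\<phi>, \<rho>)) (at \<phi>)"
      by (simp_all add: has_field_derivative_def mult_commute_abs)
    moreover have "deriv (\<lambda>s. V s \<rho>) \<phi> + deriv (\<lambda>s. V \<phi> s) \<rho> * polar_F (P \<mu>) (Q \<mu>) p q \<phi> \<rho>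
        = deriv (\<lambda>s. polar_F (P \<mu>) (Q \<mu>) p q \<phi> s) \<rho> * V \<phi> \<rho>"
      using bspec[OF pde dom[OF \<rho>]] by simp
    ultimately show "V1 (\<phi>, \<rho>) + V2 (\<phi>, \<rho>) * polar_F (P \<mu>) (Q \<mu>) p q \<phi> \<rho> = F1 (\<phi>, \<rho>) * V \<phi> \<rho>"
      using dF by (simp add: DERIV_imp_deriv)
    show "angular_numerator (P \<mu>) (Q \<mu>) p q \<phi> \<rho> \<noteq> 0" by (rule nz[OF \<rho>])
  next
    show "continuous_on (UNIV \<times> {0<..<\<delta>}) (\<lambda>(\<phi>, \<rho>). polar_F (P \<mu>) (Q \<mu>) p q \<phi> \<rho>)" by (rule C1(1))
    show "continuous_on (UNIV \<times> {0<..<\<delta>}) (\<lambda>(\<phi>, \<rho>). angular_numerator (P \<mu>) (Q \<mu>) p q \<phi> \<rho>)"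
      by (rule polar_numerators_C1(2)[OF pq \<delta>(1-3) P Q])
    show "continuous_on (UNIV \<times> {0<..<\<delta>}) F1" by (rule F1(1))
    show "continuous_on (UNIV \<times> {0<..<\<delta>}) V1" by (rule continuous_on_subset[OF V(1) sub])
    show "continuous_on (UNIV \<times> {0<..<\<delta>}) V2" by (rule continuous_on_subset[OF V(2) sub])
    show "0 < p" "0 < q" "monodromic (P \<mu>) (Q \<mu>)" by (rule pq mono)+
  qed
  then show ?thesis using \<delta> sub by blast
qed

lemma laurent_series_at:
  assumes "laurent_inverse_integrating_factor P Q p q \<epsilon> V v m"
    and "\<phi> \<notin> characteristic_directions P Q p q"
  shows "\<exists>r>0. \<forall>\<rho>. 0 < \<rho> \<and> \<rho> < r \<longrightarrow> ((\<lambda>i. v i \<phi> * \<rho> powi i) has_sum V \<phi> \<rho>) {m..}"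
  using assms(1)[unfolded laurent_inverse_integrating_factor_def, THEN conjunct2, THEN conjunct2,
      THEN conjunct1, THEN spec, THEN mp, OF assms(2)] .

text \<open>
  If the Laurent series at \<open>\<phi> = 0\<close> were zero, then \<open>V\<close> would vanish on a whole strip by
  \<open>zero_transfer\<close>, although it is not locally null. So its first nonzero term dominates on the
  half-axis \<open>\<phi> = 0\<close>, and \<open>zero_transfer\<close> extends this to all angles. The index of that term may
  exceed \<open>m\<close>.
\<close>

lemma nonvanishing_strip_exists:
  assumes strip: "monodromic_strip P Q p q V F1 V1 V2 \<delta>" and "0 < \<delta>"
    and sub: "UNIV \<times> {0<..<\<delta>} \<subseteq> polar_domain P Q p q \<epsilon>"
    and laurent: "laurent_inverse_integrating_factor P Q p q \<epsilon> V v m"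
    and "0 \<notin> characteristic_directions P Q p q"
  shows "\<exists>d>0. d \<le> \<delta> \<and> nonvanishing_monodromic_strip P Q p q V F1 V1 V2 d"
proof -
  interpret monodromic_strip P Q p q V F1 V1 V2 \<delta> by fact
  obtain r where r: "0 < r"
    and all: "\<forall>\<rho>. 0 < \<rho> \<and> \<rho> < r \<longrightarrow> ((\<lambda>i. v i 0 * \<rho> powi i) has_sum V 0 \<rho>) {m..}"
    using laurent_series_at[OF laurent assms(5)] by (elim exE conjE) (rule that)
  have series: "((\<lambda>i. v i 0 * \<rho> powi i) has_sum V 0 \<rho>) {m..}" if "0 < \<rho>" "\<rho> < r" for \<rho>
    using all that by simp
  have "\<exists>i\<ge>m. v i 0 \<noteq> 0"
  proof (rule ccontr)
    assume "\<not> (\<exists>i\<ge>m. v i 0 \<noteq> 0)"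
    then have zero: "v i 0 = 0" if "m \<le> i" for i using that by blast
    have V0: "V 0 \<rho> = 0" if "0 < \<rho>" "\<rho> < r" for \<rho>
    proof -
      have "((\<lambda>i. 0) has_sum V 0 \<rho>) {m..}"
        by (rule iffD1[OF has_sum_cong series[OF that]]) (simp add: zero)
      then show ?thesis using has_sum_unique[OF _ has_sum_0[of "{m..}" "\<lambda>_. 0"]] by blast
    qed
    obtain d where d: "0 < d" "\<And>f s. 0 < s \<Longrightarrow> s < d \<Longrightarrow> \<exists>t. 0 < t \<and> t < min \<delta> r \<and> (V f s = 0 \<longleftrightarrow> V 0 t = 0)"
      using zero_transfer[of "min \<delta> r"] \<open>0 < \<delta>\<close> r by auto
    define U where "U = (UNIV :: real set) \<times> {0<..<min d \<delta>}"
    have "open U" "U \<subseteq> polar_domain P Q p q \<epsilon>" using sub by (auto simp: U_def intro: open_Times)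
    moreover have "(0, min d \<delta> / 2) \<in> U" using d(1) \<open>0 < \<delta>\<close> by (auto simp: U_def min_def)
    then have "U \<noteq> {}" by blast
    moreover note conjunct1[OF conjunct2[OF conjunct2[OF
        conjunct1[OF laurent[unfolded laurent_inverse_integrating_factor_def], unfolded inverse_integrating_factor_def]]]]
    ultimately have "\<exists>(\<phi>, \<rho>)\<in>U. V \<phi> \<rho> \<noteq> 0" by simp
    then obtain f s where "(f, s) \<in> U" "V f s \<noteq> 0" by blast
    then show False using d(2)[of s f] V0 by (auto simp: U_def)
  qed
  from laurent_eventually_nonzero[OF r series this]
  obtain s where s: "0 < s" "\<And>\<rho>. 0 < \<rho> \<Longrightarrow> \<rho> < s \<Longrightarrow> V 0 \<rho> \<noteq> 0" by blast
  obtain d where d: "0 < d" "\<And>f t. 0 < t \<Longrightarrow> t < d \<Longrightarrow> \<exists>u. 0 < u \<and> u < min \<delta> s \<and> (V f t = 0 \<longleftrightarrow> V 0 u = 0)"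
    using zero_transfer[of "min \<delta> s"] \<open>0 < \<delta>\<close> s(1) by auto
  have nz: "V f t \<noteq> 0" if "0 < t" "t < min d \<delta>" for f t
    using d(2)[of t f] s(2) that by auto
  have sub_strip: "monodromic_strip P Q p q V F1 V1 V2 (min d \<delta>)"
    by (rule monodromic_strip_subset[OF strip]) simp
  have "nonvanishing_monodromic_strip P Q p q V F1 V1 V2 (min d \<delta>)"
    by (intro nonvanishing_monodromic_strip.intro nonvanishing_inverse_integrating_factor.intro
        nonvanishing_inverse_integrating_factor_axioms.intro sub_strip
        monodromic_strip.axioms(1)[OF sub_strip] nz)
  then show ?thesis using d(1) \<open>0 < \<delta>\<close> by (intro exI[of _ "min d \<delta>"]) auto
qed

section \<open>The first nontrivial coefficient of the Poincare map\<close>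

theorem theorem7:
  fixes P Q :: "real ^ 'd \<Rightarrow> real \<Rightarrow> real \<Rightarrow> real"
    and \<mu> :: "real ^ 'd"
    and p q :: nat
    and \<epsilon> :: real
    and V :: "real \<Rightarrow> real \<Rightarrow> real"
    and v :: "int \<Rightarrow> real \<Rightarrow> real"
    and m :: int
  assumes "analytic_family P Q"
    and "\<mu> \<in> monodromic_parameters P Q - critical_parameters P Q p q"
    and "(p, q) \<in> newton_weights (P \<mu>) (Q \<mu>)"
    and "0 \<notin> characteristic_directions (P \<mu>) (Q \<mu>) p q"
    and "0 < \<epsilon>"
    and "laurent_inverse_integrating_factor (P \<mu>) (Q \<mu>) p q \<epsilon> V v m"
  shows "\<exists>g::real.
    (\<exists>\<delta>>0. \<delta> \<le> \<epsilon> \<and> (\<forall>r. 0 < r \<and> r < \<delta> \<longrightarrow>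
       ((\<lambda>\<phi>. polar_F (P \<mu>) (Q \<mu>) p q \<phi> r / V \<phi> r) has_integral g) {0..2 * pi})) \<and>
    (\<forall>\<Phi> \<eta>. polar_flow (P \<mu>) (Q \<mu>) p q \<epsilon> \<Phi> \<and> formal_expansion (\<Phi> (2 * pi)) \<eta> \<longrightarrow>
       (m = 1 \<longrightarrow> 0 < \<eta> 1 \<and> ln (\<eta> 1) = v m 0 * g) \<and>
       (m > 1 \<longrightarrow> \<eta> (nat m) = v m 0 * g))"
proof -
  have pq: "0 < p" "0 < q" using assms(3) by (auto simp: newton_weights_def)
  have iif: "inverse_integrating_factor (P \<mu>) (Q \<mu>) p q \<epsilon> V"
    using assms(6) by (simp add: laurent_inverse_integrating_factor_def)
  obtain \<delta>\<^sub>0 F1 V1 V2 where \<delta>\<^sub>0: "0 < \<delta>\<^sub>0" "\<delta>\<^sub>0 \<le> \<epsilon>" "UNIV \<times> {0<..<\<delta>\<^sub>0} \<subseteq> polar_domain (P \<mu>) (Q \<mu>) p q \<epsilon>"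
    "monodromic_strip (P \<mu>) (Q \<mu>) p q V F1 V1 V2 \<delta>\<^sub>0"
    using monodromic_strip_exists[OF assms(1,2) pq assms(5) iif] by blast
  obtain \<delta> where \<delta>: "0 < \<delta>" "\<delta> \<le> \<delta>\<^sub>0" "nonvanishing_monodromic_strip (P \<mu>) (Q \<mu>) p q V F1 V1 V2 \<delta>"
    using nonvanishing_strip_exists[OF \<delta>\<^sub>0(4,1,3) assms(6,4)] by blast
  interpret nonvanishing_monodromic_strip "P \<mu>" "Q \<mu>" p q V F1 V1 V2 \<delta> by (rule \<delta>(3))
  obtain g where g: "\<forall>r. 0 < r \<and> r < \<delta> \<longrightarrow>
      ((\<lambda>\<phi>. polar_F (P \<mu>) (Q \<mu>) p q \<phi> r / V \<phi> r) has_integral g) {0..2 * pi}"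
    using integral_constant by (elim exE) (rule that)
  obtain d where d: "0 < d" and transit: "\<forall>y. (\<forall>s\<in>{0..2 * pi}. 0 < y s \<and>
        (y has_real_derivative polar_F (P \<mu>) (Q \<mu>) p q s (y s)) (at s within {0..2 * pi})) \<and>
      y 0 < d \<and> y (2 * pi) < d \<longrightarrow>
    (\<exists>K. K (y (2 * pi)) - K (y 0) = g \<and>
      (\<forall>s. min (y 0) (y (2 * pi)) \<le> s \<and> s \<le> max (y 0) (y (2 * pi)) \<longrightarrow>
         V 0 s \<noteq> 0 \<and> (K has_real_derivative 1 / V 0 s) (at s)))"
    using small_transit_identity[OF \<delta>(1) g] by (elim exE conjE) (rule that)
  obtain \<rho>\<^sub>1 where \<rho>\<^sub>1: "0 < \<rho>\<^sub>1"
    and series: "\<forall>\<rho>. 0 < \<rho> \<and> \<rho> < \<rho>\<^sub>1 \<longrightarrow> ((\<lambda>i. v i 0 * \<rho> powi i) has_sum V 0 \<rho>) {m..}"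
    using laurent_series_at[OF assms(6,4)] by (elim exE conjE) (rule that)
  note leading = laurent_leading_tendsto[OF \<rho>\<^sub>1 series[THEN spec, THEN mp, OF conjI]]
  have "(m = 1 \<longrightarrow> 0 < \<eta> 1 \<and> ln (\<eta> 1) = v m 0 * g) \<and> (m > 1 \<longrightarrow> \<eta> (nat m) = v m 0 * g)"
    if flow: "polar_flow (P \<mu>) (Q \<mu>) p q \<epsilon> \<Phi>" and \<eta>: "formal_expansion (\<Phi> (2 * pi)) \<eta>" for \<Phi> \<eta>
  proof (cases "1 \<le> m")
    case True
    define M where "M = nat m"
    have M: "m = int M" using True by (simp add: M_def)
    have lead: "((\<lambda>\<rho>. V 0 \<rho> / \<rho> ^ M) \<longlongrightarrow> v m 0) (at_right 0)"
      using leading by (simp add: M)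
    have to0: "(\<Phi> (2 * pi) \<longlongrightarrow> 0) (at_right 0)" by (rule formal_expansion_tendsto_0[OF \<eta>])
    obtain e where e: "0 < e" and sol: "\<forall>r. 0 < r \<and> r < e \<longrightarrow> \<Phi> 0 r = r \<and>
        (\<forall>\<phi>\<in>{0..2 * pi}. (\<phi>, \<Phi> \<phi> r) \<in> polar_domain (P \<mu>) (Q \<mu>) p q \<epsilon> \<and>
           ((\<lambda>s. \<Phi> s r) has_real_derivative polar_F (P \<mu>) (Q \<mu>) p q \<phi> (\<Phi> \<phi> r)) (at \<phi> within {0..2 * pi}))"
      using flow unfolding polar_flow_def by (elim exE conjE) (rule that)
    have "\<forall>\<^sub>F r in at_right 0. r \<in> {0<..<min d e}"
      using d e by (intro eventually_at_right_real) simp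
    moreover have "\<forall>\<^sub>F r in at_right 0. \<Phi> (2 * pi) r < d"
      using order_tendstoD(2)[OF to0 d] .
    ultimately have key: "\<forall>\<^sub>F r in at_right 0. 0 < \<Phi> (2 * pi) r \<and> (\<exists>K. K (\<Phi> (2 * pi) r) - K r = g \<and>
       (\<forall>s. min r (\<Phi> (2 * pi) r) \<le> s \<and> s \<le> max r (\<Phi> (2 * pi) r) \<longrightarrow>
          V 0 s \<noteq> 0 \<and> (K has_real_derivative 1 / V 0 s) (at s)))"
    proof eventually_elim
      case (elim r)
      then have r: "0 < r" "r < e" "r < d" by auto
      note sol_r = sol[THEN spec, THEN mp, OF conjI, OF r(1,2)]
      have \<Phi>0: "\<Phi> 0 r = r" using sol_r by (rule conjunct1)
      have y: "\<forall>s\<in>{0..2 * pi}. 0 < \<Phi> s r \<and>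
          ((\<lambda>s. \<Phi> s r) has_real_derivative polar_F (P \<mu>) (Q \<mu>) p q s (\<Phi> s r)) (at s within {0..2 * pi})"
        using sol_r by (auto simp: polar_domain_def)
      have "\<Phi> 0 r < d" "\<Phi> (2 * pi) r < d" using \<Phi>0 r(3) elim(2) by simp_all
      with transit[THEN spec[of _ "\<lambda>s. \<Phi> s r"], THEN mp] y
      have "\<exists>K. K (\<Phi> (2 * pi) r) - K (\<Phi> 0 r) = g \<and>
        (\<forall>s. min (\<Phi> 0 r) (\<Phi> (2 * pi) r) \<le> s \<and> s \<le> max (\<Phi> 0 r) (\<Phi> (2 * pi) r) \<longrightarrow>
           V 0 s \<noteq> 0 \<and> (K has_real_derivative 1 / V 0 s) (at s))" by blast
      moreover have "0 < \<Phi> (2 * pi) r" using y by simp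
      ultimately show ?case unfolding \<Phi>0 by (intro conjI)
    qed
    note asym = poincare_map_asymptotics[OF to0 key lead]
    show ?thesis
    proof (intro conjI impI)
      assume "m = 1"
      then have "\<eta> 1 = exp (g * v m 0)"
        using formal_expansion_coefficients(1)[OF \<eta> asym(1)] by (simp add: M)
      then show "0 < \<eta> 1" "ln (\<eta> 1) = v m 0 * g" by simp_all
    next
      assume "1 < m"
      then have "1 < M" by (simp add: M)
      from formal_expansion_coefficients(2)[OF \<eta> this asym(2)[OF this]]
      show "\<eta> (nat m) = v m 0 * g" by (simp add: M_def mult.commute)
    qed
  qed auto
  moreover have "\<delta> \<le> \<epsilon>" using \<delta>(2) \<delta>\<^sub>0(2) by simp
  ultimately show ?thesis using g \<delta>(1) by blast
qed

end
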